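(* Let $\Omega\subset\mathbb{R}^d$ be convex and compact with non-empty interior, and let $\mathcal{H}$ be equal to the (fractional) Sobolev space $H^m=H^m(\Omega)$ with equivalent norms. Let $\alpha\in\mathbb{N}^d$ be a multi-index and suppose $m>d/2+|\alpha|$. Suppose the design satisfies the norm-comparison property and $\lambda\gtrsim n^{-2m/d}$. Then $$\sup_{x\in\Omega}\big|\mathbb{E}_ED^\alpha\hat f(x)-D^\alpha f(x)\big|=O_{\mathbb P}\Big(\lambda^{\frac12-\frac{d+2|\alpha|}{4m}}\|f\|_{\mathcal H}\Big).$$
   Context: Setting: $K$ is a reproducing kernel on $\Omega\subset\mathbb{R}^d$ with reproducing kernel Hilbert space $\mathcal{H}$ (norm $\|\cdot\|_{\mathcal H}$). For each $n$ there are design points $x_1,\dots,x_n\in\Omega$ (deterministic or random, may depend on $n$) and data $y_i=f(x_i)+e_i$, with $f\in\mathcal{H}$ and $e_1,e_2,\dots$ i.i.d. with mean zero and finite variance $\sigma^2$; the errors are independent of the design. Write $X=(x_1,\dots,x_n)^T$, $E=(e_1,\dots,e_n)^T$. The smoothing parameter $\lambda=\lambda_n>0$ is deterministic; $\lambda$ and $f$ may depend on $n$. Asymptotics are as $n\to\infty$. The kernel ridge regression (KRR) estimator is $\hat f=\operatorname{argmin}_{v\in\mathcal{H}}\frac1n\sum_{i=1}^n(y_i-v(x_i))^2+\lambda\|v\|_{\mathcal{H}}^2$. $D^\alpha$ is the partial derivative with multi-index $\alpha$, of total order $|\alpha|$. $\mathbb{E}_E$ is expectation with respect to $E$ only ($X$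 held fixed). Also $\|v\|_n^2=\frac1n\sum_{i=1}^n v(x_i)^2$, and $\|\cdot\|_{L_2}$ is the $L_2(\Omega)$ norm. $a_n\gtrsim b_n$ means $b_n/a_n$ is bounded (in probability). Norm-comparison property of the design: $X$, if random, is independent of $E$; and there is $C_1>0$, and for each $\epsilon>0$ a $C_\epsilon>0$, all independent of $n$ and $X$, such that $\mathbb{P}(\Xi_\epsilon)\ge1-\epsilon$, where $\Xi_\epsilon$ is the event that, for all $v\in\mathcal H$, $\|v\|_{L_2}\le\max\{C_1\|v\|_n,C_\epsilon n^{-m/d}\|v\|_{\mathcal H}\}$ and $\|v\|_n\le\max\{C_1\|v\|_{L_2},C_\epsilon n^{-m/d}\|v\|_{\mathcal H}\}$ (for deterministic $X$ these inequalities hold unconditionally). *)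

theory Defs
  imports "HOL-Probability.Probability"
begin

section \<open>Partial derivatives\<close>

text \<open>
  Derivatives are taken relative to a set \<open>S\<close>. The Frechet derivative within \<open>S\<close>
  (rather than a one-dimensional derivative along a coordinate line, which may meet \<open>S\<close> in a
  single point only) is used so that partial derivatives also make sense at boundary points.
  If \<open>S\<close> is convex with non-empty interior, the derivative within \<open>S\<close> is unique, and for
  functions that are continuously differentiable up to the boundary it is the continuous
  extension of the derivative in the interior.
\<close>

definition partial_deriv ::
    "(real ^ 'd) set \<Rightarrow> 'd \<Rightarrow> (real ^ 'd \<Rightarrow> real) \<Rightarrow> real ^ 'd \<Rightarrow> real" where
  "partial_deriv S i f x = frechet_derivative f (at x within S) (axis i 1)"

primrec iter_partial_deriv ::
    "(real ^ 'd) set \<Rightarrow> 'd list \<Rightarrow> (real ^ 'd \<Rightarrow> real) \<Rightarrow> real ^ 'd \<Rightarrow> real" where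
  "iter_partial_deriv S [] f = f"
| "iter_partial_deriv S (i # js) f = partial_deriv S i (iter_partial_deriv S js f)"

definition mi_order :: "nat ^ 'd \<Rightarrow> nat" where
  "mi_order \<alpha> = (\<Sum>i\<in>UNIV. \<alpha> $ i)"

text \<open>
  The index type carries no order, so some enumeration of the multi-index is chosen; for
  functions with continuous derivatives of order \<open>mi_order \<alpha>\<close> the choice is irrelevant.
\<close>

definition multi_deriv ::
    "(real ^ 'd) set \<Rightarrow> nat ^ 'd \<Rightarrow> (real ^ 'd \<Rightarrow> real) \<Rightarrow> real ^ 'd \<Rightarrow> real" where
  "multi_deriv S \<alpha> f = iter_partial_deriv S (SOME js. \<forall>i. count_list js i = \<alpha> $ i) f"


section \<open>Fractional Sobolev spaces\<close>

definition square_integrable :: "(real ^ 'd) set \<Rightarrow> (real ^ 'd \<Rightarrow> real) \<Rightarrow> bool" where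
  "square_integrable \<Omega> v \<longleftrightarrow>
     v \<in> borel_measurable (lebesgue_on \<Omega>) \<and> integrable (lebesgue_on \<Omega>) (\<lambda>x. (v x)\<^sup>2)"

definition norm_L2 :: "(real ^ 'd) set \<Rightarrow> (real ^ 'd \<Rightarrow> real) \<Rightarrow> real" where
  "norm_L2 \<Omega> v = sqrt (LINT x|lebesgue_on \<Omega>. (v x)\<^sup>2)"

text \<open>Infinitely differentiable functions with compact support in \<open>U\<close>.\<close>

definition test_function :: "(real ^ 'd) set \<Rightarrow> (real ^ 'd \<Rightarrow> real) \<Rightarrow> bool" where
  "test_function U \<phi> \<longleftrightarrow>
     (\<forall>js. iter_partial_deriv UNIV js \<phi> differentiable_on UNIV) \<and>
     compact (closure {x. \<phi> x \<noteq> 0}) \<and> closure {x. \<phi> x \<noteq> 0} \<subseteq> U"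

definition is_weak_deriv ::
    "(real ^ 'd) set \<Rightarrow> nat ^ 'd \<Rightarrow> (real ^ 'd \<Rightarrow> real) \<Rightarrow> (real ^ 'd \<Rightarrow> real) \<Rightarrow> bool" where
  "is_weak_deriv \<Omega> \<beta> v g \<longleftrightarrow>
     square_integrable \<Omega> g \<and>
     (\<forall>\<phi>. test_function (interior \<Omega>) \<phi> \<longrightarrow>
        (LINT x|lebesgue_on \<Omega>. v x * multi_deriv UNIV \<beta> \<phi> x) =
        (- 1) ^ mi_order \<beta> * (LINT x|lebesgue_on \<Omega>. g x * \<phi> x))"

text \<open>
  On the interior of \<open>\<Omega>\<close> the weak derivative is unique up to null sets; the quantities below
  do not depend on the choice of the representative as long as the boundary of \<open>\<Omega>\<close> is a null set,
  which holds for convex \<open>\<Omega>\<close>.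
\<close>

definition weak_deriv ::
    "(real ^ 'd) set \<Rightarrow> nat ^ 'd \<Rightarrow> (real ^ 'd \<Rightarrow> real) \<Rightarrow> real ^ 'd \<Rightarrow> real" where
  "weak_deriv \<Omega> \<beta> v = (SOME g. is_weak_deriv \<Omega> \<beta> v g)"

text \<open>Square of the Sobolev--Slobodeckij (Gagliardo) seminorm of order \<open>s\<close>, \<open>0 < s < 1\<close>.\<close>

definition slobodeckij_energy ::
    "(real ^ 'd) set \<Rightarrow> real \<Rightarrow> (real ^ 'd \<Rightarrow> real) \<Rightarrow> ennreal" where
  "slobodeckij_energy \<Omega> s g =
     (\<integral>\<^sup>+ x. (\<integral>\<^sup>+ y. ennreal ((g x - g y)\<^sup>2 / norm (x - y) powr (real CARD('d) + 2 * s))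
        \<partial>lebesgue_on \<Omega>) \<partial>lebesgue_on \<Omega>)"

definition sobolev_space :: "real \<Rightarrow> (real ^ 'd) set \<Rightarrow> (real ^ 'd \<Rightarrow> real) set" where
  "sobolev_space m \<Omega> =
     {v. square_integrable \<Omega> v \<and>
         (\<forall>\<beta>. mi_order \<beta> \<le> nat \<lfloor>m\<rfloor> \<longrightarrow> (\<exists>g. is_weak_deriv \<Omega> \<beta> v g)) \<and>
         (frac m > 0 \<longrightarrow> (\<forall>\<beta>. mi_order \<beta> = nat \<lfloor>m\<rfloor> \<longrightarrow>
            slobodeckij_energy \<Omega> (frac m) (weak_deriv \<Omega> \<beta> v) < \<infinity>))}"

definition sobolev_norm :: "real \<Rightarrow> (real ^ 'd) set \<Rightarrow> (real ^ 'd \<Rightarrow> real) \<Rightarrow> real" where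
  "sobolev_norm m \<Omega> v = sqrt
     ((\<Sum>\<beta> | mi_order \<beta> \<le> nat \<lfloor>m\<rfloor>. (norm_L2 \<Omega> (weak_deriv \<Omega> \<beta> v))\<^sup>2) +
      (if frac m > 0
       then (\<Sum>\<beta> | mi_order \<beta> = nat \<lfloor>m\<rfloor>.
               enn2real (slobodeckij_energy \<Omega> (frac m) (weak_deriv \<Omega> \<beta> v)))
       else 0))"


section \<open>Reproducing kernel Hilbert spaces\<close>

text \<open>
  Functions on \<open>\<Omega>\<close> are represented by total functions that vanish outside \<open>\<Omega>\<close>.
\<close>

locale rkhs =
  fixes \<Omega> :: "'a set"
    and K :: "'a \<Rightarrow> 'a \<Rightarrow> real"
    and H :: "('a \<Rightarrow> real) set"
    and ip :: "('a \<Rightarrow> real) \<Rightarrow> ('a \<Rightarrow> real) \<Rightarrow> real"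
  assumes vanishes_outside: "v \<in> H \<Longrightarrow> x \<notin> \<Omega> \<Longrightarrow> v x = 0"
    and zero_mem: "(\<lambda>_. 0) \<in> H"
    and add_mem: "u \<in> H \<Longrightarrow> v \<in> H \<Longrightarrow> (\<lambda>x. u x + v x) \<in> H"
    and scale_mem: "v \<in> H \<Longrightarrow> (\<lambda>x. c * v x) \<in> H"
    and ip_commute: "u \<in> H \<Longrightarrow> v \<in> H \<Longrightarrow> ip u v = ip v u"
    and ip_add_left: "u \<in> H \<Longrightarrow> v \<in> H \<Longrightarrow> w \<in> H \<Longrightarrow>
                        ip (\<lambda>x. u x + v x) w = ip u w + ip v w"
    and ip_scale_left: "u \<in> H \<Longrightarrow> v \<in> H \<Longrightarrow> ip (\<lambda>x. c * u x) v = c * ip u v"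
    and ip_nonneg: "v \<in> H \<Longrightarrow> 0 \<le> ip v v"
    and ip_eq_0: "v \<in> H \<Longrightarrow> ip v v = 0 \<Longrightarrow> v = (\<lambda>_. 0)"
    and complete: "(\<And>k. vs k \<in> H) \<Longrightarrow>
          (\<forall>\<epsilon>>0. \<exists>N. \<forall>i\<ge>N. \<forall>j\<ge>N.
             sqrt (ip (\<lambda>x. vs i x - vs j x) (\<lambda>x. vs i x - vs j x)) < \<epsilon>) \<Longrightarrow>
          \<exists>v\<in>H. (\<lambda>k. sqrt (ip (\<lambda>x. vs k x - v x) (\<lambda>x. vs k x - v x))) \<longlonglongrightarrow> 0"
    and kernel_mem: "x \<in> \<Omega> \<Longrightarrow> K x \<in> H"
    and reproducing: "v \<in> H \<Longrightarrow> x \<in> \<Omega> \<Longrightarrow> ip v (K x) = v x"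

definition ip_norm :: "(('a \<Rightarrow> real) \<Rightarrow> ('a \<Rightarrow> real) \<Rightarrow> real) \<Rightarrow> ('a \<Rightarrow> real) \<Rightarrow> real" where
  "ip_norm ip v = sqrt (ip v v)"

text \<open>
  \<open>H\<close> is the Sobolev space of order \<open>m\<close> with an equivalent norm. Elements of a Sobolev space with
  \<open>m > d / 2\<close> are identified with their continuous representatives; for the elements of \<open>H\<close>,
  point values matter.
\<close>

definition is_sobolev_space ::
    "real \<Rightarrow> (real ^ 'd) set \<Rightarrow> (real ^ 'd \<Rightarrow> real) set \<Rightarrow>
     ((real ^ 'd \<Rightarrow> real) \<Rightarrow> (real ^ 'd \<Rightarrow> real) \<Rightarrow> real) \<Rightarrow> bool" where
  "is_sobolev_space m \<Omega> H ip \<longleftrightarrow>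
     H = {v \<in> sobolev_space m \<Omega>. continuous_on \<Omega> v \<and> (\<forall>x. x \<notin> \<Omega> \<longrightarrow> v x = 0)} \<and>
     (\<exists>c>0. \<exists>C>0. \<forall>v\<in>H. c * sobolev_norm m \<Omega> v \<le> ip_norm ip v \<and>
                              ip_norm ip v \<le> C * sobolev_norm m \<Omega> v)"


section \<open>Kernel ridge regression\<close>

text \<open>Design points and data are indexed by \<open>{1..n}\<close>.\<close>

definition krr_objective ::
    "(('a \<Rightarrow> real) \<Rightarrow> ('a \<Rightarrow> real) \<Rightarrow> real) \<Rightarrow> nat \<Rightarrow> real \<Rightarrow>
     (nat \<Rightarrow> 'a) \<Rightarrow> (nat \<Rightarrow> real) \<Rightarrow> ('a \<Rightarrow> real) \<Rightarrow> real" where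
  "krr_objective ip n l x y v =
     1 / real n * (\<Sum>i=1..n. (y i - v (x i))\<^sup>2) + l * (ip_norm ip v)\<^sup>2"

definition krr ::
    "('a \<Rightarrow> real) set \<Rightarrow> (('a \<Rightarrow> real) \<Rightarrow> ('a \<Rightarrow> real) \<Rightarrow> real) \<Rightarrow> nat \<Rightarrow> real \<Rightarrow>
     (nat \<Rightarrow> 'a) \<Rightarrow> (nat \<Rightarrow> real) \<Rightarrow> 'a \<Rightarrow> real" where
  "krr H ip n l x y = arg_min (krr_objective ip n l x y) (\<lambda>v. v \<in> H)"

definition empirical_norm :: "nat \<Rightarrow> (nat \<Rightarrow> 'a) \<Rightarrow> ('a \<Rightarrow> real) \<Rightarrow> real" where
  "empirical_norm n x v = sqrt (1 / real n * (\<Sum>i=1..n. (v (x i))\<^sup>2))"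

definition iid_errors :: "'w measure \<Rightarrow> real \<Rightarrow> (nat \<Rightarrow> 'w \<Rightarrow> real) \<Rightarrow> bool" where
  "iid_errors M \<sigma> e \<longleftrightarrow>
     prob_space.indep_vars M (\<lambda>_. borel) e {1..} \<and>
     (\<forall>i\<ge>1. distr M borel (e i) = distr M borel (e 1)) \<and>
     (\<forall>i\<ge>1. integrable M (\<lambda>\<omega>. (e i \<omega>)\<^sup>2)) \<and>
     (\<forall>i\<ge>1. prob_space.expectation M (e i) = 0) \<and>
     (\<forall>i\<ge>1. prob_space.variance M (e i) = \<sigma>\<^sup>2)"

text \<open>
  \<open>X n i\<close> is the \<open>i\<close>-th of the \<open>n\<close> design points; a deterministic design is the
  special case of constant random variables.
\<close>

definition is_design ::
    "'w measure \<Rightarrow> 'a::topological_space set \<Rightarrow> (nat \<Rightarrow> nat \<Rightarrow> 'w \<Rightarrow> 'a) \<Rightarrow> bool" where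
  "is_design M \<Omega> X \<longleftrightarrow>
     (\<forall>n. \<forall>i\<in>{1..n}. X n i \<in> borel_measurable M \<and> (\<forall>\<omega>\<in>space M. X n i \<omega> \<in> \<Omega>))"

text \<open>
  Independence of the sigma-algebras generated by the two random vectors
  (\<open>indep_var\<close> requires both to have the same type).
\<close>

definition design_indep_errors ::
    "'w measure \<Rightarrow> (nat \<Rightarrow> nat \<Rightarrow> 'w \<Rightarrow> 'a::topological_space) \<Rightarrow> (nat \<Rightarrow> 'w \<Rightarrow> real) \<Rightarrow> bool" where
  "design_indep_errors M X e \<longleftrightarrow>
     (\<forall>n. prob_space.indep_set M
        (sets (vimage_algebra (space M) (\<lambda>\<omega>. \<lambda>i\<in>{1..n}. X n i \<omega>) (Pi\<^sub>M {1..n} (\<lambda>_. borel))))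
        (sets (vimage_algebra (space M) (\<lambda>\<omega>. \<lambda>i\<in>{1..n}. e i \<omega>) (Pi\<^sub>M {1..n} (\<lambda>_. borel)))))"

definition norm_comparison ::
    "'w measure \<Rightarrow> (real ^ 'd) set \<Rightarrow> (real ^ 'd \<Rightarrow> real) set \<Rightarrow>
     ((real ^ 'd \<Rightarrow> real) \<Rightarrow> (real ^ 'd \<Rightarrow> real) \<Rightarrow> real) \<Rightarrow> real \<Rightarrow>
     (nat \<Rightarrow> nat \<Rightarrow> 'w \<Rightarrow> real ^ 'd) \<Rightarrow> bool" where
  "norm_comparison M \<Omega> H ip m X \<longleftrightarrow>
     (\<exists>C1>0. \<forall>\<epsilon>>0. \<exists>C>0. \<forall>n\<ge>1.
        measure M {\<omega> \<in> space M. \<forall>v\<in>H.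
            norm_L2 \<Omega> v \<le> max (C1 * empirical_norm n (\<lambda>i. X n i \<omega>) v)
                                (C * real n powr (- m / real CARD('d)) * ip_norm ip v) \<and>
            empirical_norm n (\<lambda>i. X n i \<omega>) v \<le>
                            max (C1 * norm_L2 \<Omega> v)
                                (C * real n powr (- m / real CARD('d)) * ip_norm ip v)}
        \<ge> 1 - \<epsilon>)"

text \<open>
  Expectation with respect to the errors only: the design is frozen at its realisation
  at \<open>\<omega>\<close>, and the errors are integrated out.
\<close>

definition errors_mean_krr_deriv ::
    "'w measure \<Rightarrow> (real ^ 'd) set \<Rightarrow> (real ^ 'd \<Rightarrow> real) set \<Rightarrow>
     ((real ^ 'd \<Rightarrow> real) \<Rightarrow> (real ^ 'd \<Rightarrow> real) \<Rightarrow> real) \<Rightarrow> nat ^ 'd \<Rightarrow> nat \<Rightarrow> real \<Rightarrow>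
     (real ^ 'd \<Rightarrow> real) \<Rightarrow> (nat \<Rightarrow> 'w \<Rightarrow> real ^ 'd) \<Rightarrow> (nat \<Rightarrow> 'w \<Rightarrow> real) \<Rightarrow>
     'w \<Rightarrow> real ^ 'd \<Rightarrow> real" where
  "errors_mean_krr_deriv M \<Omega> H ip \<alpha> n l f X e \<omega> x =
     (LINT \<omega>'|M. multi_deriv \<Omega> \<alpha>
        (krr H ip n l (\<lambda>i. X i \<omega>) (\<lambda>i. f (X i \<omega>) + e i \<omega>')) x)"

text \<open>
  \<open>Z n\<close> is stochastically bounded by \<open>r n\<close> as \<open>n\<close> tends to infinity. If \<open>Z n\<close> is measurable,
  the inner condition says that \<open>\<bar>Z n\<bar> \<le> C * r n\<close> has probability at least \<open>1 - \<epsilon>\<close>; otherwise it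
  is the usual version with inner probability.
\<close>

definition bigo_in_prob :: "'w measure \<Rightarrow> (nat \<Rightarrow> 'w \<Rightarrow> ereal) \<Rightarrow> (nat \<Rightarrow> real) \<Rightarrow> bool" where
  "bigo_in_prob M Z r \<longleftrightarrow>
     (\<forall>\<epsilon>>0. \<exists>C. \<forall>\<^sub>F n in sequentially.
        \<exists>A\<in>sets M. measure M A \<ge> 1 - \<epsilon> \<and> (\<forall>\<omega>\<in>A. \<bar>Z n \<omega>\<bar> \<le> ereal (C * r n)))"

end

theory Submission
  imports Defs "HOL-Computational_Algebra.Polynomial"
begin

text \<open>
  The estimator is linear in the data, so averaging over the errors replaces the data by
  their noise-free values, and the expected derivative is the derivative of the ridge
  regression fit to \<open>f\<close> itself. Let \<open>g\<close> be that fit minus \<open>f\<close>. Comparing the objective at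
  the fit and at \<open>f\<close> gives \<open>\<bar>g\<bar>\<^sub>n \<le> \<surd>\<lambda> \<bar>f\<bar>\<close> and \<open>\<bar>g\<bar> \<le> 2 \<bar>f\<bar>\<close> (norms in \<open>H\<close>), and the norm
  comparison together with \<open>n powr (- 2 m / d) = O(\<lambda>)\<close> turns the first bound into an \<open>L\<^sub>2\<close> bound of
  the same order. What remains is purely about the Sobolev space: for \<open>k < m - d / 2\<close>, every
  \<open>v \<in> H\<^sup>m\<close> is \<open>k\<close> times differentiable up to the boundary, and for all \<open>0 < h \<le> 1\<close>
  derivatives of order \<open>k\<close> are at most a constant times
  \<open>h powr (- d / 2 - k) * \<bar>v\<bar>\<^sub>2 + h powr (m - d / 2 - k) * \<bar>v\<bar>\<close>
  (lemma \<open>sobolev_derivatives\<close>). For \<open>\<lambda> \<le> 1\<close> the theorem is the case \<open>h = \<lambda> powr (1 / (2 m))\<close>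
  with \<open>v = g\<close>; for \<open>\<lambda> > 1\<close> it is enough that derivatives are bounded by the norm of \<open>g\<close>.

  The Sobolev estimate avoids extension operators and Fourier analysis by using convexity.
  Fix a smooth bump \<open>\<Phi>\<close> supported in a small box around an interior point \<open>c\<close>. For \<open>x \<in> \<Omega>\<close>
  and \<open>0 < s \<le> 1\<close> the average \<open>\<integral> \<Phi>(y) v(x + s (y - x)) dy\<close> only uses values of \<open>v\<close> on the
  box contracted towards \<open>x\<close>, which stays in the interior of \<open>\<Omega>\<close>; written as an integral against a
  kernel in \<open>z = x + s (y - x)\<close> it is smooth in \<open>x\<close> and \<open>s\<close>, and the kernel is a test
  function, so weak derivatives may be moved between \<open>v\<close> and the kernel. An \<open>x\<close>-derivative of
  order \<open>j\<close> of this average is, up to the factor \<open>(1 - s) ^ j\<close>, the average of a derivative of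
  \<open>v\<close> of order \<open>j\<close>. For fixed \<open>x\<close>, consider the latter as a function of \<open>s\<close>:

  \<^item> differentiating it \<open>l\<close> times in \<open>s\<close> costs \<open>l\<close> further derivatives of the kernel, so at
    \<open>s = h\<close> Cauchy-Schwarz bounds the result by \<open>h powr (- d / 2 - j - l) * \<bar>v\<bar>\<^sub>2\<close>;
  \<^item> once \<open>j + l\<close> reaches \<open>\<lceil>m\<rceil>\<close>, moving derivatives to \<open>v\<close> bounds it by
    \<open>s powr (m - j - l - d / 2) * \<bar>v\<bar>\<close> for all \<open>s\<close>. For fractional \<open>m\<close> the one derivative left on the
    kernel gives it mean zero, and the Slobodeckij energy controls the oscillation of the
    weak derivative over the small box (lemma \<open>avg_oscillation\<close>).

  Since \<open>m - j - d / 2 > 0\<close>, integrating down from the top order shows that the first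
  derivative in \<open>s\<close> is integrable at \<open>0\<close>, with explicit constants (lemma \<open>decay_imp_modulus\<close>). Hence
  all averaged derivatives of order at most \<open>k\<close> converge uniformly in \<open>x\<close> as \<open>s\<close> tends to \<open>0\<close>;
  as the averages themselves converge to a multiple of the continuous function \<open>v\<close>, the limits are
  the derivatives of that multiple, with the stated bound.
\<close>

section \<open>A smooth bump function\<close>

lemma power_poly_exp_tendsto_0:
  fixes p :: "real poly"
  shows "((\<lambda>u. u ^ k * poly p u * exp (- u)) \<longlongrightarrow> 0) at_top"
proof (induction p arbitrary: k)
  case 0
  then show ?case by simp
next
  case (pCons a p)
  have "((\<lambda>u. a * (u ^ k / exp u) + u ^ Suc k * poly p u * exp (- u)) \<longlongrightarrow> a * 0 + 0) at_top"
    by (intro tendsto_add tendsto_mult tendsto_const tendsto_power_div_exp_0 pCons.IH)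
  moreover have "(\<lambda>u. a * (u ^ k / exp u) + u ^ Suc k * poly p u * exp (- u)) =
      (\<lambda>u. u ^ k * poly (pCons a p) u * exp (- u))"
    by (auto simp: fun_eq_iff exp_minus field_simps)
  ultimately show ?case by simp
qed

text \<open>
  For \<open>t > 0\<close>, the \<open>n\<close>-th derivative of \<open>exp (- 1 / t)\<close> is \<open>flat_poly n\<close> evaluated at \<open>1 / t\<close> times
  \<open>exp (- 1 / t)\<close>.
\<close>

primrec flat_poly :: "nat \<Rightarrow> real poly" where
  "flat_poly 0 = 1"
| "flat_poly (Suc n) = [:0, 0, 1:] * (flat_poly n - pderiv (flat_poly n))"

definition flat_exp :: "nat \<Rightarrow> real \<Rightarrow> real" where
  "flat_exp n t = (if 0 < t then poly (flat_poly n) (1 / t) * exp (- (1 / t)) else 0)"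

text \<open>
  Away from \<open>0\<close> this is the chain rule. At \<open>0\<close> the exponential beats every polynomial in
  \<open>1 / t\<close>, so all difference quotients vanish in the limit.
\<close>

lemma flat_has_derivative: "(flat_exp n has_real_derivative flat_exp (Suc n) t) (at t)"
proof -
  consider "t < 0" | "t = 0" | "t > 0" by linarith
  then show ?thesis
  proof cases
    case 1
    have "((\<lambda>_. 0::real) has_real_derivative 0) (at t)" by simp
    then have "(flat_exp n has_real_derivative 0) (at t)"
      by (rule has_field_derivative_transform_within_open[where S = "{..<0}"])
         (use 1 in \<open>auto simp: flat_exp_def\<close>)
    with 1 show ?thesis by (simp add: flat_exp_def)
  next
    case 3
    have "((\<lambda>t. poly (flat_poly n) (1 / t) * exp (- (1 / t))) has_real_derivative
            poly (flat_poly (Suc n)) (1 / t) * exp (- (1 / t))) (at t)"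
      using 3 by (auto intro!: derivative_eq_intros simp: field_simps power2_eq_square)
    then have "(flat_exp n has_real_derivative poly (flat_poly (Suc n)) (1 / t) * exp (- (1 / t))) (at t)"
      by (rule has_field_derivative_transform_within_open[where S = "{0<..}"])
         (use 3 in \<open>auto simp: flat_exp_def\<close>)
    with 3 show ?thesis by (simp add: flat_exp_def)
  next
    case 2
    have R: "((\<lambda>h. flat_exp n h / h) \<longlongrightarrow> 0) (at_right 0)"
    proof -
      have "((\<lambda>h. (inverse h) ^ 1 * poly (flat_poly n) (inverse h) * exp (- inverse h)) \<longlongrightarrow> 0)
              (at_right (0::real))"
        by (rule filterlim_compose[OF power_poly_exp_tendsto_0 filterlim_inverse_at_top_right])
      then show ?thesis
        by (rule Lim_transform_eventually)
           (auto simp: eventually_at_right_field flat_exp_def field_simps intro!: exI[of _ 1])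
    qed
    have L: "((\<lambda>h. flat_exp n h / h) \<longlongrightarrow> 0) (at_left 0)"
      by (rule Lim_transform_eventually[OF tendsto_const])
         (auto simp: eventually_at_left_field flat_exp_def intro!: exI[of _ "-1"])
    have "((\<lambda>h. flat_exp n h / h) \<longlongrightarrow> 0) (at 0)"
      using L R by (simp add: filterlim_at_split)
    then have "(flat_exp n has_real_derivative 0) (at 0)"
      unfolding DERIV_def by (simp add: flat_exp_def[of n 0])
    then show ?thesis using 2 by (simp add: flat_exp_def[of "Suc n" 0])
  qed
qed

text \<open>
  The \<open>n\<close>-th derivative of a product, given the two sequences of derivatives. Carrying the
  two orders as extra arguments makes the Leibniz rule a plain recursion without binomial
  coefficients.
\<close>

primrec prod_deriv :: "(nat \<Rightarrow> real \<Rightarrow> real) \<Rightarrow> (nat \<Rightarrow> real \<Rightarrow> real) \<Rightarrow>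
    nat \<Rightarrow> nat \<Rightarrow> nat \<Rightarrow> real \<Rightarrow> real" where
  "prod_deriv u v 0 k l t = u k t * v l t"
| "prod_deriv u v (Suc n) k l t = prod_deriv u v n (Suc k) l t + prod_deriv u v n k (Suc l) t"

lemma prod_deriv_has_derivative:
  assumes "\<And>k t. (u k has_real_derivative u (Suc k) t) (at t)"
    and "\<And>l t. (v l has_real_derivative v (Suc l) t) (at t)"
  shows "(prod_deriv u v n k l has_real_derivative prod_deriv u v (Suc n) k l t) (at t)"
proof (induction n arbitrary: k l)
  case 0
  have "((\<lambda>t. u k t * v l t) has_real_derivative u (Suc k) t * v l t + u k t * v (Suc l) t) (at t)"
    by (rule DERIV_cong[OF DERIV_mult[OF assms(1) assms(2)]]) simp
  then show ?case by (simp add: fun_eq_iff[symmetric])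
next
  case (Suc n)
  have "((\<lambda>t. prod_deriv u v n (Suc k) l t + prod_deriv u v n k (Suc l) t) has_real_derivative
     prod_deriv u v (Suc n) (Suc k) l t + prod_deriv u v (Suc n) k (Suc l) t) (at t)"
    by (intro DERIV_add Suc.IH)
  then show ?case by simp
qed

lemma prod_deriv_eq_0:
  assumes "(\<forall>k. u k t = 0) \<or> (\<forall>l. v l t = 0)"
  shows "prod_deriv u v n k l t = 0"
  using assms by (induction n arbitrary: k l) auto

text \<open>
  The bump comes with the sequence of all its derivatives, in which form it is used below.
  It is \<open>flat_exp 0 (\<rho> + t) * flat_exp 0 (\<rho> - t)\<close>.
\<close>

lemma smooth_bump_exists:
  fixes \<rho> :: real
  assumes "\<rho> > 0"
  obtains b :: "nat \<Rightarrow> real \<Rightarrow> real"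
  where "\<And>n t. (b n has_real_derivative b (Suc n) t) (at t)"
    and "\<And>n t. \<rho> \<le> \<bar>t\<bar> \<Longrightarrow> b n t = 0"
    and "\<And>t. 0 \<le> b 0 t" and "0 < b 0 0"
proof
  define u where "u k t = flat_exp k (\<rho> + t)" for k t
  define v where "v l t = (- 1) ^ l * flat_exp l (\<rho> - t)" for l t
  define b where "b n = prod_deriv u v n 0 0" for n
  have du: "(u k has_real_derivative u (Suc k) t) (at t)" for k t
    unfolding u_def
    by (rule DERIV_cong[OF DERIV_chain2[OF flat_has_derivative]]) (auto intro!: derivative_eq_intros)
  have dv: "(v l has_real_derivative v (Suc l) t) (at t)" for l t
    unfolding v_def
    by (rule DERIV_cong[OF DERIV_cmult[OF DERIV_chain2[OF flat_has_derivative, where Db = "- 1"]]])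
       (auto intro!: derivative_eq_intros)
  show "(b n has_real_derivative b (Suc n) t) (at t)" for n t
    unfolding b_def by (rule prod_deriv_has_derivative; rule du dv)
  show "b n t = 0" if "\<rho> \<le> \<bar>t\<bar>" for n t
  proof -
    have "(\<forall>k. u k t = 0) \<or> (\<forall>l. v l t = 0)"
      using that by (auto simp: u_def v_def flat_exp_def abs_if split: if_splits)
    then show ?thesis unfolding b_def by (rule prod_deriv_eq_0)
  qed
  show "0 \<le> b 0 t" for t by (auto simp: b_def u_def v_def flat_exp_def)
  show "0 < b 0 0" using assms by (auto simp: b_def u_def v_def flat_exp_def)
qed

section \<open>Functions whose derivatives blow up like powers\<close>

text \<open>
  A pointwise bound on the derivative by a power integrates to a bound on the increment:
  compare \<open>G\<close> with the primitive of the power through monotonicity.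
\<close>

lemma abs_diff_le_powr:
  fixes G G' :: "real \<Rightarrow> real"
  assumes "0 < s" "s \<le> s'" "a \<noteq> 0"
    and der: "\<And>t. t \<in> {s..s'} \<Longrightarrow> (G has_real_derivative G' t) (at t)"
    and bd: "\<And>t. t \<in> {s..s'} \<Longrightarrow> \<bar>G' t\<bar> \<le> c * t powr (a - 1)"
  shows "\<bar>G s' - G s\<bar> \<le> c * (s' powr a - s powr a) / a"
proof -
  have p: "((\<lambda>t. c * t powr a / a) has_real_derivative c * t powr (a - 1)) (at t)"
    if "t \<in> {s..s'}" for t
    using that assms(1,3) by (auto intro!: derivative_eq_intros)
  have "(\<lambda>t. c * t powr a / a + G t) s \<le> (\<lambda>t. c * t powr a / a + G t) s'"
  proof (rule DERIV_nonneg_imp_nondecreasing[OF assms(2)])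
    fix t assume "s \<le> t" "t \<le> s'"
    then have t: "t \<in> {s..s'}" by simp
    show "\<exists>y. ((\<lambda>t. c * t powr a / a + G t) has_real_derivative y) (at t) \<and> 0 \<le> y"
      using DERIV_add[OF p[OF t] der[OF t]] bd[OF t] by (intro exI conjI) auto
  qed
  moreover have "(\<lambda>t. c * t powr a / a - G t) s \<le> (\<lambda>t. c * t powr a / a - G t) s'"
  proof (rule DERIV_nonneg_imp_nondecreasing[OF assms(2)])
    fix t assume "s \<le> t" "t \<le> s'"
    then have t: "t \<in> {s..s'}" by simp
    show "\<exists>y. ((\<lambda>t. c * t powr a / a - G t) has_real_derivative y) (at t) \<and> 0 \<le> y"
      using DERIV_diff[OF p[OF t] der[OF t]] bd[OF t] by (intro exI conjI) auto
  qed
  ultimately show ?thesis by (simp add: right_diff_distrib diff_divide_distrib)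
qed

text \<open>
  Integrating the bound for order \<open>l + 1\<close> from \<open>s\<close> to \<open>h\<close> gives the bound for order \<open>l\<close>,
  as long as the exponent \<open>q - l\<close> is negative, so that the integral is governed by its lower end \<open>s\<close>.
  Each step costs the factor \<open>1 + 1 / (1 - q)\<close>.
\<close>

lemma derivatives_decay:
  fixes D :: "nat \<Rightarrow> real \<Rightarrow> real"
  assumes q: "0 < q" "q < 1" and AB: "0 \<le> A" "0 \<le> B"
    and der: "\<And>l s. l < N \<Longrightarrow> 0 < s \<Longrightarrow> s \<le> h \<Longrightarrow> (D l has_real_derivative D (Suc l) s) (at s)"
    and top: "\<And>s. 0 < s \<Longrightarrow> s \<le> h \<Longrightarrow> \<bar>D N s\<bar> \<le> A * s powr (q - real N)"
    and low: "\<And>l. l < N \<Longrightarrow> \<bar>D l h\<bar> \<le> B * h powr (q - real l)"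
    and l: "1 \<le> l" "l \<le> N" and s: "0 < s" "s \<le> h"
  shows "\<bar>D l s\<bar> \<le> (1 + 1 / (1 - q)) ^ (N - l) * (A + B) * s powr (q - real l)"
  using l(2) l(1) s
proof (induction l arbitrary: s rule: inc_induct)
  case base
  have "A * s powr (q - real N) \<le> (A + B) * s powr (q - real N)"
    using AB by (intro mult_right_mono) auto
  moreover have "\<bar>D N s\<bar> \<le> A * s powr (q - real N)" using top base by blast
  ultimately show ?case by simp
next
  case (step l)
  define \<kappa> where "\<kappa> = 1 + 1 / (1 - q)"
  define c where "c = \<kappa> ^ (N - Suc l) * (A + B)"
  have \<kappa>: "1 \<le> \<kappa>" using q by (simp add: \<kappa>_def)
  have "1 \<le> \<kappa> ^ (N - Suc l)" using \<kappa> by simp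
  then have "1 * (A + B) \<le> c" unfolding c_def using AB by (intro mult_right_mono) auto
  then have c: "A + B \<le> c" "0 \<le> c" using AB by auto
  have a: "q - real l \<noteq> 0" "real l - q \<ge> 1 - q" "0 < 1 - q" using q step.prems by auto
  have "\<bar>D l h - D l s\<bar> \<le> c * (h powr (q - real l) - s powr (q - real l)) / (q - real l)"
  proof (rule abs_diff_le_powr[OF step.prems(2,3) a(1)])
    fix t assume t: "t \<in> {s..h}"
    then show "(D l has_real_derivative D (Suc l) t) (at t)"
      using step by (intro der) auto
    show "\<bar>D (Suc l) t\<bar> \<le> c * t powr (q - real l - 1)"
      using step.IH[of t] t step.prems by (simp add: c_def \<kappa>_def algebra_simps)
  qed
  also have "\<dots> = c * (s powr (q - real l) - h powr (q - real l)) / (real l - q)"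
    using a by (simp add: field_simps)
  also have "\<dots> \<le> c * s powr (q - real l) / (1 - q)"
    using c a by (intro frac_le mult_left_mono) auto
  finally have 1: "\<bar>D l h - D l s\<bar> \<le> c / (1 - q) * s powr (q - real l)" by simp
  have "\<bar>D l h\<bar> \<le> B * h powr (q - real l)" using low step.hyps by simp
  also have "\<dots> \<le> B * s powr (q - real l)"
    using AB step.prems a q by (intro mult_left_mono powr_mono2') auto
  also have "\<dots> \<le> c * s powr (q - real l)"
    using c AB by (intro mult_right_mono) auto
  finally have "\<bar>D l s\<bar> \<le> c * s powr (q - real l) + c / (1 - q) * s powr (q - real l)"
    using 1 by linarith
  also have "\<dots> = \<kappa> * c * s powr (q - real l)"
    by (simp add: \<kappa>_def algebra_simps)
  also have "\<kappa> * c = \<kappa> ^ (N - l) * (A + B)"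
    using step.hyps by (simp add: c_def Suc_diff_Suc[symmetric])
  finally show ?case by (simp add: \<kappa>_def)
qed

text \<open>
  The last integration, from order \<open>1\<close> to order \<open>0\<close>, meets the integrable singularity
  \<open>t powr (q - 1)\<close> and yields a modulus of continuity at \<open>0\<close>. The constant does not depend on
  \<open>h\<close>, which later makes the Sobolev bound scale correctly.
\<close>

lemma decay_imp_modulus:
  fixes D :: "nat \<Rightarrow> real \<Rightarrow> real"
  assumes q: "0 < q" "q < 1" and AB: "0 \<le> A" "0 \<le> B" and N: "1 \<le> N"
    and der: "\<And>l s. l < N \<Longrightarrow> 0 < s \<Longrightarrow> s \<le> h \<Longrightarrow> (D l has_real_derivative D (Suc l) s) (at s)"
    and top: "\<And>s. 0 < s \<Longrightarrow> s \<le> h \<Longrightarrow> \<bar>D N s\<bar> \<le> A * s powr (q - real N)"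
    and low: "\<And>l. l < N \<Longrightarrow> \<bar>D l h\<bar> \<le> B * h powr (q - real l)"
    and s: "0 < s" "s \<le> s'" "s' \<le> h"
  shows "\<bar>D 0 s' - D 0 s\<bar> \<le> (1 + 1 / (1 - q)) ^ N / q * (A + B) * s' powr q"
proof -
  define c where "c = (1 + 1 / (1 - q)) ^ N * (A + B)"
  have c: "0 \<le> c" unfolding c_def using q AB by (intro mult_nonneg_nonneg zero_le_power) auto
  have "\<bar>D 0 s' - D 0 s\<bar> \<le> c * (s' powr q - s powr q) / q"
  proof (rule abs_diff_le_powr[OF s(1,2)])
    fix t assume t: "t \<in> {s..s'}"
    then show "(D 0 has_real_derivative D 1 t) (at t)"
      using der[of 0 t] N s by auto
    have "\<bar>D 1 t\<bar> \<le> (1 + 1 / (1 - q)) ^ (N - 1) * (A + B) * t powr (q - real 1)"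
      using t s by (intro derivatives_decay[OF q AB der top low _ N]) auto
    also have "\<dots> \<le> c * t powr (q - real 1)"
      unfolding c_def using AB q by (intro mult_right_mono power_increasing) auto
    finally show "\<bar>D 1 t\<bar> \<le> c * t powr (q - 1)" by simp
  qed (use q in auto)
  also have "\<dots> \<le> c * s' powr q / q"
    using c q by (intro divide_right_mono mult_left_mono) auto
  finally show ?thesis by (simp add: c_def algebra_simps)
qed

section \<open>Weighted integrals\<close>

lemma integral_Cauchy_Schwarz:
  fixes f g :: "'a \<Rightarrow> real"
  assumes [measurable]: "f \<in> borel_measurable M" "g \<in> borel_measurable M"
    and f: "integrable M (\<lambda>x. (f x)\<^sup>2)" and g: "integrable M (\<lambda>x. (g x)\<^sup>2)"
  shows "integrable M (\<lambda>x. f x * g x)"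
    and "\<bar>LINT x|M. f x * g x\<bar> \<le> sqrt (LINT x|M. (f x)\<^sup>2) * sqrt (LINT x|M. (g x)\<^sup>2)"
proof -
  show fg: "integrable M (\<lambda>x. f x * g x)"
  proof (rule Bochner_Integration.integrable_bound[OF Bochner_Integration.integrable_add[OF f g]])
    have "\<bar>a * b\<bar> \<le> a\<^sup>2 + b\<^sup>2" for a b :: real
    proof -
      have "2 * \<bar>a\<bar> * \<bar>b\<bar> \<le> \<bar>a\<bar>\<^sup>2 + \<bar>b\<bar>\<^sup>2" by (rule sum_squares_bound)
      moreover have "0 \<le> \<bar>a\<bar> * \<bar>b\<bar>" by simp
      ultimately show ?thesis unfolding abs_mult power2_abs by linarith
    qed
    then show "AE x in M. norm (f x * g x) \<le> norm ((f x)\<^sup>2 + (g x)\<^sup>2)"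
      by (intro AE_I2) simp
  qed measurable
  define a b c where "a = (LINT x|M. (f x)\<^sup>2)" and "b = (LINT x|M. (g x)\<^sup>2)"
    and "c = (LINT x|M. f x * g x)"
  have ab: "0 \<le> a" "0 \<le> b" by (auto simp: a_def b_def)
  have *: "0 \<le> t\<^sup>2 * a - 2 * t * c + b" for t
  proof -
    have "0 \<le> (LINT x|M. (t * f x - g x)\<^sup>2)" by simp
    also have "(\<lambda>x. (t * f x - g x)\<^sup>2) = (\<lambda>x. t\<^sup>2 * (f x)\<^sup>2 - 2 * t * (f x * g x) + (g x)\<^sup>2)"
      by (auto simp: fun_eq_iff power2_eq_square algebra_simps)
    also have "(LINT x|M. t\<^sup>2 * (f x)\<^sup>2 - 2 * t * (f x * g x) + (g x)\<^sup>2) = t\<^sup>2 * a - 2 * t * c + b"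
      unfolding a_def b_def c_def using f g fg by simp
    finally show ?thesis .
  qed
  have "c\<^sup>2 \<le> a * b"
  proof (cases "a = 0")
    case True
    have "c = 0"
    proof (rule ccontr)
      assume "c \<noteq> 0"
      with *[of "(b + 1) / (2 * c)"] True ab show False by (simp add: field_simps)
    qed
    with True show ?thesis by simp
  next
    case False
    with ab have "0 < a" by simp
    with *[of "c / a"] show ?thesis by (simp add: field_simps power2_eq_square)
  qed
  then have "\<bar>c\<bar> \<le> sqrt (a * b)" by (simp add: real_le_rsqrt)
  then show "\<bar>LINT x|M. f x * g x\<bar> \<le> sqrt (LINT x|M. (f x)\<^sup>2) * sqrt (LINT x|M. (g x)\<^sup>2)"
    by (simp add: a_def b_def c_def real_sqrt_mult)
qed

text \<open>
  Differentiation under the integral sign: the mean value theorem bounds the difference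
  quotients uniformly, so dominated convergence applies along every sequence.
\<close>

lemma has_derivative_weighted_integral:
  fixes k :: "'a::real_normed_vector \<Rightarrow> 'z \<Rightarrow> real" and k' :: "'a \<Rightarrow> 'z \<Rightarrow> 'a \<Rightarrow> real"
  assumes S: "convex S" and p: "p \<in> S"
    and der: "\<And>q z. q \<in> S \<Longrightarrow> z \<in> space M \<Longrightarrow> ((\<lambda>q. k q z) has_derivative k' q z) (at q within S)"
    and C: "0 \<le> C" and bound: "\<And>q z h. q \<in> S \<Longrightarrow> z \<in> space M \<Longrightarrow> \<bar>k' q z h\<bar> \<le> C * norm h"
    and meas': "\<And>h. (\<lambda>z. k' p z h) \<in> borel_measurable M"
    and int: "\<And>q. q \<in> S \<Longrightarrow> integrable M (\<lambda>z. k q z * v z)"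
    and v: "integrable M v"
  shows "((\<lambda>q. LINT z|M. k q z * v z) has_derivative (\<lambda>h. LINT z|M. k' p z h * v z)) (at p within S)"
proof -
  note [measurable] = meas' borel_measurable_integrable[OF v]
  have lin: "linear (k' p z)" if "z \<in> space M" for z
    using der[OF p that] by (rule has_derivative_linear)
  have int': "integrable M (\<lambda>z. k' p z h * v z)" for h
  proof (rule Bochner_Integration.integrable_bound)
    show "integrable M (\<lambda>z. C * norm h * \<bar>v z\<bar>)" using v by simp
    show "AE z in M. norm (k' p z h * v z) \<le> norm (C * norm h * \<bar>v z\<bar>)"
    proof (rule AE_I2)
      fix z assume z: "z \<in> space M"
      have "\<bar>k' p z h\<bar> * \<bar>v z\<bar> \<le> (C * norm h) * \<bar>v z\<bar>"
        using bound[OF p z] by (intro mult_right_mono) auto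
      then show "norm (k' p z h * v z) \<le> norm (C * norm h * \<bar>v z\<bar>)"
        unfolding real_norm_def abs_mult[of "k' p z h"] by (rule order_trans[OF _ abs_ge_self])
    qed
  qed measurable
  have bl: "bounded_linear (\<lambda>h. LINT z|M. k' p z h * v z)"
  proof (rule bounded_linear_intro)
    fix h1 h2
    have "(LINT z|M. k' p z (h1 + h2) * v z) = (LINT z|M. k' p z h1 * v z + k' p z h2 * v z)"
      by (rule Bochner_Integration.integral_cong) (auto simp: linear_add[OF lin] algebra_simps)
    then show "(LINT z|M. k' p z (h1 + h2) * v z) = (LINT z|M. k' p z h1 * v z) + (LINT z|M. k' p z h2 * v z)"
      using int' by simp
  next
    fix r h
    have "(LINT z|M. k' p z (r *\<^sub>R h) * v z) = (LINT z|M. r * (k' p z h * v z))"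
      by (rule Bochner_Integration.integral_cong) (auto simp: linear_scale[OF lin])
    then show "(LINT z|M. k' p z (r *\<^sub>R h) * v z) = r *\<^sub>R (LINT z|M. k' p z h * v z)" by simp
  next
    fix h
    have "norm (LINT z|M. k' p z h * v z) \<le> (LINT z|M. C * norm h * \<bar>v z\<bar>)"
    proof (rule order_trans[OF integral_norm_bound integral_mono])
      show "integrable M (\<lambda>z. norm (k' p z h * v z))" using int' by (rule integrable_norm)
      show "integrable M (\<lambda>z. C * norm h * \<bar>v z\<bar>)" using v by simp
      fix z assume z: "z \<in> space M"
      have "\<bar>k' p z h\<bar> * \<bar>v z\<bar> \<le> (C * norm h) * \<bar>v z\<bar>"
        using bound[OF p z] by (intro mult_right_mono) auto
      then show "norm (k' p z h * v z) \<le> C * norm h * \<bar>v z\<bar>" by (simp add: abs_mult)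
    qed
    then show "norm (LINT z|M. k' p z h * v z) \<le> norm h * (C * (LINT z|M. \<bar>v z\<bar>))"
      by (simp add: algebra_simps)
  qed
  have lim: "((\<lambda>y. (1 / norm (y - p)) *\<^sub>R
        ((LINT z|M. k y z * v z) - ((LINT z|M. k p z * v z) + (LINT z|M. k' p z (y - p) * v z)))) \<longlongrightarrow> 0)
        (at p within S)"
    unfolding tendsto_at_iff_sequentially
  proof (intro allI impI)
    fix X assume X: "\<forall>i. X i \<in> S - {p}" and Xp: "X \<longlonglongrightarrow> p"
    define r where "r i z = inverse (norm (X i - p)) *
        (k (X i) z * v z - (k p z * v z + k' p z (X i - p) * v z))" for i z
    have Xi: "X i \<in> S" "0 < norm (X i - p)" for i using X by auto
    have r_int: "integrable M (r i)" for i
      unfolding r_def using int[OF Xi(1)[of i]] int[OF p] int'[of "X i - p"] by simp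
    have "(\<lambda>i. LINT z|M. r i z) \<longlonglongrightarrow> (LINT z|M. 0)"
    proof (rule integral_dominated_convergence[where w = "\<lambda>z. 2 * C * \<bar>v z\<bar>"])
      show "AE z in M. (\<lambda>i. r i z) \<longlonglongrightarrow> 0"
      proof (rule AE_I2)
        fix z assume z: "z \<in> space M"
        have "((\<lambda>y. (1 / norm (y - p)) *\<^sub>R (k y z - (k p z + k' p z (y - p)))) \<longlongrightarrow> 0) (at p within S)"
          using der[OF p z] unfolding has_derivative_within by blast
        then have "((\<lambda>y. (1 / norm (y - p)) *\<^sub>R (k y z - (k p z + k' p z (y - p)))) \<circ> X) \<longlonglongrightarrow> 0"
          using X Xp unfolding tendsto_at_iff_sequentially by blast
        then have "(\<lambda>i. ((\<lambda>y. (1 / norm (y - p)) *\<^sub>R (k y z - (k p z + k' p z (y - p)))) \<circ> X) i * v z) \<longlonglongrightarrow> 0"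
          by (rule tendsto_mult_left_zero)
        moreover have "r i z = ((\<lambda>y. (1 / norm (y - p)) *\<^sub>R (k y z - (k p z + k' p z (y - p)))) \<circ> X) i * v z" for i
          by (simp add: r_def divide_inverse algebra_simps)
        ultimately show "(\<lambda>i. r i z) \<longlonglongrightarrow> 0" by simp
      qed
      show "AE z in M. norm (r i z) \<le> 2 * C * \<bar>v z\<bar>" for i
      proof (rule AE_I2)
        fix z assume z: "z \<in> space M"
        have "norm (k (X i) z - k p z) \<le> C * norm (X i - p)"
        proof (rule differentiable_bound[OF S, where f' = "\<lambda>q. k' q z"])
          show "((\<lambda>q. k q z) has_derivative k' q z) (at q within S)" if "q \<in> S" for q
            using der[OF that z] .
          show "onorm (k' q z) \<le> C" if "q \<in> S" for q
            by (rule onorm_bound) (use bound[OF that z] C in auto)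
        qed (use Xi p in auto)
        moreover have "\<bar>k' p z (X i - p)\<bar> \<le> C * norm (X i - p)" by (rule bound[OF p z])
        ultimately have "\<bar>k (X i) z - k p z - k' p z (X i - p)\<bar> \<le> 2 * C * norm (X i - p)"
          by (simp add: real_norm_def)
        then have "\<bar>k (X i) z - k p z - k' p z (X i - p)\<bar> / norm (X i - p) \<le> 2 * C"
          using Xi(2)[of i] by (simp add: field_simps)
        then have "\<bar>k (X i) z - k p z - k' p z (X i - p)\<bar> / norm (X i - p) * \<bar>v z\<bar> \<le> 2 * C * \<bar>v z\<bar>"
          by (rule mult_right_mono) simp
        moreover have "r i z = (k (X i) z - k p z - k' p z (X i - p)) / norm (X i - p) * v z"
          by (simp add: r_def divide_inverse algebra_simps)
        ultimately show "norm (r i z) \<le> 2 * C * \<bar>v z\<bar>" by (simp add: abs_mult)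
      qed
      show "integrable M (\<lambda>z. 2 * C * \<bar>v z\<bar>)" using v by simp
      show "r i \<in> borel_measurable M" for i by (rule borel_measurable_integrable[OF r_int])
    qed simp
    moreover have "(LINT z|M. r i z) = ((\<lambda>y. (1 / norm (y - p)) *\<^sub>R
        ((LINT z|M. k y z * v z) - ((LINT z|M. k p z * v z) + (LINT z|M. k' p z (y - p) * v z)))) \<circ> X) i" for i
    proof -
      have "(LINT z|M. r i z) = inverse (norm (X i - p)) *
          (LINT z|M. k (X i) z * v z - (k p z * v z + k' p z (X i - p) * v z))"
        unfolding r_def by simp
      also have "(LINT z|M. k (X i) z * v z - (k p z * v z + k' p z (X i - p) * v z)) =
         (LINT z|M. k (X i) z * v z) - ((LINT z|M. k p z * v z) + (LINT z|M. k' p z (X i - p) * v z))"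
        using int[OF Xi(1)[of i]] int[OF p] int'[of "X i - p"] by simp
      finally show ?thesis by (simp add: divide_inverse mult.commute)
    qed
    ultimately show "((\<lambda>y. (1 / norm (y - p)) *\<^sub>R
        ((LINT z|M. k y z * v z) - ((LINT z|M. k p z * v z) + (LINT z|M. k' p z (y - p) * v z)))) \<circ> X) \<longlonglongrightarrow> 0"
      by (simp only: integral_zero)
  qed
  show ?thesis unfolding has_derivative_within using bl lim by blast
qed

lemma lborel_integral_translate:
  fixes f :: "'a::euclidean_space \<Rightarrow> real"
  assumes [measurable]: "f \<in> borel_measurable borel"
  shows "(LINT z|lborel. f (z + a)) = (LINT z|lborel. f z)"
proof -
  have "(LINT z|lborel. f z) = (LINT z|distr lborel borel ((+) a). f z)"
    by (simp only: lborel_distr_plus)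
  also have "\<dots> = (LINT z|lborel. f (a + z))" by (rule integral_distr) auto
  finally show ?thesis by (simp add: add.commute)
qed

text \<open>
  Cauchy-Schwarz, keeping track of the volume of the support. For kernels on boxes with sides
  proportional to \<open>s\<close> the volume supplies a factor \<open>s powr (d / 2)\<close>.
\<close>

lemma integral_against_bounded_support:
  fixes v \<phi> :: "real ^ 'd \<Rightarrow> real"
  assumes v: "square_integrable \<Omega> v" and \<Omega>: "\<Omega> \<in> sets lebesgue"
    and \<phi>: "\<phi> \<in> borel_measurable (lebesgue_on \<Omega>)" and T: "0 \<le> T" "\<And>z. \<bar>\<phi> z\<bar> \<le> T"
    and B: "B \<in> lmeasurable" "B \<subseteq> \<Omega>" and supp: "\<And>z. z \<notin> B \<Longrightarrow> \<phi> z = 0"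
  shows "integrable (lebesgue_on \<Omega>) (\<lambda>z. \<phi> z * v z)"
    and "\<bar>LINT z|lebesgue_on \<Omega>. \<phi> z * v z\<bar> \<le> T * sqrt (measure lebesgue B) * norm_L2 \<Omega> v"
proof -
  note [measurable] = \<phi>
  have vm [measurable]: "v \<in> borel_measurable (lebesgue_on \<Omega>)"
    and v2: "integrable (lebesgue_on \<Omega>) (\<lambda>x. (v x)\<^sup>2)"
    using v by (auto simp: square_integrable_def)
  have Bs: "B \<in> sets (lebesgue_on \<Omega>)"
    using B \<Omega> by (auto simp: sets_restrict_space_iff fmeasurable_def)
  have mB: "measure (lebesgue_on \<Omega>) B = measure lebesgue B"
    using B \<Omega> by (intro measure_restrict_space) auto
  have eB: "emeasure (lebesgue_on \<Omega>) B < \<infinity>"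
    using B \<Omega> by (subst emeasure_restrict_space) (auto simp: fmeasurable_def)
  have iB: "integrable (lebesgue_on \<Omega>) (\<lambda>z. T\<^sup>2 * indicator B z)"
    using Bs eB by (intro integrable_mult_right integrable_real_indicator) auto
  have le: "(\<phi> z)\<^sup>2 \<le> T\<^sup>2 * indicator B z" for z
    using T(2)[of z] supp[of z] by (auto simp: indicator_def abs_le_square_iff[symmetric] T(1))
  have p2: "integrable (lebesgue_on \<Omega>) (\<lambda>z. (\<phi> z)\<^sup>2)"
    by (rule Bochner_Integration.integrable_bound[OF iB]) (use le in \<open>auto intro!: AE_I2 order_trans[OF _ abs_ge_self]\<close>)
  have "(LINT z|lebesgue_on \<Omega>. (\<phi> z)\<^sup>2) \<le> (LINT z|lebesgue_on \<Omega>. T\<^sup>2 * indicator B z)"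
    by (rule integral_mono[OF p2 iB]) (rule le)
  also have "\<dots> = T\<^sup>2 * measure lebesgue B"
    using Bs eB mB B(2) by (simp add: Int_absorb2)
  finally have "sqrt (LINT z|lebesgue_on \<Omega>. (\<phi> z)\<^sup>2) \<le> sqrt (T\<^sup>2 * measure lebesgue B)" by simp
  also have "\<dots> = T * sqrt (measure lebesgue B)" using T by (simp add: real_sqrt_mult)
  finally have s: "sqrt (LINT z|lebesgue_on \<Omega>. (\<phi> z)\<^sup>2) \<le> T * sqrt (measure lebesgue B)" .
  show "integrable (lebesgue_on \<Omega>) (\<lambda>z. \<phi> z * v z)"
    by (rule integral_Cauchy_Schwarz(1)[OF \<phi> vm p2 v2])
  have "\<bar>LINT z|lebesgue_on \<Omega>. \<phi> z * v z\<bar> \<le> sqrt (LINT z|lebesgue_on \<Omega>. (\<phi> z)\<^sup>2) * norm_L2 \<Omega> v"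
    unfolding norm_L2_def by (rule integral_Cauchy_Schwarz(2)[OF \<phi> vm p2 v2])
  also have "\<dots> \<le> T * sqrt (measure lebesgue B) * norm_L2 \<Omega> v"
    by (rule mult_right_mono[OF s]) (simp add: norm_L2_def)
  finally show "\<bar>LINT z|lebesgue_on \<Omega>. \<phi> z * v z\<bar> \<le> T * sqrt (measure lebesgue B) * norm_L2 \<Omega> v" .
qed

section \<open>Derivatives within convex sets and multi-indices\<close>

text \<open>
  At a boundary point there may be no coordinate direction in which one can stay in \<open>S\<close>. The
  difference of two derivatives vanishes along every segment into \<open>S\<close>, however, and the directions of
  these segments contain an open set.
\<close>

lemma has_derivative_unique_within_convex:
  fixes f :: "'a::euclidean_space \<Rightarrow> real"
  assumes S: "convex S" and int: "interior S \<noteq> {}" and x: "x \<in> S"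
    and A: "(f has_derivative A) (at x within S)" and B: "(f has_derivative B) (at x within S)"
  shows "A = B"
proof -
  define L where "L w = A w - B w" for w
  have 0: "((\<lambda>_. 0) has_derivative L) (at x within S)"
    using has_derivative_diff[OF A B] by (simp add: L_def[abs_def])
  then have L: "linear L" by (rule has_derivative_linear)
  have zero: "L (y - x) = 0" if y: "y \<in> S" for y
  proof -
    have path: "((\<lambda>t::real. x + t *\<^sub>R (y - x)) has_derivative (\<lambda>t. t *\<^sub>R (y - x))) (at 0 within {0..1})"
      by (rule derivative_eq_intros refl)+ simp
    have sub: "(\<lambda>t::real. x + t *\<^sub>R (y - x)) ` {0..1} \<subseteq> S"
    proof (intro image_subsetI)
      fix t :: real assume "t \<in> {0..1}"
      then have "(1 - t) *\<^sub>R x + t *\<^sub>R y \<in> S"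
        by (intro convexD[OF S x y]) auto
      then show "x + t *\<^sub>R (y - x) \<in> S" by (simp add: algebra_simps)
    qed
    have "((\<lambda>_. 0) has_derivative L) (at (x + 0 *\<^sub>R (y - x)) within (\<lambda>t::real. x + t *\<^sub>R (y - x)) ` {0..1})"
      using has_derivative_subset[OF 0 sub] by (simp only: scaleR_zero_left add_0_right)
    from diff_chain_within[OF path this]
    have "((\<lambda>_::real. 0) has_vector_derivative L (y - x)) (at 0 within {0..1})"
      unfolding has_vector_derivative_def o_def linear_scale[OF L] .
    moreover have "((\<lambda>_::real. 0::real) has_vector_derivative 0) (at 0 within {0..1})"
      by (rule has_vector_derivative_const)
    ultimately show ?thesis
      by (intro vector_derivative_unique_within_closed_interval[of 0 1 0 "\<lambda>_. 0"]) auto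
  qed
  obtain c where "c \<in> interior S" using int by blast
  then obtain r where r: "0 < r" "ball c r \<subseteq> S" unfolding mem_interior by blast
  have "L w = 0" for w
  proof (cases "w = 0")
    case True then show ?thesis using L by (simp add: linear_0)
  next
    case False
    define t where "t = r / (2 * norm w)"
    have t: "t > 0" using False r by (simp add: t_def)
    have "norm (t *\<^sub>R w) = r / 2" using False r unfolding norm_scaleR t_def by simp
    then have "c + t *\<^sub>R w \<in> ball c r" using r by (simp add: dist_norm)
    then have "L (c + t *\<^sub>R w - x) = 0" using zero r by blast
    moreover have "L (c - x) = 0" using zero r centre_in_ball by blast
    moreover have "L (t *\<^sub>R w) = L (c + t *\<^sub>R w - x) - L (c - x)"
      by (subst linear_diff[OF L, symmetric]) simp
    ultimately have "L (t *\<^sub>R w) = 0" by simp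
    then show ?thesis using t by (simp only: linear_scale[OF L] real_scaleR_def) simp
  qed
  then show ?thesis unfolding L_def by (intro ext) (metis eq_iff_diff_eq_0)
qed

lemma has_derivative_frechet_within_convex:
  fixes f :: "real ^ 'd \<Rightarrow> real"
  assumes "convex S" "interior S \<noteq> {}" "x \<in> S" "(f has_derivative f') (at x within S)"
  shows "frechet_derivative f (at x within S) = f'"
proof -
  have "f differentiable (at x within S)" using assms(4) by (auto simp: differentiable_def)
  then have "(f has_derivative frechet_derivative f (at x within S)) (at x within S)"
    by (simp add: frechet_derivative_works)
  then show ?thesis by (rule has_derivative_unique_within_convex[OF assms(1-3) _ assms(4)])
qed

text \<open>
  Frechet derivatives of functions that are not differentiable have no useful value; therefore
  linearity requires differentiability of all lower-order derivatives of the summands.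
\<close>

lemma iter_partial_deriv_sum:
  fixes u :: "'i \<Rightarrow> real ^ 'd \<Rightarrow> real"
  assumes S: "convex S" "interior S \<noteq> {}"
    and diff: "\<And>i js' x. i \<in> A \<Longrightarrow> length js' < length js \<Longrightarrow> x \<in> S \<Longrightarrow>
      iter_partial_deriv S js' (u i) differentiable (at x within S)"
  shows "x \<in> S \<Longrightarrow> iter_partial_deriv S js (\<lambda>x. \<Sum>i\<in>A. a i * u i x) x = (\<Sum>i\<in>A. a i * iter_partial_deriv S js (u i) x)"
  using diff
proof (induction js arbitrary: x)
  case Nil
  then show ?case by simp
next
  case (Cons j js)
  define D where "D i = frechet_derivative (iter_partial_deriv S js (u i)) (at x within S)" for i
  have D: "(iter_partial_deriv S js (u i) has_derivative D i) (at x within S)" if "i \<in> A" for i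
    unfolding D_def frechet_derivative_works[symmetric] using Cons.prems that by auto
  have D_sum: "((\<lambda>x. \<Sum>i\<in>A. a i * iter_partial_deriv S js (u i) x) has_derivative (\<lambda>w. \<Sum>i\<in>A. a i * D i w)) (at x within S)"
    by (intro has_derivative_sum has_derivative_mult_right D)
  have eq: "iter_partial_deriv S js (\<lambda>x. \<Sum>i\<in>A. a i * u i x) y = (\<Sum>i\<in>A. a i * iter_partial_deriv S js (u i) y)"
    if "y \<in> S" for y
    by (rule Cons.IH[OF that]) (rule Cons.prems(2), auto)
  have "(iter_partial_deriv S js (\<lambda>x. \<Sum>i\<in>A. a i * u i x) has_derivative (\<lambda>w. \<Sum>i\<in>A. a i * D i w)) (at x within S)"
    by (rule has_derivative_transform[OF Cons.prems(1) _ D_sum]) (rule eq)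
  from has_derivative_frechet_within_convex[OF S Cons.prems(1) this]
  show ?case by (simp add: partial_deriv_def D_def)
qed

lemma has_derivative_prod_components:
  fixes u :: "'d::finite \<Rightarrow> real \<Rightarrow> real" and y :: "real ^ 'd"
  assumes "\<And>i. (u i has_real_derivative u' i) (at (y $ i))"
  shows "((\<lambda>y. \<Prod>i\<in>UNIV. u i (y $ i)) has_derivative
          (\<lambda>w. \<Sum>i\<in>UNIV. w $ i * (u' i * (\<Prod>j\<in>UNIV - {i}. u j (y $ j))))) (at y)"
proof -
  have "((\<lambda>y. u i (y $ i)) has_derivative (\<lambda>w. w $ i * u' i)) (at y)" for i
  proof -
    have "((\<lambda>y. y $ i) has_derivative (\<lambda>w. w $ i)) (at y)"
      by (rule bounded_linear_imp_has_derivative[OF bounded_linear_vec_nth])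
    from has_derivative_compose[OF this assms[of i, unfolded has_field_derivative_def]]
    show ?thesis by (simp add: mult.commute)
  qed
  from has_derivative_prod[where I = UNIV and f = "\<lambda>i y. u i (y $ i)", OF this]
  show ?thesis by (simp add: mult.assoc)
qed

text \<open>
  Iterated partial derivatives are indexed by lists of directions, weak derivatives by
  multi-indices. Derivatives of the mollifiers below depend on the list only through its multi-index.
\<close>

definition list_mi :: "'d::finite list \<Rightarrow> nat ^ 'd" where
  "list_mi js = (\<chi> i. count_list js i)"

definition unit_mi :: "'d::finite \<Rightarrow> nat ^ 'd" where
  "unit_mi i = axis i 1"

lemma unit_mi_nth: "unit_mi i $ j = (if j = i then 1 else 0)"
  by (simp add: unit_mi_def axis_def)

lemma list_mi_Nil [simp]: "list_mi [] = 0"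
  by (simp add: list_mi_def vec_eq_iff)

lemma list_mi_Cons [simp]: "list_mi (i # js) = list_mi js + unit_mi i"
  by (simp add: list_mi_def vec_eq_iff unit_mi_nth)

lemma mi_order_zero [simp]: "mi_order 0 = 0"
  by (simp add: mi_order_def)

lemma mi_order_add: "mi_order (\<beta> + \<gamma>) = mi_order \<beta> + mi_order \<gamma>"
  by (simp add: mi_order_def sum.distrib)

lemma mi_order_unit_mi [simp]: "mi_order (unit_mi i) = 1"
  by (simp add: mi_order_def unit_mi_nth)

lemma mi_order_list_mi [simp]: "mi_order (list_mi js) = length js"
  by (induction js) (simp_all add: mi_order_add)

lemma ex_list_mi: "\<exists>js. list_mi js = \<beta>"
proof -
  obtain js where js: "mset js = (\<Sum>i\<in>UNIV. replicate_mset (\<beta> $ i) i)"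
    using ex_mset by blast
  have "count_list js i = \<beta> $ i" for i
  proof -
    have "count_list js i = count (mset js) i" by (induction js) auto
    also have "\<dots> = (\<Sum>j\<in>UNIV. if j = i then \<beta> $ j else 0)"
      unfolding js by (simp add: count_sum count_replicate_mset eq_commute cong: if_cong)
    finally show ?thesis by simp
  qed
  then show ?thesis by (intro exI[of _ js]) (simp add: list_mi_def vec_eq_iff)
qed

text \<open>
  The list chosen in the definition depends on the multi-index only, so the same list serves all
  domains and functions.
\<close>

lemma multi_deriv_eq_iter:
  obtains js where "list_mi js = \<beta>" and "\<And>S f. multi_deriv S \<beta> f = iter_partial_deriv S js f"
proof
  obtain js where "list_mi js = \<beta>" using ex_list_mi by blast
  then have "\<forall>i. count_list js i = \<beta> $ i" by (auto simp: list_mi_def)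
  from someI[of "\<lambda>js. \<forall>i. count_list js i = \<beta> $ i", OF this]
  show "list_mi (SOME js. \<forall>i. count_list js i = \<beta> $ i) = \<beta>"
    by (simp add: list_mi_def vec_eq_iff)
  show "multi_deriv S \<beta> f = iter_partial_deriv S (SOME js. \<forall>i. count_list js i = \<beta> $ i) f" for S f
    by (simp add: multi_deriv_def)
qed

lemma finite_mi_order_le: "finite {\<beta> :: nat ^ 'd::finite. mi_order \<beta> \<le> n}"
proof (rule finite_subset)
  show "finite (vec_lambda ` (UNIV \<rightarrow>\<^sub>E {..n} :: ('d \<Rightarrow> nat) set))"
    by (intro finite_imageI finite_PiE) auto
  show "{\<beta> :: nat ^ 'd. mi_order \<beta> \<le> n} \<subseteq> vec_lambda ` (UNIV \<rightarrow>\<^sub>E {..n})"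
  proof
    fix \<beta> :: "nat ^ 'd" assume "\<beta> \<in> {\<beta>. mi_order \<beta> \<le> n}"
    then have "\<beta> $ i \<le> n" for i
      using member_le_sum[of i UNIV "\<lambda>i. \<beta> $ i"] by (auto simp: mi_order_def)
    then have "vec_nth \<beta> \<in> UNIV \<rightarrow>\<^sub>E {..n}" by auto
    then show "\<beta> \<in> vec_lambda ` (UNIV \<rightarrow>\<^sub>E {..n})"
      by (intro image_eqI[of _ _ "vec_nth \<beta>"]) (auto simp: vec_lambda_eta)
  qed
qed

lemma mi_le_order: "\<beta> $ i \<le> mi_order \<beta>"
  using member_le_sum[of i UNIV "\<lambda>i. \<beta> $ i"] by (auto simp: mi_order_def)

section \<open>Mollifiers that contract towards an interior point\<close>

locale smoothing =
  fixes b :: "nat \<Rightarrow> real \<Rightarrow> real" and \<rho> :: real and c :: "real ^ 'd"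
  assumes rho_pos: "0 < \<rho>"
    and b_deriv: "\<And>n t. (b n has_real_derivative b (Suc n) t) (at t)"
    and b_support: "\<And>n t. \<rho> \<le> \<bar>t\<bar> \<Longrightarrow> b n t = 0"
    and b_nonneg: "\<And>t. 0 \<le> b 0 t"
    and b_pos: "0 < b 0 0"
begin

text \<open>
  This is the \<open>n\<close>-th derivative in \<open>t\<close> of \<open>(t - \<xi>) ^ g * b 0 t\<close>. The powers of \<open>t - \<xi>\<close> arise
  from derivatives in the scale parameter. For \<open>n = 0\<close> the predecessor \<open>n - 1\<close> is harmless because of the
  factor \<open>n\<close>.
\<close>

primrec bump_moment :: "nat \<Rightarrow> nat \<Rightarrow> real \<Rightarrow> real \<Rightarrow> real" where
  "bump_moment 0 n \<xi> t = b n t"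
| "bump_moment (Suc g) n \<xi> t = (t - \<xi>) * bump_moment g n \<xi> t + real n * bump_moment g (n - 1) \<xi> t"

lemma bump_moment_support: "\<rho> \<le> \<bar>t\<bar> \<Longrightarrow> bump_moment g n \<xi> t = 0"
  by (induction g arbitrary: n) (auto simp: b_support)

lemma bump_moment_deriv: "(bump_moment g n \<xi> has_real_derivative bump_moment g (Suc n) \<xi> t) (at t)"
proof (induction g arbitrary: n)
  case 0
  have "bump_moment 0 n \<xi> = b n" for n by (simp add: fun_eq_iff)
  then show ?case by (simp add: b_deriv)
next
  case (Suc g)
  have "(bump_moment (Suc g) n \<xi> has_real_derivative
      (1 * bump_moment g n \<xi> t + bump_moment g (Suc n) \<xi> t * (t - \<xi>)) + real n * bump_moment g (Suc (n - 1)) \<xi> t) (at t)"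
  proof -
    have "bump_moment (Suc g) n \<xi> = (\<lambda>t. (t - \<xi>) * bump_moment g n \<xi> t + real n * bump_moment g (n - 1) \<xi> t)"
      by (simp add: fun_eq_iff)
    moreover have "((\<lambda>t. t - \<xi>) has_real_derivative 1) (at t)"
      by (auto intro!: derivative_eq_intros)
    ultimately show ?thesis
      by (simp only:) (intro DERIV_add DERIV_mult DERIV_cmult Suc.IH)
  qed
  then show ?case
    by (rule DERIV_cong) (cases n; simp add: algebra_simps)
qed

lemma bump_moment_bound: "\<exists>C. \<forall>\<xi> t. \<bar>\<xi>\<bar> \<le> R \<longrightarrow> \<bar>bump_moment g n \<xi> t\<bar> \<le> C"
proof (induction g arbitrary: n)
  case 0
  have "continuous_on {-\<rho>..\<rho>} (b n)"
    by (intro continuous_at_imp_continuous_on ballI DERIV_isCont[OF b_deriv])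
  then have "bounded (b n ` {-\<rho>..\<rho>})"
    by (intro compact_imp_bounded compact_continuous_image) auto
  then obtain C where C: "\<And>t. t \<in> {-\<rho>..\<rho>} \<Longrightarrow> \<bar>b n t\<bar> \<le> C"
    unfolding bounded_iff by fastforce
  have "\<bar>b n t\<bar> \<le> C" for t
  proof (cases "t \<in> {-\<rho>..\<rho>}")
    case False
    then have "b n t = 0" by (intro b_support) auto
    then show ?thesis using C[of 0] rho_pos by (simp add: order_trans[OF abs_ge_zero])
  qed (rule C)
  then show ?case by auto
next
  case (Suc g)
  obtain C1 where C1: "\<And>\<xi> t. \<bar>\<xi>\<bar> \<le> R \<Longrightarrow> \<bar>bump_moment g n \<xi> t\<bar> \<le> C1" using Suc.IH by blast
  obtain C2 where C2: "\<And>\<xi> t. \<bar>\<xi>\<bar> \<le> R \<Longrightarrow> \<bar>bump_moment g (n - 1) \<xi> t\<bar> \<le> C2" using Suc.IH by blast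
  have "\<bar>bump_moment (Suc g) n \<xi> t\<bar> \<le> (\<rho> + R) * C1 + real n * C2" if \<xi>: "\<bar>\<xi>\<bar> \<le> R" for \<xi> t
  proof (cases "\<rho> \<le> \<bar>t\<bar>")
    case True
    have "0 \<le> C1" "0 \<le> C2" "0 \<le> R" using C1[OF \<xi>, of 0] C2[OF \<xi>, of 0] \<xi> by linarith+
    then show ?thesis using bump_moment_support[OF True] rho_pos by (simp del: bump_moment.simps)
  next
    case False
    have "\<bar>bump_moment (Suc g) n \<xi> t\<bar> \<le> \<bar>t - \<xi>\<bar> * \<bar>bump_moment g n \<xi> t\<bar> + real n * \<bar>bump_moment g (n - 1) \<xi> t\<bar>"
      using abs_triangle_ineq[of "(t - \<xi>) * bump_moment g n \<xi> t" "real n * bump_moment g (n - 1) \<xi> t"]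
      by (simp add: abs_mult)
    also have "\<dots> \<le> (\<rho> + R) * C1 + real n * C2"
      using False \<xi> rho_pos C1[OF \<xi>, of t] C2[OF \<xi>, of t] by (intro add_mono mult_mono) auto
    finally show ?thesis .
  qed
  then show ?case by blast
qed

text \<open>
  With \<open>t = \<xi> + (\<zeta> - \<xi>) / s\<close>, that is \<open>\<zeta> = \<xi> + s * (t - \<xi>)\<close>, this is \<open>(- 1) ^ n\<close> times the
  \<open>n\<close>-th \<open>\<zeta>\<close>-derivative of the rescaled function \<open>1 / s * (t - \<xi>) ^ g * b 0 t\<close>. The normalisation is
  chosen such that each derivative rule below has a single kernel on its right-hand side.
\<close>

definition moll1 :: "nat \<Rightarrow> nat \<Rightarrow> real \<Rightarrow> real \<Rightarrow> real \<Rightarrow> real" where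
  "moll1 g n s \<xi> \<zeta> = (- 1) ^ n / s ^ Suc n * bump_moment g n \<xi> (\<xi> + (\<zeta> - \<xi>) / s)"

text \<open>
  The transport identity behind the whole argument: up to sign, a derivative in the scale is a derivative in
  space of the same kernel multiplied by \<open>t - \<xi>\<close>. The term from differentiating \<open>1 / s ^ Suc n\<close> is
  absorbed by the Leibniz rule for the factor \<open>t - \<xi>\<close>.
\<close>

lemma moll1_deriv_scale:
  assumes "0 < s"
  shows "((\<lambda>s. moll1 g n s \<xi> \<zeta>) has_real_derivative moll1 (Suc g) (Suc n) s \<xi> \<zeta>) (at s)"
proof -
  define y where "y s = \<xi> + (\<zeta> - \<xi>) / s" for s
  have dy: "(y has_real_derivative - (\<zeta> - \<xi>) / s\<^sup>2) (at s)"
    unfolding y_def using assms by (auto intro!: derivative_eq_intros simp: power2_eq_square)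
  have dp: "((\<lambda>s. (- 1) ^ n / s ^ Suc n) has_real_derivative - ((- 1) ^ n * real (Suc n) / s ^ Suc (Suc n))) (at s)"
  proof -
    have "((\<lambda>s. (- 1) ^ n * inverse (s ^ Suc n)) has_real_derivative
        (- 1) ^ n * - (real (Suc n) * s ^ n * inverse ((s ^ Suc n)\<^sup>2))) (at s)"
      by (rule DERIV_cmult, rule DERIV_cong[OF DERIV_inverse_fun[OF DERIV_pow]])
         (use assms in \<open>auto simp: power2_eq_square\<close>)
    then show ?thesis
      unfolding divide_inverse
      by (rule DERIV_cong) (use assms in \<open>simp add: field_simps power2_eq_square\<close>)
  qed
  have "((\<lambda>s. (- 1) ^ n / s ^ Suc n * bump_moment g n \<xi> (y s)) has_real_derivative
      - ((- 1) ^ n * real (Suc n) / s ^ Suc (Suc n)) * bump_moment g n \<xi> (y s) +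
      (bump_moment g (Suc n) \<xi> (y s) * (- (\<zeta> - \<xi>) / s\<^sup>2)) * ((- 1) ^ n / s ^ Suc n)) (at s)"
    by (rule DERIV_mult[OF dp DERIV_chain2[OF bump_moment_deriv dy]])
  moreover have "- ((- 1) ^ n * real (Suc n) / s ^ Suc (Suc n)) * bump_moment g n \<xi> (y s) +
      (bump_moment g (Suc n) \<xi> (y s) * (- (\<zeta> - \<xi>) / s\<^sup>2)) * ((- 1) ^ n / s ^ Suc n) = moll1 (Suc g) (Suc n) s \<xi> \<zeta>"
  proof -
    define q where "q = s ^ Suc n"
    have q: "s ^ Suc (Suc n) = s * q" by (simp add: q_def)
    have y: "- (\<zeta> - \<xi>) / s\<^sup>2 = - (y s - \<xi>) / s"
      by (simp add: y_def power2_eq_square divide_inverse algebra_simps)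
    have "moll1 (Suc g) (Suc n) s \<xi> \<zeta> = (- 1) ^ Suc n / (s * q) *
        ((y s - \<xi>) * bump_moment g (Suc n) \<xi> (y s) + real (Suc n) * bump_moment g n \<xi> (y s))"
      by (simp only: moll1_def q y_def[symmetric] bump_moment.simps diff_Suc_1)
    also have "\<dots> = - ((- 1) ^ n * real (Suc n) / (s * q)) * bump_moment g n \<xi> (y s) +
      (bump_moment g (Suc n) \<xi> (y s) * (- (y s - \<xi>) / s)) * ((- 1) ^ n / q)"
      by (simp add: divide_inverse algebra_simps)
    finally show ?thesis unfolding y q unfolding q_def by simp
  qed
  ultimately show ?thesis unfolding moll1_def y_def by simp
qed

lemma moll1_deriv_arg:
  "((\<lambda>\<zeta>. moll1 g n s \<xi> \<zeta>) has_real_derivative - moll1 g (Suc n) s \<xi> \<zeta>) (at \<zeta>)"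
proof -
  have "((\<lambda>\<zeta>. \<xi> + (\<zeta> - \<xi>) / s) has_real_derivative 1 / s) (at \<zeta>)"
    by (cases "s = 0") (auto intro!: derivative_eq_intros)
  from DERIV_cmult[OF DERIV_chain2[OF bump_moment_deriv[of g n \<xi>] this], of "(- 1) ^ n / s ^ Suc n"]
  show ?thesis unfolding moll1_def by (rule DERIV_cong) simp
qed

lemma moll1_deriv_base:
  assumes "0 < s"
  shows "((\<lambda>\<xi>. moll1 0 n s \<xi> \<zeta>) has_real_derivative (1 - s) * moll1 0 (Suc n) s \<xi> \<zeta>) (at \<xi>)"
proof -
  have "((\<lambda>\<xi>. \<xi> + (\<zeta> - \<xi>) / s) has_real_derivative 1 - 1 / s) (at \<xi>)"
    using assms by (auto intro!: derivative_eq_intros)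
  from DERIV_cmult[OF DERIV_chain2[OF b_deriv[of n] this], of "(- 1) ^ n / s ^ Suc n"]
  show ?thesis unfolding moll1_def bump_moment.simps
    by (rule DERIV_cong) (use assms in \<open>simp add: field_simps\<close>)
qed

text \<open>
  The order of differentiation in space is \<open>\<beta>\<close>, and \<open>\<gamma>\<close> counts factors \<open>y - x\<close>; the product form
  makes mixed derivatives depend on the multi-index only.
\<close>

definition moll :: "nat ^ 'd \<Rightarrow> nat ^ 'd \<Rightarrow> real \<Rightarrow> real ^ 'd \<Rightarrow> real ^ 'd \<Rightarrow> real" where
  "moll \<beta> \<gamma> s x z = (\<Prod>i\<in>UNIV. moll1 (\<gamma> $ i) (\<beta> $ i) s (x $ i - c $ i) (z $ i - c $ i))"

lemma moll_axis:
  "moll (\<beta> + unit_mi i) (\<gamma> + unit_mi i) s x z =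
     moll1 (Suc (\<gamma> $ i)) (Suc (\<beta> $ i)) s (x $ i - c $ i) (z $ i - c $ i) *
     (\<Prod>j\<in>UNIV - {i}. moll1 (\<gamma> $ j) (\<beta> $ j) s (x $ j - c $ j) (z $ j - c $ j))"
  "moll (\<beta> + unit_mi i) \<gamma> s x z =
     moll1 (\<gamma> $ i) (Suc (\<beta> $ i)) s (x $ i - c $ i) (z $ i - c $ i) *
     (\<Prod>j\<in>UNIV - {i}. moll1 (\<gamma> $ j) (\<beta> $ j) s (x $ j - c $ j) (z $ j - c $ j))"
  unfolding moll_def by (subst prod.remove[of UNIV i]; simp add: unit_mi_nth)+

lemma moll_deriv_scale:
  assumes "0 < s"
  shows "((\<lambda>s. moll \<beta> \<gamma> s x z) has_real_derivative
     (\<Sum>i\<in>UNIV. moll (\<beta> + unit_mi i) (\<gamma> + unit_mi i) s x z)) (at s)"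
  unfolding moll_axis(1) unfolding moll_def
  by (rule has_field_derivative_prod[OF moll1_deriv_scale[OF assms]])

lemma moll_deriv_arg:
  "(moll \<beta> \<gamma> s x has_derivative (\<lambda>w. \<Sum>i\<in>UNIV. w $ i * - moll (\<beta> + unit_mi i) \<gamma> s x z)) (at z)"
proof -
  have "((\<lambda>\<zeta>. moll1 (\<gamma> $ i) (\<beta> $ i) s (x $ i - c $ i) (\<zeta> - c $ i)) has_real_derivative
      - moll1 (\<gamma> $ i) (Suc (\<beta> $ i)) s (x $ i - c $ i) (z $ i - c $ i)) (at (z $ i))" for i
    by (rule DERIV_cong[OF DERIV_chain2[OF moll1_deriv_arg]]) (auto intro!: derivative_eq_intros)
  from has_derivative_prod_components[OF this]
  show ?thesis unfolding moll_axis(2) by (simp add: moll_def[abs_def])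
qed

lemma moll_deriv_base:
  assumes "0 < s"
  shows "((\<lambda>x. moll \<beta> 0 s x z) has_derivative
     (\<lambda>w. \<Sum>i\<in>UNIV. w $ i * ((1 - s) * moll (\<beta> + unit_mi i) 0 s x z))) (at x)"
proof -
  have "((\<lambda>\<xi>. moll1 0 (\<beta> $ i) s (\<xi> - c $ i) (z $ i - c $ i)) has_real_derivative
      (1 - s) * moll1 0 (Suc (\<beta> $ i)) s (x $ i - c $ i) (z $ i - c $ i)) (at (x $ i))" for i
    by (rule DERIV_cong[OF DERIV_chain2[OF moll1_deriv_base[OF assms]]]) (auto intro!: derivative_eq_intros)
  from has_derivative_prod_components[OF this]
  show ?thesis unfolding moll_axis(2) by (simp add: moll_def[abs_def] mult.assoc)
qed

text \<open>
  The image of the box of radius \<open>\<rho>\<close> around \<open>c\<close> under the contraction \<open>y \<mapsto> x + s (y - x)\<close>.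
\<close>

definition supp_box :: "real \<Rightarrow> real ^ 'd \<Rightarrow> (real ^ 'd) set" where
  "supp_box s x = cbox (\<chi> i. (1 - s) * x $ i + s * (c $ i - \<rho>)) (\<chi> i. (1 - s) * x $ i + s * (c $ i + \<rho>))"

lemma moll_support:
  assumes "0 < s" "z \<notin> supp_box s x"
  shows "moll \<beta> \<gamma> s x z = 0"
proof -
  obtain i where i: "\<not> ((1 - s) * x $ i + s * (c $ i - \<rho>) \<le> z $ i \<and> z $ i \<le> (1 - s) * x $ i + s * (c $ i + \<rho>))"
    using assms(2) by (auto simp: supp_box_def mem_box_cart)
  define y where "y = (x $ i - c $ i) + ((z $ i - c $ i) - (x $ i - c $ i)) / s"
  have "z $ i = (1 - s) * x $ i + s * (c $ i + y)" using assms(1) by (simp add: y_def field_simps)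
  with i have "\<not> (s * (c $ i - \<rho>) \<le> s * (c $ i + y) \<and> s * (c $ i + y) \<le> s * (c $ i + \<rho>))" by linarith
  with assms(1) have "\<not> (- \<rho> \<le> y \<and> y \<le> \<rho>)" by simp
  then have "bump_moment (\<gamma> $ i) (\<beta> $ i) (x $ i - c $ i) y = 0" by (intro bump_moment_support) auto
  then have "moll1 (\<gamma> $ i) (\<beta> $ i) s (x $ i - c $ i) (z $ i - c $ i) = 0"
    by (simp add: moll1_def y_def)
  then show ?thesis unfolding moll_def by (intro prod_zero) auto
qed

text \<open>
  The sizes of the one-dimensional factors multiply, and each contributes \<open>s\<close> to the power
  minus one minus its order of differentiation.
\<close>

lemma moll_bound:
  obtains C where "0 \<le> C" and "\<And>\<beta> \<gamma> s x z. mi_order \<beta> \<le> N \<Longrightarrow> mi_order \<gamma> \<le> N \<Longrightarrow> 0 < s \<Longrightarrow>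
      (\<And>i. \<bar>x $ i - c $ i\<bar> \<le> R) \<Longrightarrow> \<bar>moll \<beta> \<gamma> s x z\<bar> \<le> C / s ^ (CARD('d) + mi_order \<beta>)"
proof -
  obtain T where T: "\<And>g n \<xi> t. \<bar>\<xi>\<bar> \<le> R \<Longrightarrow> \<bar>bump_moment g n \<xi> t\<bar> \<le> T g n"
    using bump_moment_bound[of R] by metis
  define K where "K = (\<Sum>g\<le>N. \<Sum>n\<le>N. \<bar>T g n\<bar>)"
  have K: "\<bar>bump_moment g n \<xi> t\<bar> \<le> K" if "\<bar>\<xi>\<bar> \<le> R" "g \<le> N" "n \<le> N" for g n \<xi> t
  proof -
    have "\<bar>bump_moment g n \<xi> t\<bar> \<le> \<bar>T g n\<bar>" using T[OF that(1)] by (meson abs_ge_self order_trans)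
    also have "\<dots> \<le> (\<Sum>n\<le>N. \<bar>T g n\<bar>)" using that by (intro member_le_sum) auto
    also have "\<dots> \<le> K" unfolding K_def using that
      by (intro member_le_sum[of g _ "\<lambda>g. \<Sum>n\<le>N. \<bar>T g n\<bar>"]) (auto intro: sum_nonneg)
    finally show ?thesis .
  qed
  have K0: "0 \<le> K" unfolding K_def by (intro sum_nonneg) auto
  show ?thesis
  proof
    show "0 \<le> K ^ CARD('d)" using K0 by simp
    fix \<beta> \<gamma> :: "nat ^ 'd" and s :: real and x z :: "real ^ 'd"
    assume o: "mi_order \<beta> \<le> N" "mi_order \<gamma> \<le> N" and s: "0 < s" and x: "\<And>i. \<bar>x $ i - c $ i\<bar> \<le> R"
    have "\<bar>moll \<beta> \<gamma> s x z\<bar> = (\<Prod>i\<in>UNIV. \<bar>moll1 (\<gamma> $ i) (\<beta> $ i) s (x $ i - c $ i) (z $ i - c $ i)\<bar>)"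
      unfolding moll_def by (rule abs_prod)
    also have "\<dots> \<le> (\<Prod>i\<in>UNIV. K / s ^ Suc (\<beta> $ i))"
    proof (intro prod_mono conjI)
      fix i
      have "\<bar>moll1 (\<gamma> $ i) (\<beta> $ i) s (x $ i - c $ i) (z $ i - c $ i)\<bar> =
         \<bar>bump_moment (\<gamma> $ i) (\<beta> $ i) (x $ i - c $ i) (x $ i - c $ i + (z $ i - c $ i - (x $ i - c $ i)) / s)\<bar> / s ^ Suc (\<beta> $ i)"
        unfolding moll1_def abs_mult abs_divide using s by (simp add: power_abs)
      also have "\<dots> \<le> K / s ^ Suc (\<beta> $ i)"
        using s o mi_le_order[of \<beta> i] mi_le_order[of \<gamma> i]
        by (intro divide_right_mono K x) auto
      finally show "\<bar>moll1 (\<gamma> $ i) (\<beta> $ i) s (x $ i - c $ i) (z $ i - c $ i)\<bar> \<le> K / s ^ Suc (\<beta> $ i)" .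
    qed simp
    also have "\<dots> = K ^ CARD('d) / s ^ (\<Sum>i\<in>UNIV. Suc (\<beta> $ i))"
      by (simp only: prod_dividef power_sum) simp
    also have "(\<Sum>i\<in>UNIV. Suc (\<beta> $ i)) = CARD('d) + mi_order \<beta>"
      by (simp add: mi_order_def sum_Suc)
    finally show "\<bar>moll \<beta> \<gamma> s x z\<bar> \<le> K ^ CARD('d) / s ^ (CARD('d) + mi_order \<beta>)" .
  qed
qed

lemma partial_deriv_UNIV_moll:
  "partial_deriv UNIV i (\<lambda>z. a * moll \<beta> \<gamma> s x z) z = - a * moll (\<beta> + unit_mi i) \<gamma> s x z"
proof -
  have "((\<lambda>z. a * moll \<beta> \<gamma> s x z) has_derivative
      (\<lambda>w. a * (\<Sum>i\<in>UNIV. w $ i * - moll (\<beta> + unit_mi i) \<gamma> s x z))) (at z)"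
    by (intro has_derivative_mult_right moll_deriv_arg)
  then have "frechet_derivative (\<lambda>z. a * moll \<beta> \<gamma> s x z) (at z) =
      (\<lambda>w. a * (\<Sum>i\<in>UNIV. w $ i * - moll (\<beta> + unit_mi i) \<gamma> s x z))"
    by (rule frechet_derivative_at[symmetric])
  then have "partial_deriv UNIV i (\<lambda>z. a * moll \<beta> \<gamma> s x z) z =
      a * (\<Sum>j\<in>UNIV. if i = j then - moll (\<beta> + unit_mi j) \<gamma> s x z else 0)"
    by (simp add: partial_deriv_def axis_def if_distrib[of "\<lambda>t. t * _"] eq_commute sum_negf cong: if_cong)
  then show ?thesis by simp
qed

lemma iter_partial_deriv_UNIV_moll:
  "iter_partial_deriv UNIV js (moll \<beta> \<gamma> s x) = (\<lambda>z. (- 1) ^ length js * moll (\<beta> + list_mi js) \<gamma> s x z)"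
proof (induction js)
  case (Cons i js)
  show ?case
    by (rule ext) (simp add: Cons.IH partial_deriv_UNIV_moll add.assoc)
qed simp

lemma multi_deriv_UNIV_moll:
  "multi_deriv UNIV \<beta>' (moll \<beta> \<gamma> s x) z = (- 1) ^ mi_order \<beta>' * moll (\<beta> + \<beta>') \<gamma> s x z"
proof -
  obtain js where js: "list_mi js = \<beta>'"
    "\<And>S f. multi_deriv S \<beta>' f = iter_partial_deriv S js (f :: real ^ 'd \<Rightarrow> real)"
    using multi_deriv_eq_iter[of \<beta>'] by blast
  show ?thesis unfolding js(2) iter_partial_deriv_UNIV_moll using js(1) mi_order_list_mi[of js] by simp
qed

lemma test_function_moll:
  assumes "0 < s" "supp_box s x \<subseteq> U"
  shows "test_function U (moll \<beta> \<gamma> s x)"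
proof -
  have "{z. moll \<beta> \<gamma> s x z \<noteq> 0} \<subseteq> supp_box s x" using moll_support[OF assms(1)] by blast
  then have sub: "closure {z. moll \<beta> \<gamma> s x z \<noteq> 0} \<subseteq> supp_box s x"
    by (rule closure_minimal) (simp add: supp_box_def closed_cbox)
  have "compact (closure {z. moll \<beta> \<gamma> s x z \<noteq> 0})"
    unfolding compact_closure
    by (rule bounded_subset[OF bounded_cbox])
       (use \<open>{z. moll \<beta> \<gamma> s x z \<noteq> 0} \<subseteq> supp_box s x\<close> in \<open>simp add: supp_box_def\<close>)
  moreover have "iter_partial_deriv UNIV js (moll \<beta> \<gamma> s x) differentiable_on UNIV" for js
    unfolding iter_partial_deriv_UNIV_moll differentiable_on_def differentiable_def
    using has_derivative_mult_right[OF moll_deriv_arg] by blast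
  ultimately show ?thesis unfolding test_function_def using sub assms(2) by blast
qed

lemma continuous_on_moll: "continuous_on A (moll \<beta> \<gamma> s x)"
  by (intro continuous_at_imp_continuous_on ballI has_derivative_continuous[OF moll_deriv_arg])

end

section \<open>Averages over contracted boxes\<close>

locale smoothing_domain = smoothing b \<rho> c
  for b :: "nat \<Rightarrow> real \<Rightarrow> real" and \<rho> :: real and c :: "real ^ 'd" +
  fixes \<Omega> :: "(real ^ 'd) set"
  assumes convex: "convex \<Omega>" and compact: "compact \<Omega>"
    and box_subset: "cbox (\<chi> i. c $ i - \<rho>) (\<chi> i. c $ i + \<rho>) \<subseteq> interior \<Omega>"
begin

lemma Omega_sets [simp, intro]: "\<Omega> \<in> sets lebesgue"
  using compact by (intro lmeasurable_compact fmeasurableD)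

lemma finite_measure_Omega: "finite_measure (lebesgue_on \<Omega>)"
  using compact by (intro finite_measure_lebesgue_on lmeasurable_compact)

lemma center_mem: "c \<in> interior \<Omega>"
proof -
  have "c \<in> cbox (\<chi> i. c $ i - \<rho>) (\<chi> i. c $ i + \<rho>)" using rho_pos by (simp add: mem_box_cart)
  then show ?thesis using box_subset by blast
qed

lemma interior_nonempty: "interior \<Omega> \<noteq> {}"
  using center_mem by blast

text \<open>
  The segment from a point of \<open>\<Omega>\<close> to an interior point lies in the interior, except possibly for
  its starting point.
\<close>

lemma supp_box_subset:
  assumes "x \<in> \<Omega>" "0 < s" "s \<le> 1"
  shows "supp_box s x \<subseteq> interior \<Omega>"
proof
  fix z assume z: "z \<in> supp_box s x"
  define y where "y = x + (1 / s) *\<^sub>R (z - x)"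
  have "s * (c $ i - \<rho>) \<le> s * y $ i \<and> s * y $ i \<le> s * (c $ i + \<rho>)" for i
    using z assms(2) by (auto simp: supp_box_def mem_box_cart y_def algebra_simps)
  then have "y \<in> cbox (\<chi> i. c $ i - \<rho>) (\<chi> i. c $ i + \<rho>)"
    using assms(2) by (simp add: mem_box_cart)
  then have "y \<in> interior \<Omega>" using box_subset by blast
  from mem_interior_convex_shrink[OF convex this assms]
  show "z \<in> interior \<Omega>" using assms(2) by (simp add: y_def)
qed

lemma supp_box_subset': "x \<in> \<Omega> \<Longrightarrow> 0 < s \<Longrightarrow> s \<le> 1 \<Longrightarrow> supp_box s x \<subseteq> \<Omega>"
  using supp_box_subset interior_subset by blast

lemma measure_supp_box: "0 < s \<Longrightarrow> measure lebesgue (supp_box s x) = (2 * \<rho> * s) ^ CARD('d)"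
proof -
  assume s: "0 < s"
  define lo hi where "lo = (\<chi> i. (1 - s) * x $ i + s * (c $ i - \<rho>))"
    and "hi = (\<chi> i. (1 - s) * x $ i + s * (c $ i + \<rho>))"
  have "\<forall>i. lo $ i \<le> hi $ i" using s rho_pos by (simp add: lo_def hi_def)
  then have "lo \<in> cbox lo hi" by (simp add: mem_box_cart)
  then have "measure lebesgue (cbox lo hi) = (\<Prod>i\<in>UNIV. hi $ i - lo $ i)"
    using content_cbox_cart[of lo hi] by auto
  also have "\<dots> = (2 * \<rho> * s) ^ CARD('d)"
    by (simp add: lo_def hi_def algebra_simps)
  finally show ?thesis by (simp add: supp_box_def lo_def hi_def)
qed

lemma supp_box_lmeasurable [simp]: "supp_box s x \<in> lmeasurable"
  by (simp add: supp_box_def)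

lemma moll_measurable [measurable]: "moll \<beta> \<gamma> s x \<in> borel_measurable (lebesgue_on \<Omega>)"
  by (rule continuous_imp_measurable_on_sets_lebesgue[OF continuous_on_moll]) simp

lemma Omega_bounded:
  obtains R where "0 \<le> R" and "\<And>x i. x \<in> \<Omega> \<Longrightarrow> \<bar>x $ i - c $ i\<bar> \<le> R"
proof -
  have "bounded \<Omega>" using compact by (rule compact_imp_bounded)
  then have "\<exists>R. \<forall>x\<in>\<Omega>. dist c x \<le> R" by (simp only: bounded_any_center[of \<Omega> c])
  then obtain R where R: "\<And>x. x \<in> \<Omega> \<Longrightarrow> dist c x \<le> R" by blast
  have "\<bar>x $ i - c $ i\<bar> \<le> \<bar>R\<bar>" if "x \<in> \<Omega>" for x i
    using component_le_norm_cart[of "x - c" i] R[OF that] by (simp add: dist_norm norm_minus_commute)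
  then show ?thesis using that[of "\<bar>R\<bar>"] by auto
qed

lemma moll_bound_Omega:
  obtains C where "0 < C" and "\<And>\<beta> \<gamma> s x z. mi_order \<beta> \<le> N \<Longrightarrow> mi_order \<gamma> \<le> N \<Longrightarrow> 0 < s \<Longrightarrow>
      x \<in> \<Omega> \<Longrightarrow> \<bar>moll \<beta> \<gamma> s x z\<bar> \<le> C / s ^ (CARD('d) + mi_order \<beta>)"
proof -
  obtain R where R: "\<And>x i. x \<in> \<Omega> \<Longrightarrow> \<bar>x $ i - c $ i\<bar> \<le> R" by (rule Omega_bounded) blast
  show ?thesis
  proof (rule moll_bound[where N = N and R = R])
    fix C assume C0: "0 \<le> C" and C: "\<And>\<beta> \<gamma> s x z. mi_order \<beta> \<le> N \<Longrightarrow> mi_order \<gamma> \<le> N \<Longrightarrow> 0 < s \<Longrightarrow>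
      (\<And>i. \<bar>x $ i - c $ i\<bar> \<le> R) \<Longrightarrow> \<bar>moll \<beta> \<gamma> s x z\<bar> \<le> C / s ^ (CARD('d) + mi_order \<beta>)"
    show ?thesis
    proof (rule that[of "C + 1"])
      show "0 < C + 1" using C0 by simp
      fix \<beta> \<gamma> :: "nat ^ 'd" and s :: real and x z :: "real ^ 'd"
      assume a: "mi_order \<beta> \<le> N" "mi_order \<gamma> \<le> N" "0 < s" "x \<in> \<Omega>"
      have "\<bar>moll \<beta> \<gamma> s x z\<bar> \<le> C / s ^ (CARD('d) + mi_order \<beta>)" by (rule C[OF a(1-3) R[OF a(4)]])
      also have "\<dots> \<le> (C + 1) / s ^ (CARD('d) + mi_order \<beta>)" using a(3) by (intro divide_right_mono) auto
      finally show "\<bar>moll \<beta> \<gamma> s x z\<bar> \<le> (C + 1) / s ^ (CARD('d) + mi_order \<beta>)" .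
    qed
  qed
qed

definition avg :: "nat ^ 'd \<Rightarrow> nat ^ 'd \<Rightarrow> real \<Rightarrow> real ^ 'd \<Rightarrow> (real ^ 'd \<Rightarrow> real) \<Rightarrow> real" where
  "avg \<beta> \<gamma> s x v = (LINT z|lebesgue_on \<Omega>. moll \<beta> \<gamma> s x z * v z)"

lemma square_integrable_imp_integrable:
  assumes "square_integrable \<Omega> v"
  shows "integrable (lebesgue_on \<Omega>) v"
proof -
  interpret finite_measure "lebesgue_on \<Omega>" by (rule finite_measure_Omega)
  have "integrable (lebesgue_on \<Omega>) (\<lambda>x. 1 * v x)"
    using assms by (intro integral_Cauchy_Schwarz(1)) (auto simp: square_integrable_def)
  then show ?thesis by simp
qed

lemma moll_bounded_ge:
  assumes x: "x \<in> \<Omega>" and s: "0 < s"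
  obtains C where "0 \<le> C" "\<And>q z. s \<le> q \<Longrightarrow> \<bar>moll \<beta> \<gamma> q x z\<bar> \<le> C"
proof -
  obtain C where C: "0 < C" "\<And>\<beta>' \<gamma>' s x z. mi_order \<beta>' \<le> max (mi_order \<beta>) (mi_order \<gamma>) \<Longrightarrow>
      mi_order \<gamma>' \<le> max (mi_order \<beta>) (mi_order \<gamma>) \<Longrightarrow> 0 < s \<Longrightarrow>
      x \<in> \<Omega> \<Longrightarrow> \<bar>moll \<beta>' \<gamma>' s x z\<bar> \<le> C / s ^ (CARD('d) + mi_order \<beta>')"
    by (rule moll_bound_Omega) blast
  show ?thesis
  proof
    show "0 \<le> C / s ^ (CARD('d) + mi_order \<beta>)" using C(1) s by simp
    fix q z assume q: "s \<le> q"
    have "\<bar>moll \<beta> \<gamma> q x z\<bar> \<le> C / q ^ (CARD('d) + mi_order \<beta>)" using q s by (intro C(2) x) auto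
    also have "\<dots> \<le> C / s ^ (CARD('d) + mi_order \<beta>)"
      using q s C(1) by (intro divide_left_mono power_mono mult_pos_pos zero_less_power) auto
    finally show "\<bar>moll \<beta> \<gamma> q x z\<bar> \<le> C / s ^ (CARD('d) + mi_order \<beta>)" .
  qed
qed

lemma moll_times_integrable:
  assumes "x \<in> \<Omega>" "0 < s" "integrable (lebesgue_on \<Omega>) v"
  shows "integrable (lebesgue_on \<Omega>) (\<lambda>z. moll \<beta> \<gamma> s x z * v z)"
proof -
  note [measurable] = borel_measurable_integrable[OF assms(3)]
  obtain C where C: "0 \<le> C" "\<And>q z. s \<le> q \<Longrightarrow> \<bar>moll \<beta> \<gamma> q x z\<bar> \<le> C"
    by (rule moll_bounded_ge[OF assms(1,2)]) blast
  show ?thesis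
  proof (rule Bochner_Integration.integrable_bound)
    show "integrable (lebesgue_on \<Omega>) (\<lambda>z. C * \<bar>v z\<bar>)" using assms(3) by simp
    show "AE z in lebesgue_on \<Omega>. norm (moll \<beta> \<gamma> s x z * v z) \<le> norm (C * \<bar>v z\<bar>)"
      using C(2)[OF order_refl] C(1) by (intro AE_I2) (simp add: abs_mult mult_right_mono)
  qed measurable
qed

lemma avg_deriv_scale:
  assumes x: "x \<in> \<Omega>" and v: "integrable (lebesgue_on \<Omega>) v" and s: "0 < s"
  shows "((\<lambda>s. avg \<beta> \<gamma> s x v) has_real_derivative
     (\<Sum>i\<in>UNIV. avg (\<beta> + unit_mi i) (\<gamma> + unit_mi i) s x v)) (at s)"
proof -
  have "\<exists>C. 0 \<le> C \<and> (\<forall>q z. s / 2 \<le> q \<longrightarrow> \<bar>moll (\<beta> + unit_mi i) (\<gamma> + unit_mi i) q x z\<bar> \<le> C)" for i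
    by (rule moll_bounded_ge[OF x, of "s / 2" "\<beta> + unit_mi i" "\<gamma> + unit_mi i"]) (use s in auto)
  then obtain C where C: "\<And>i. 0 \<le> C i"
    "\<And>i q z. s / 2 \<le> q \<Longrightarrow> \<bar>moll (\<beta> + unit_mi i) (\<gamma> + unit_mi i) q x z\<bar> \<le> C i" by metis
  have "((\<lambda>q. LINT z|lebesgue_on \<Omega>. moll \<beta> \<gamma> q x z * v z) has_derivative
     (\<lambda>h. LINT z|lebesgue_on \<Omega>. ((\<Sum>i\<in>UNIV. moll (\<beta> + unit_mi i) (\<gamma> + unit_mi i) s x z) * h) * v z)) (at s within {s/2<..})"
  proof (rule has_derivative_weighted_integral[where C = "\<Sum>i\<in>UNIV. C i"
        and k' = "\<lambda>q z h. (\<Sum>i\<in>UNIV. moll (\<beta> + unit_mi i) (\<gamma> + unit_mi i) q x z) * h"])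
    show "((\<lambda>q. moll \<beta> \<gamma> q x z) has_derivative (*) (\<Sum>i\<in>UNIV. moll (\<beta> + unit_mi i) (\<gamma> + unit_mi i) q x z)) (at q within {s / 2<..})"
      if "q \<in> {s / 2<..}" for q z
      using moll_deriv_scale[of q \<beta> \<gamma> x z] that s
      by (auto simp: has_field_derivative_def intro: has_derivative_at_withinI)
    show "\<bar>(\<Sum>i\<in>UNIV. moll (\<beta> + unit_mi i) (\<gamma> + unit_mi i) q x z) * h\<bar> \<le> (\<Sum>i\<in>UNIV. C i) * norm h"
      if "q \<in> {s / 2<..}" for q z h
      unfolding abs_mult real_norm_def using that
      by (intro mult_right_mono order_trans[OF sum_abs] sum_mono C(2)) auto
    show "integrable (lebesgue_on \<Omega>) (\<lambda>z. moll \<beta> \<gamma> q x z * v z)" if "q \<in> {s / 2<..}" for q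
      using that s by (intro moll_times_integrable x v) auto
  qed (use s v C(1) in \<open>auto intro: sum_nonneg\<close>)
  moreover have "(LINT z|lebesgue_on \<Omega>. ((\<Sum>i\<in>UNIV. moll (\<beta> + unit_mi i) (\<gamma> + unit_mi i) s x z) * h) * v z) =
     (\<Sum>i\<in>UNIV. avg (\<beta> + unit_mi i) (\<gamma> + unit_mi i) s x v) * h" for h
  proof -
    have "(LINT z|lebesgue_on \<Omega>. ((\<Sum>i\<in>UNIV. moll (\<beta> + unit_mi i) (\<gamma> + unit_mi i) s x z) * h) * v z) =
      (LINT z|lebesgue_on \<Omega>. h * (\<Sum>i\<in>UNIV. moll (\<beta> + unit_mi i) (\<gamma> + unit_mi i) s x z * v z))"
      by (intro Bochner_Integration.integral_cong) (auto simp: sum_distrib_right sum_distrib_left mult_ac)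
    also have "\<dots> = h * (\<Sum>i\<in>UNIV. avg (\<beta> + unit_mi i) (\<gamma> + unit_mi i) s x v)"
      unfolding avg_def by (simp add: Bochner_Integration.integral_sum moll_times_integrable x s v)
    finally show ?thesis by (simp add: mult.commute)
  qed
  ultimately have "((\<lambda>q. avg \<beta> \<gamma> q x v) has_derivative (*) (\<Sum>i\<in>UNIV. avg (\<beta> + unit_mi i) (\<gamma> + unit_mi i) s x v)) (at s within {s/2<..})"
    by (simp add: avg_def[abs_def])
  moreover have "at s within {s/2<..} = at s" using s by (intro at_within_open) auto
  ultimately show ?thesis unfolding has_field_derivative_def by simp
qed

lemma avg_deriv_base:
  assumes x: "x \<in> \<Omega>" and v: "integrable (lebesgue_on \<Omega>) v" and s: "0 < s" "s \<le> 1"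
  shows "((\<lambda>x. avg \<beta> 0 s x v) has_derivative
     (\<lambda>w. \<Sum>i\<in>UNIV. w $ i * ((1 - s) * avg (\<beta> + unit_mi i) 0 s x v))) (at x within \<Omega>)"
proof -
  obtain C where C: "0 < C" "\<And>\<beta>' \<gamma>' s x z. mi_order \<beta>' \<le> mi_order \<beta> + 1 \<Longrightarrow>
      mi_order \<gamma>' \<le> mi_order \<beta> + 1 \<Longrightarrow> 0 < s \<Longrightarrow>
      x \<in> \<Omega> \<Longrightarrow> \<bar>moll \<beta>' \<gamma>' s x z\<bar> \<le> C / s ^ (CARD('d) + mi_order \<beta>')"
    by (rule moll_bound_Omega) blast
  define T where "T = C / s ^ (CARD('d) + mi_order \<beta> + 1)"
  have T: "0 \<le> T" "\<And>i x z. x \<in> \<Omega> \<Longrightarrow> \<bar>moll (\<beta> + unit_mi i) 0 s x z\<bar> \<le> T"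
    using C(1) s C(2)[of "\<beta> + unit_mi _" 0 s] by (auto simp: T_def mi_order_add)
  have "((\<lambda>x. LINT z|lebesgue_on \<Omega>. moll \<beta> 0 s x z * v z) has_derivative
     (\<lambda>w. LINT z|lebesgue_on \<Omega>. (\<Sum>i\<in>UNIV. w $ i * ((1 - s) * moll (\<beta> + unit_mi i) 0 s x z)) * v z)) (at x within \<Omega>)"
  proof (rule has_derivative_weighted_integral[where C = "real CARD('d) * T"
        and k' = "\<lambda>x z w. \<Sum>i\<in>UNIV. w $ i * ((1 - s) * moll (\<beta> + unit_mi i) 0 s x z)"])
    show "((\<lambda>x. moll \<beta> 0 s x z) has_derivative
       (\<lambda>w. \<Sum>i\<in>UNIV. w $ i * ((1 - s) * moll (\<beta> + unit_mi i) 0 s q z))) (at q within \<Omega>)" for q z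
      by (rule has_derivative_at_withinI[OF moll_deriv_base[OF s(1)]])
    show "\<bar>\<Sum>i\<in>UNIV. w $ i * ((1 - s) * moll (\<beta> + unit_mi i) 0 s q z)\<bar> \<le> real CARD('d) * T * norm w"
      if "q \<in> \<Omega>" for q z w
    proof -
      have "\<bar>w $ i * ((1 - s) * moll (\<beta> + unit_mi i) 0 s q z)\<bar> \<le> norm w * (1 * T)" for i
        unfolding abs_mult using s T that component_le_norm_cart[of w i]
        by (intro mult_mono) auto
      then have "(\<Sum>i\<in>UNIV. \<bar>w $ i * ((1 - s) * moll (\<beta> + unit_mi i) 0 s q z)\<bar>) \<le> (\<Sum>i\<in>(UNIV::'d set). norm w * (1 * T))"
        by (intro sum_mono)
      then show ?thesis by (intro order_trans[OF sum_abs]) (simp add: mult_ac)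
    qed
    show "integrable (lebesgue_on \<Omega>) (\<lambda>z. moll \<beta> 0 s q z * v z)" if "q \<in> \<Omega>" for q
      using that s by (intro moll_times_integrable v)
  qed (use convex x v T(1) in auto)
  moreover have "(LINT z|lebesgue_on \<Omega>. (\<Sum>i\<in>UNIV. w $ i * ((1 - s) * moll (\<beta> + unit_mi i) 0 s x z)) * v z) =
     (\<Sum>i\<in>UNIV. w $ i * ((1 - s) * avg (\<beta> + unit_mi i) 0 s x v))" for w
  proof -
    have "(LINT z|lebesgue_on \<Omega>. (\<Sum>i\<in>UNIV. w $ i * ((1 - s) * moll (\<beta> + unit_mi i) 0 s x z)) * v z) =
      (LINT z|lebesgue_on \<Omega>. (\<Sum>i\<in>UNIV. (w $ i * (1 - s)) * (moll (\<beta> + unit_mi i) 0 s x z * v z)))"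
      by (intro Bochner_Integration.integral_cong refl) (simp only: sum_distrib_right mult.assoc)
    also have "\<dots> = (\<Sum>i\<in>UNIV. (w $ i * (1 - s)) * avg (\<beta> + unit_mi i) 0 s x v)"
      unfolding avg_def by (simp add: Bochner_Integration.integral_sum moll_times_integrable x s v)
    finally show ?thesis by (simp only: mult.assoc)
  qed
  ultimately show ?thesis by (simp add: avg_def[abs_def])
qed

text \<open>
  The kernel is a test function, and its derivatives are the kernels with larger \<open>\<beta>\<close>; the two
  signs cancel.
\<close>

lemma avg_weak:
  assumes "is_weak_deriv \<Omega> \<beta> v g" "x \<in> \<Omega>" "0 < s" "s \<le> 1"
  shows "avg (\<beta>' + \<beta>) \<gamma> s x v = avg \<beta>' \<gamma> s x g"
proof -
  have "test_function (interior \<Omega>) (moll \<beta>' \<gamma> s x)"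
    using assms by (intro test_function_moll supp_box_subset)
  with assms(1) have "(LINT z|lebesgue_on \<Omega>. v z * multi_deriv UNIV \<beta> (moll \<beta>' \<gamma> s x) z) =
      (- 1) ^ mi_order \<beta> * (LINT z|lebesgue_on \<Omega>. g z * moll \<beta>' \<gamma> s x z)"
    unfolding is_weak_deriv_def by blast
  then have "(LINT z|lebesgue_on \<Omega>. (- 1) ^ mi_order \<beta> * (moll (\<beta>' + \<beta>) \<gamma> s x z * v z)) =
      (- 1) ^ mi_order \<beta> * avg \<beta>' \<gamma> s x g"
    unfolding multi_deriv_UNIV_moll avg_def by (simp add: mult_ac)
  then show ?thesis by (simp add: avg_def)
qed

text \<open>
  The kernel has size \<open>s powr (- d - \<bar>\<beta>\<bar>)\<close> and lives on a set of measure of order \<open>s powr d\<close>.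
\<close>

lemma avg_bound:
  obtains C where "0 \<le> C" and "\<And>\<beta> \<gamma> s x v. mi_order \<beta> \<le> N \<Longrightarrow> mi_order \<gamma> \<le> N \<Longrightarrow> 0 < s \<Longrightarrow> s \<le> 1 \<Longrightarrow>
      x \<in> \<Omega> \<Longrightarrow> square_integrable \<Omega> v \<Longrightarrow>
      \<bar>avg \<beta> \<gamma> s x v\<bar> \<le> C * s powr (- (real CARD('d) / 2) - real (mi_order \<beta>)) * norm_L2 \<Omega> v"
proof -
  obtain C where C: "0 < C" "\<And>\<beta> \<gamma> s x z. mi_order \<beta> \<le> N \<Longrightarrow> mi_order \<gamma> \<le> N \<Longrightarrow> 0 < s \<Longrightarrow>
      x \<in> \<Omega> \<Longrightarrow> \<bar>moll \<beta> \<gamma> s x z\<bar> \<le> C / s ^ (CARD('d) + mi_order \<beta>)"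
    by (rule moll_bound_Omega) blast
  show ?thesis
  proof
    show "0 \<le> C * (2 * \<rho>) powr (real CARD('d) / 2)" using C(1) by simp
    fix \<beta> \<gamma> :: "nat ^ 'd" and s :: real and x :: "real ^ 'd" and v assume o: "mi_order \<beta> \<le> N" "mi_order \<gamma> \<le> N" and s: "0 < (s::real)" "s \<le> 1"
      and x: "x \<in> \<Omega>" and v: "square_integrable \<Omega> v"
    have "\<bar>avg \<beta> \<gamma> s x v\<bar> \<le> C / s ^ (CARD('d) + mi_order \<beta>) * sqrt (measure lebesgue (supp_box s x)) * norm_L2 \<Omega> v"
      unfolding avg_def
      by (rule integral_against_bounded_support(2)[OF v])
         (use s x C(1) o supp_box_subset'[OF x s] in \<open>auto intro!: C(2) moll_support\<close>)
    also have "C / s ^ (CARD('d) + mi_order \<beta>) * sqrt (measure lebesgue (supp_box s x)) =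
        C * (2 * \<rho>) powr (real CARD('d) / 2) * s powr (- (real CARD('d) / 2) - real (mi_order \<beta>))"
    proof -
      have e1: "sqrt (measure lebesgue (supp_box s x)) = (2 * \<rho>) powr (real CARD('d) / 2) * s powr (real CARD('d) / 2)"
        using s rho_pos
        by (simp add: measure_supp_box powr_half_sqrt[symmetric] powr_realpow[symmetric] powr_powr powr_mult)
      have e2: "C / s ^ (CARD('d) + mi_order \<beta>) = C * s powr (- (real CARD('d) + real (mi_order \<beta>)))"
        unfolding powr_minus using s by (simp add: powr_realpow[symmetric] divide_inverse)
      have e3: "s powr (- (real CARD('d) + real (mi_order \<beta>))) * s powr (real CARD('d) / 2) =
        s powr (- (real CARD('d) / 2) - real (mi_order \<beta>))"
        unfolding powr_add[symmetric] by (simp add: field_simps)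
      show ?thesis unfolding e1 e2 e3[symmetric] by (simp only: mult_ac)
    qed
    finally show "\<bar>avg \<beta> \<gamma> s x v\<bar> \<le> C * (2 * \<rho>) powr (real CARD('d) / 2) *
        s powr (- (real CARD('d) / 2) - real (mi_order \<beta>)) * norm_L2 \<Omega> v" .
  qed
qed

lemma moll_borel [measurable]: "moll \<beta> \<gamma> s x \<in> borel_measurable borel"
  by (rule borel_measurable_continuous_onI[OF continuous_on_moll])

lemma integral_moll_lborel:
  assumes "x \<in> \<Omega>" "0 < s" "s \<le> 1"
  shows "(LINT z|lebesgue_on \<Omega>. moll \<beta> \<gamma> s x z) = (LINT z|lborel. moll \<beta> \<gamma> s x z)"
proof -
  have "(LINT z|lebesgue_on \<Omega>. moll \<beta> \<gamma> s x z) = (LINT z|lebesgue. indicator \<Omega> z *\<^sub>R moll \<beta> \<gamma> s x z)"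
    by (rule integral_restrict_space) simp
  also have "(\<lambda>z. indicator \<Omega> z *\<^sub>R moll \<beta> \<gamma> s x z) = moll \<beta> \<gamma> s x"
  proof
    fix z
    show "indicator \<Omega> z *\<^sub>R moll \<beta> \<gamma> s x z = moll \<beta> \<gamma> s x z"
      using moll_support[OF assms(2), of z x] supp_box_subset'[OF assms] by (cases "z \<in> \<Omega>") auto
  qed
  also have "(LINT z|lebesgue. moll \<beta> \<gamma> s x z) = (LINT z|lborel. moll \<beta> \<gamma> s x z)"
    by (rule integral_completion) simp
  finally show ?thesis .
qed

text \<open>
  The integral over the whole space of a translated kernel does not depend on the translation;
  its derivative with respect to a shift in direction \<open>i\<close> is, up to sign, the integral in question.
\<close>

lemma avg_mean_zero:
  assumes x: "x \<in> \<Omega>" and s: "0 < s" "s \<le> 1"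
  shows "avg (\<beta> + unit_mi i) \<gamma> s x (\<lambda>_. 1) = 0"
proof -
  define a :: "real ^ 'd" where "a = axis i 1"
  have na: "norm a = 1" by (simp add: a_def)
  have "bounded (supp_box s x)" by (simp add: supp_box_def)
  then obtain R where R: "\<And>z. z \<in> supp_box s x \<Longrightarrow> norm z \<le> R" unfolding bounded_iff by blast
  \<comment> \<open>An integrable weight that equals 1 on all shifts of the support by at most 1.\<close>
  define v where "v = (indicator (cball 0 (R + 1)) :: real ^ 'd \<Rightarrow> real)"
  have v: "integrable lborel v"
    unfolding v_def using emeasure_bounded_finite[OF bounded_cball, of 0 "R + 1"]
    by (intro integrable_real_indicator) auto
  obtain C where C: "0 \<le> C" "\<And>q z. s \<le> q \<Longrightarrow> \<bar>moll (\<beta> + unit_mi i) \<gamma> q x z\<bar> \<le> C"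
    by (rule moll_bounded_ge[OF x s(1)]) blast
  obtain C' where C': "0 \<le> C'" "\<And>q z. s \<le> q \<Longrightarrow> \<bar>moll \<beta> \<gamma> q x z\<bar> \<le> C'"
    by (rule moll_bounded_ge[OF x s(1)]) blast
  have der: "((\<lambda>t. LINT z|lborel. moll \<beta> \<gamma> s x (z + t *\<^sub>R a) * v z) has_derivative
      (\<lambda>h. LINT z|lborel. (- moll (\<beta> + unit_mi i) \<gamma> s x (z + 0 *\<^sub>R a) * h) * v z)) (at 0 within {-1<..<1})"
  proof (rule has_derivative_weighted_integral[where C = C
        and k' = "\<lambda>t z h. - moll (\<beta> + unit_mi i) \<gamma> s x (z + t *\<^sub>R a) * h"])
    show "((\<lambda>t. moll \<beta> \<gamma> s x (z + t *\<^sub>R a)) has_derivative (*) (- moll (\<beta> + unit_mi i) \<gamma> s x (z + t *\<^sub>R a)))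
        (at t within {-1<..<1})" for t z
    proof -
      have "((\<lambda>t. z + t *\<^sub>R a) has_derivative (\<lambda>h. h *\<^sub>R a)) (at t within {-1<..<1})"
        by (rule derivative_eq_intros refl)+ simp
      from has_derivative_compose[OF this moll_deriv_arg]
      have "((\<lambda>t. moll \<beta> \<gamma> s x (z + t *\<^sub>R a)) has_derivative
        (\<lambda>h. \<Sum>j\<in>UNIV. (h *\<^sub>R a) $ j * - moll (\<beta> + unit_mi j) \<gamma> s x (z + t *\<^sub>R a))) (at t within {-1<..<1})" .
      moreover have "(\<Sum>j\<in>UNIV. (h *\<^sub>R a) $ j * - moll (\<beta> + unit_mi j) \<gamma> s x (z + t *\<^sub>R a)) =
          - moll (\<beta> + unit_mi i) \<gamma> s x (z + t *\<^sub>R a) * h" for h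
      proof -
        have "(\<Sum>j\<in>UNIV. (h *\<^sub>R a) $ j * - moll (\<beta> + unit_mi j) \<gamma> s x (z + t *\<^sub>R a)) =
          (\<Sum>j\<in>UNIV. if j = i then - (h * moll (\<beta> + unit_mi j) \<gamma> s x (z + t *\<^sub>R a)) else 0)"
          by (rule sum.cong) (auto simp: a_def axis_def)
        then show ?thesis by (simp add: mult.commute)
      qed
      ultimately show ?thesis by (simp only:)
    qed
    show "\<bar>- moll (\<beta> + unit_mi i) \<gamma> s x (z + t *\<^sub>R a) * h\<bar> \<le> C * norm h" for t z h
      unfolding abs_mult real_norm_def abs_minus by (intro mult_right_mono C(2)) auto
    show "integrable lborel (\<lambda>z. moll \<beta> \<gamma> s x (z + t *\<^sub>R a) * v z)" for t
    proof (rule Bochner_Integration.integrable_bound)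
      show "integrable lborel (\<lambda>z. C' * v z)" using v by simp
      show "AE z in lborel. norm (moll \<beta> \<gamma> s x (z + t *\<^sub>R a) * v z) \<le> norm (C' * v z)"
        using C'(2)[OF order_refl] C'(1) by (intro AE_I2) (simp add: abs_mult mult_right_mono)
      have "(\<lambda>z. moll \<beta> \<gamma> s x (z + t *\<^sub>R a)) \<in> borel_measurable borel"
        by (rule measurable_compose[OF _ moll_borel]) simp
      then show "(\<lambda>z. moll \<beta> \<gamma> s x (z + t *\<^sub>R a) * v z) \<in> borel_measurable lborel"
        unfolding v_def by (simp add: borel_measurable_times borel_measurable_indicator)
    qed
  qed (use v C in auto)
  have eq: "moll \<beta>' \<gamma> s x (z + t *\<^sub>R a) * v z = moll \<beta>' \<gamma> s x (z + t *\<^sub>R a)" if "t \<in> {-1<..<1}" for t z \<beta>'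
  proof (cases "z + t *\<^sub>R a \<in> supp_box s x")
    case True
    have "norm z \<le> norm (z + t *\<^sub>R a) + norm (t *\<^sub>R a)"
      using norm_triangle_ineq4[of "z + t *\<^sub>R a" "t *\<^sub>R a"] by simp
    also have "norm (t *\<^sub>R a) \<le> 1" using that na by auto
    also have "norm (z + t *\<^sub>R a) + 1 \<le> R + 1" using R[OF True] by simp
    finally show ?thesis by (simp add: v_def)
  next
    case False
    then show ?thesis using moll_support[OF s(1)] by simp
  qed
  have "((\<lambda>t::real. LINT z|lborel. moll \<beta> \<gamma> s x z) has_derivative
      (\<lambda>h. LINT z|lborel. (- moll (\<beta> + unit_mi i) \<gamma> s x (z + 0 *\<^sub>R a) * h) * v z)) (at 0 within {-1<..<1})"
    by (rule has_derivative_transform[OF _ _ der]) (simp_all add: eq lborel_integral_translate)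
  then have "((\<lambda>t::real. LINT z|lborel. moll \<beta> \<gamma> s x z) has_derivative
      (\<lambda>h. LINT z|lborel. (- moll (\<beta> + unit_mi i) \<gamma> s x (z + 0 *\<^sub>R a) * h) * v z)) (at 0)"
    by (subst (asm) at_within_open) auto
  moreover have "((\<lambda>t::real. LINT z|lborel. moll \<beta> \<gamma> s x z) has_derivative (\<lambda>h. 0)) (at 0)"
    by (rule has_derivative_const)
  ultimately have "(\<lambda>h::real. LINT z|lborel. (- moll (\<beta> + unit_mi i) \<gamma> s x (z + 0 *\<^sub>R a) * h) * v z) = (\<lambda>h. 0)"
    by (rule has_derivative_unique)
  from fun_cong[OF this, of "- 1"]
  have "(LINT z|lborel. moll (\<beta> + unit_mi i) \<gamma> s x z) = 0"
  proof -
    have e0: "moll (\<beta> + unit_mi i) \<gamma> s x z * v z = moll (\<beta> + unit_mi i) \<gamma> s x z" for z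
      using eq[of 0 "\<beta> + unit_mi i" z] by simp
    show ?thesis using \<open>_ = 0\<close> by (simp add: e0)
  qed
  then show ?thesis using integral_moll_lborel[OF x s] by (simp add: avg_def)
qed

lemma square_integrable_const: "square_integrable \<Omega> (\<lambda>_. r)"
proof -
  interpret finite_measure "lebesgue_on \<Omega>" by (rule finite_measure_Omega)
  show ?thesis by (simp add: square_integrable_def)
qed

lemma supp_box_diam:
  assumes "z \<in> supp_box s x" "z' \<in> supp_box s x" "0 < s"
  shows "norm (z - z') \<le> real CARD('d) * (2 * \<rho>) * s"
proof -
  have "\<bar>(z - z') $ i\<bar> \<le> 2 * \<rho> * s" for i
  proof -
    have "(1 - s) * x $ i + s * (c $ i - \<rho>) \<le> z $ i" "z $ i \<le> (1 - s) * x $ i + s * (c $ i + \<rho>)"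
      "(1 - s) * x $ i + s * (c $ i - \<rho>) \<le> z' $ i" "z' $ i \<le> (1 - s) * x $ i + s * (c $ i + \<rho>)"
      using assms by (auto simp: supp_box_def mem_box_cart)
    then show ?thesis by (simp add: algebra_simps abs_le_iff)
  qed
  then have "(\<Sum>i\<in>UNIV. \<bar>(z - z') $ i\<bar>) \<le> (\<Sum>i\<in>(UNIV::'d set). 2 * \<rho> * s)"
    by (intro sum_mono)
  then show ?thesis using norm_le_l1_cart[of "z - z'"] by simp
qed

text \<open>
  Since the kernel has mean zero, any constant may be subtracted from \<open>g\<close>. Subtract \<open>g z'\<close> for
  a point \<open>z'\<close> of the small box, apply Cauchy-Schwarz in \<open>z\<close>, and average over \<open>z'\<close>: the result is the double
  integral of \<open>(g z' - g z)\<^sup>2\<close> over the box, where the distances are at most the diameter.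
\<close>

lemma avg_oscillation:
  assumes x: "x \<in> \<Omega>" and s: "0 < s" "s \<le> 1" and g: "square_integrable \<Omega> g"
    and T: "0 < T" "\<And>z. \<bar>moll (unit_mi i) \<gamma> s x z\<bar> \<le> T" and \<sigma>: "0 < \<sigma>"
    and fin: "slobodeckij_energy \<Omega> \<sigma> g < \<infinity>"
  shows "(avg (unit_mi i) \<gamma> s x g)\<^sup>2 \<le>
    T\<^sup>2 * (real CARD('d) * (2 * \<rho>) * s) powr (real CARD('d) + 2 * \<sigma>) * enn2real (slobodeckij_energy \<Omega> \<sigma> g)"
proof -
  define B where "B = supp_box s x"
  define V where "V = measure lebesgue B"
  define p where "p = real CARD('d) + 2 * \<sigma>"
  define D where "D = real CARD('d) * (2 * \<rho>) * s"
  define Dp where "Dp = D powr p"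
  define j where "j = avg (unit_mi i) \<gamma> s x g"
  have V: "0 < V" unfolding V_def B_def using s rho_pos by (simp add: measure_supp_box)
  have D: "0 < D" unfolding D_def using s rho_pos by simp
  have Dp: "0 < Dp" unfolding Dp_def using D by simp
  have p: "0 < p" using \<sigma> by (simp add: p_def)
  have gm [measurable]: "g \<in> borel_measurable (lebesgue_on \<Omega>)"
    and g2: "integrable (lebesgue_on \<Omega>) (\<lambda>z. (g z)\<^sup>2)"
    using g by (auto simp: square_integrable_def)
  have B: "B \<in> lmeasurable" "B \<subseteq> \<Omega>" unfolding B_def using supp_box_subset'[OF x s] by auto
  have Bs [measurable]: "B \<in> sets (lebesgue_on \<Omega>)"
    using B by (auto simp: sets_restrict_space_iff fmeasurable_def)
  have g1: "integrable (lebesgue_on \<Omega>) g" by (rule square_integrable_imp_integrable[OF g])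
  have main: "ennreal (j\<^sup>2 / (T\<^sup>2 * V * Dp)) \<le>
      (\<integral>\<^sup>+ z. ennreal ((g z' - g z)\<^sup>2 / norm (z' - z) powr p) \<partial>lebesgue_on \<Omega>)" if z': "z' \<in> B" for z'
  proof -
    define v where "v z = indicator B z * (g z - g z')" for z
    have vm [measurable]: "v \<in> borel_measurable (lebesgue_on \<Omega>)" unfolding v_def by measurable
    have v2: "integrable (lebesgue_on \<Omega>) (\<lambda>z. (v z)\<^sup>2)"
    proof (rule Bochner_Integration.integrable_bound)
      show "integrable (lebesgue_on \<Omega>) (\<lambda>z. 2 * (g z)\<^sup>2 + 2 * (g z')\<^sup>2)"
        using g2 square_integrable_const[of "g z'"]
        by (intro Bochner_Integration.integrable_add integrable_mult_right) (auto simp: square_integrable_def)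
      show "AE z in lebesgue_on \<Omega>. norm ((v z)\<^sup>2) \<le> norm (2 * (g z)\<^sup>2 + 2 * (g z')\<^sup>2)"
      proof (rule AE_I2)
        fix z
        have "(g z - g z')\<^sup>2 \<le> 2 * (g z)\<^sup>2 + 2 * (g z')\<^sup>2"
          using zero_le_power2[of "g z + g z'"] by (simp add: power2_eq_square algebra_simps)
        then show "norm ((v z)\<^sup>2) \<le> norm (2 * (g z)\<^sup>2 + 2 * (g z')\<^sup>2)"
          by (simp add: v_def indicator_def)
      qed
    qed measurable
    have sq: "square_integrable \<Omega> v" using v2 by (simp add: square_integrable_def)
    have "j = (LINT z|lebesgue_on \<Omega>. moll (unit_mi i) \<gamma> s x z * g z) - g z' * avg (0 + unit_mi i) \<gamma> s x (\<lambda>_. 1)"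
      unfolding avg_mean_zero[OF x s] by (simp add: j_def avg_def)
    also have "\<dots> = (LINT z|lebesgue_on \<Omega>. moll (unit_mi i) \<gamma> s x z * g z - g z' * (moll (unit_mi i) \<gamma> s x z * 1))"
      unfolding avg_def add_0
      using moll_times_integrable[OF x s(1) g1]
        moll_times_integrable[OF x s(1) square_integrable_imp_integrable[OF square_integrable_const[of 1]]]
      by (subst Bochner_Integration.integral_diff) auto
    also have "\<dots> = (LINT z|lebesgue_on \<Omega>. moll (unit_mi i) \<gamma> s x z * v z)"
      using moll_support[OF s(1), of _ x]
      by (intro Bochner_Integration.integral_cong refl) (auto simp: v_def B_def indicator_def algebra_simps)
    finally have "\<bar>j\<bar> \<le> T * sqrt V * norm_L2 \<Omega> v"
      unfolding V_def
      using integral_against_bounded_support(2)[OF sq Omega_sets moll_measurable less_imp_le[OF T(1)] T(2) B]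
        moll_support[OF s(1), of _ x] by (simp add: B_def)
    then have "\<bar>j\<bar>\<^sup>2 \<le> (T * sqrt V * norm_L2 \<Omega> v)\<^sup>2" by (rule power_mono) simp
    also have "\<dots> = T\<^sup>2 * V * (LINT z|lebesgue_on \<Omega>. (v z)\<^sup>2)"
      using V by (simp add: power_mult_distrib norm_L2_def)
    finally have "j\<^sup>2 / (T\<^sup>2 * V * Dp) \<le> (LINT z|lebesgue_on \<Omega>. (v z)\<^sup>2 / Dp)"
      using V T(1) Dp by (simp add: field_simps)
    then have "ennreal (j\<^sup>2 / (T\<^sup>2 * V * Dp)) \<le> ennreal (LINT z|lebesgue_on \<Omega>. (v z)\<^sup>2 / Dp)"
      by (rule ennreal_leI)
    also have "\<dots> = (\<integral>\<^sup>+ z. ennreal ((v z)\<^sup>2 / Dp) \<partial>lebesgue_on \<Omega>)"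
      using v2 Dp by (intro nn_integral_eq_integral[symmetric]) auto
    also have "\<dots> \<le> (\<integral>\<^sup>+ z. ennreal ((g z' - g z)\<^sup>2 / norm (z' - z) powr p) \<partial>lebesgue_on \<Omega>)"
    proof (intro nn_integral_mono ennreal_leI)
      fix z
      show "(v z)\<^sup>2 / Dp \<le> (g z' - g z)\<^sup>2 / norm (z' - z) powr p"
      proof (cases "z \<in> B \<and> z \<noteq> z'")
        case True
        then have "norm (z' - z) powr p \<le> Dp"
          unfolding Dp_def D_def using p supp_box_diam[of z' s x z] z' s
          by (intro powr_mono2) (auto simp: B_def)
        moreover have "z' - z \<noteq> 0" using True by auto
        then have "0 < norm (z' - z) powr p" by simp
        ultimately have "(g z' - g z)\<^sup>2 / Dp \<le> (g z' - g z)\<^sup>2 / norm (z' - z) powr p"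
          using Dp by (intro divide_left_mono) auto
        then show ?thesis using True by (simp add: v_def power2_commute)
      next
        case False
        then have "v z = 0" by (auto simp: v_def)
        then show ?thesis by simp
      qed
    qed
    finally show ?thesis .
  qed
  \<comment> \<open>Constants stay on the left: the inner integral need not be measurable in \<open>z'\<close> for monotonicity.\<close>
  have "ennreal (j\<^sup>2 / (T\<^sup>2 * V * Dp) * V) = ennreal (j\<^sup>2 / (T\<^sup>2 * V * Dp)) * emeasure (lebesgue_on \<Omega>) B"
  proof -
    have "emeasure (lebesgue_on \<Omega>) B = emeasure lebesgue B"
      using B by (intro emeasure_restrict_space) auto
    also have "\<dots> = ennreal V" unfolding V_def using B(1) by (simp add: emeasure_eq_measure2)
    finally have e: "emeasure (lebesgue_on \<Omega>) B = ennreal V" .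
    show ?thesis unfolding e by (rule ennreal_mult) (use V T Dp in auto)
  qed
  also have "\<dots> = (\<integral>\<^sup>+ z'. ennreal (j\<^sup>2 / (T\<^sup>2 * V * Dp)) * indicator B z' \<partial>lebesgue_on \<Omega>)"
    by (rule nn_integral_cmult_indicator[symmetric]) simp
  also have "\<dots> \<le> slobodeckij_energy \<Omega> \<sigma> g"
    unfolding slobodeckij_energy_def p_def[symmetric]
  proof (rule nn_integral_mono)
    fix z'
    show "ennreal (j\<^sup>2 / (T\<^sup>2 * V * Dp)) * indicator B z' \<le>
        (\<integral>\<^sup>+ z. ennreal ((g z' - g z)\<^sup>2 / norm (z' - z) powr p) \<partial>lebesgue_on \<Omega>)"
      using main[of z'] by (cases "z' \<in> B") auto
  qed
  finally have "ennreal (j\<^sup>2 / (T\<^sup>2 * V * Dp) * V) \<le> slobodeckij_energy \<Omega> \<sigma> g" .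
  then have "j\<^sup>2 / (T\<^sup>2 * V * Dp) * V \<le> enn2real (slobodeckij_energy \<Omega> \<sigma> g)"
    using fin V T Dp by (metis enn2real_mono enn2real_ennreal infinity_ennreal_def zero_le_power2 divide_nonneg_pos mult_nonneg_nonneg less_imp_le mult_pos_pos zero_less_power)
  then have "j\<^sup>2 \<le> T\<^sup>2 * Dp * enn2real (slobodeckij_energy \<Omega> \<sigma> g)"
    using V T(1) Dp by (simp add: field_simps)
  then show ?thesis by (simp add: j_def Dp_def D_def p_def)
qed

lemma avg_fractional_bound:
  assumes \<sigma>: "0 < \<sigma>"
  obtains C where "0 \<le> C" and "\<And>\<gamma> i s x g. mi_order \<gamma> \<le> N \<Longrightarrow> 0 < s \<Longrightarrow> s \<le> 1 \<Longrightarrow>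
      x \<in> \<Omega> \<Longrightarrow> square_integrable \<Omega> g \<Longrightarrow> slobodeckij_energy \<Omega> \<sigma> g < \<infinity> \<Longrightarrow>
      \<bar>avg (unit_mi i) \<gamma> s x g\<bar> \<le> C * s powr (\<sigma> - 1 - real CARD('d) / 2) *
        sqrt (enn2real (slobodeckij_energy \<Omega> \<sigma> g))"
proof -
  obtain C where C: "0 < C" "\<And>\<beta> \<gamma> s x z. mi_order \<beta> \<le> Suc N \<Longrightarrow> mi_order \<gamma> \<le> Suc N \<Longrightarrow> 0 < s \<Longrightarrow>
      x \<in> \<Omega> \<Longrightarrow> \<bar>moll \<beta> \<gamma> s x z\<bar> \<le> C / s ^ (CARD('d) + mi_order \<beta>)"
    by (rule moll_bound_Omega) blast
  define p where "p = real CARD('d) / 2 + \<sigma>"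
  show ?thesis
  proof (rule that[of "C * (real CARD('d) * (2 * \<rho>)) powr p"])
    show "0 \<le> C * (real CARD('d) * (2 * \<rho>)) powr p" using C(1) by simp
    fix \<gamma> :: "nat ^ 'd" and i s x g
    assume a: "mi_order \<gamma> \<le> N" and s: "0 < (s::real)" "s \<le> 1" and x: "x \<in> \<Omega>"
      and g: "square_integrable \<Omega> g" "slobodeckij_energy \<Omega> \<sigma> g < \<infinity>"
    define e where "e = enn2real (slobodeckij_energy \<Omega> \<sigma> g)"
    define T where "T = C / s ^ (CARD('d) + 1)"
    have T: "0 < T" unfolding T_def using C(1) s by simp
    have "\<bar>moll (unit_mi i) \<gamma> s x z\<bar> \<le> T" for z
      using C(2)[of "unit_mi i" \<gamma> s x z] a s x by (simp add: T_def)
    from avg_oscillation[OF x s g(1) T this \<sigma> g(2)]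
    have "(avg (unit_mi i) \<gamma> s x g)\<^sup>2 \<le> T\<^sup>2 * (real CARD('d) * (2 * \<rho>) * s) powr (real CARD('d) + 2 * \<sigma>) * e"
      by (simp only: e_def)
    also have "(real CARD('d) * (2 * \<rho>) * s) powr (real CARD('d) + 2 * \<sigma>) =
        ((real CARD('d) * (2 * \<rho>) * s) powr p)\<^sup>2"
      unfolding power2_eq_square powr_add[symmetric] by (simp add: p_def)
    also have "T\<^sup>2 * ((real CARD('d) * (2 * \<rho>) * s) powr p)\<^sup>2 * e =
        (T * (real CARD('d) * (2 * \<rho>) * s) powr p * sqrt e)\<^sup>2"
      by (simp add: power_mult_distrib e_def)
    finally have "\<bar>avg (unit_mi i) \<gamma> s x g\<bar> \<le> T * (real CARD('d) * (2 * \<rho>) * s) powr p * sqrt e"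
      using T by (intro power2_le_imp_le[of "\<bar>avg (unit_mi i) \<gamma> s x g\<bar>"]) (auto simp: e_def)
    also have "T * (real CARD('d) * (2 * \<rho>) * s) powr p =
        C * (real CARD('d) * (2 * \<rho>)) powr p * s powr (\<sigma> - 1 - real CARD('d) / 2)"
    proof -
      have e1: "T = C * s powr (- (real CARD('d) + 1))"
      proof -
        have "s powr (real CARD('d) + 1) = s ^ (CARD('d) + 1)"
          using s powr_realpow[of s "CARD('d) + 1"] by (simp add: add.commute)
        then show ?thesis unfolding T_def powr_minus divide_inverse by (simp only:)
      qed
      have e2: "(real CARD('d) * (2 * \<rho>) * s) powr p = (real CARD('d) * (2 * \<rho>)) powr p * s powr p"
        using s rho_pos by (intro powr_mult) 
      have e3: "s powr (- (real CARD('d) + 1)) * s powr p = s powr (\<sigma> - 1 - real CARD('d) / 2)"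
        unfolding powr_add[symmetric] by (simp add: p_def field_simps)
      show ?thesis unfolding e1 e2 e3[symmetric] by (simp only: mult_ac)
    qed
    finally show "\<bar>avg (unit_mi i) \<gamma> s x g\<bar> \<le> C * (real CARD('d) * (2 * \<rho>)) powr p *
        s powr (\<sigma> - 1 - real CARD('d) / 2) * sqrt (enn2real (slobodeckij_energy \<Omega> \<sigma> g))"
      by (simp only: e_def)
  qed
qed

definition mass :: real where
  "mass = avg 0 0 1 c (\<lambda>_. 1)"

lemma integrable_one: "integrable (lebesgue_on \<Omega>) (\<lambda>_. 1 :: real)"
  by (rule square_integrable_imp_integrable[OF square_integrable_const])

text \<open>
  The scale derivative of the total mass is a sum of averages with mean zero kernels, and at
  scale \<open>1\<close> the kernel is the bump itself, whatever \<open>x\<close>. This replaces a change of variables.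
\<close>

lemma avg_one:
  assumes x: "x \<in> \<Omega>" and s: "0 < s" "s \<le> 1"
  shows "avg 0 0 s x (\<lambda>_. 1) = mass"
proof -
  have d: "((\<lambda>s. avg 0 0 s x (\<lambda>_. 1)) has_real_derivative 0) (at t)" if "0 < t" "t \<le> 1" for t
    by (rule DERIV_cong[OF avg_deriv_scale[OF x integrable_one that(1)]]) (intro sum.neutral ballI avg_mean_zero[OF x that])
  have "avg 0 0 s x (\<lambda>_. 1) = avg 0 0 1 x (\<lambda>_. 1)"
  proof (cases "s = 1")
    case False
    with s have "s < 1" by simp
    then show ?thesis
      by (rule DERIV_isconst_end[symmetric])
         (use s in \<open>auto intro!: continuous_at_imp_continuous_on DERIV_isCont[OF d] d\<close>)
  qed simp
  also have "moll 0 0 1 x = moll 0 0 1 c" by (simp add: moll_def moll1_def fun_eq_iff)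
  then have "avg 0 0 1 x (\<lambda>_. 1) = mass" by (simp add: mass_def avg_def)
  finally show ?thesis .
qed

lemma moll_nonneg: "0 < s \<Longrightarrow> 0 \<le> moll 0 0 s x z"
  unfolding moll_def by (intro prod_nonneg) (auto simp: moll1_def b_nonneg)

lemma mass_pos: "0 < mass"
proof -
  have c: "c \<in> \<Omega>" using center_mem interior_subset by blast
  have int: "integrable (lebesgue_on \<Omega>) (moll 0 0 1 c)"
    using moll_times_integrable[OF c _ integrable_one, of 1 0 0] by simp
  have "mass \<noteq> 0"
  proof
    assume "mass = 0"
    then have "(LINT z|lebesgue_on \<Omega>. moll 0 0 1 c z) = 0" by (simp add: mass_def avg_def)
    then have "AE z in lebesgue_on \<Omega>. moll 0 0 1 c z = 0"
      by (subst (asm) integral_nonneg_eq_0_iff_AE[OF int]) (simp_all add: moll_nonneg)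
    then have "AE z in lebesgue. z \<in> \<Omega> \<longrightarrow> moll 0 0 1 c z = 0"
      by (subst (asm) AE_restrict_space_iff) auto
    then obtain N where N: "{z \<in> space lebesgue. \<not> (z \<in> \<Omega> \<longrightarrow> moll 0 0 1 c z = 0)} \<subseteq> N" "N \<in> null_sets lebesgue"
      by (auto elim!: AE_E simp: null_sets_def)
    define U where "U = interior \<Omega> \<inter> {z. 0 < moll 0 0 1 c z}"
    have "open U" unfolding U_def
      by (intro open_Int open_interior open_Collect_less continuous_on_moll continuous_on_const)
    moreover have "c \<in> U"
      using center_mem b_pos by (auto simp: U_def moll_def moll1_def intro!: prod_pos)
    moreover have "U \<subseteq> N" using N(1) interior_subset[of \<Omega>] by (auto simp: U_def)
    then have "negligible U"
      using N(2) by (meson negligible_iff_null_sets negligible_subset)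
    ultimately show False using open_not_negligible by blast
  qed
  moreover have "0 \<le> mass" unfolding mass_def avg_def by (simp add: moll_nonneg)
  ultimately show ?thesis by simp
qed

text \<open>
  As \<open>s\<close> tends to \<open>0\<close> the supporting boxes shrink to \<open>x\<close>, where \<open>v\<close> is continuous; the kernel is
  nonnegative with constant total mass.
\<close>

lemma avg_limit:
  assumes x: "x \<in> \<Omega>" and v: "integrable (lebesgue_on \<Omega>) v" and cont: "continuous_on \<Omega> v"
  shows "(\<lambda>n. avg 0 0 (inverse (real (Suc n))) x v) \<longlonglongrightarrow> mass * v x"
proof (rule LIMSEQ_I)
  fix r :: real assume r: "0 < r"
  obtain R where R: "0 \<le> R" "\<And>x i. x \<in> \<Omega> \<Longrightarrow> \<bar>x $ i - c $ i\<bar> \<le> R" by (rule Omega_bounded) blast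
  define e where "e = r / (2 * mass)"
  have e: "0 < e" using r mass_pos by (simp add: e_def)
  then obtain \<delta> where \<delta>: "0 < \<delta>" "\<And>z. z \<in> \<Omega> \<Longrightarrow> dist z x < \<delta> \<Longrightarrow> dist (v z) (v x) < e"
    using cont x unfolding continuous_on_iff by meson
  define K where "K = real CARD('d) * (R + \<rho>)"
  have K: "0 < K" using R(1) rho_pos by (simp add: K_def)
  obtain n0 where n0: "inverse (real (Suc n0)) < \<delta> / K"
    using reals_Archimedean[of "\<delta> / K"] \<delta>(1) K by auto
  have "norm (avg 0 0 (inverse (real (Suc n))) x v - mass * v x) < r" if n: "n \<ge> n0" for n
  proof -
    define s where "s = inverse (real (Suc n))"
    have s: "0 < s" "s \<le> 1" by (auto simp: s_def field_simps)
    have "s \<le> inverse (real (Suc n0))" unfolding s_def using n by (intro le_imp_inverse_le) auto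
    with n0 have "s < \<delta> / K" by linarith
    then have sK: "K * s < \<delta>" using K by (simp add: field_simps)
    have close: "\<bar>v z - v x\<bar> \<le> e" if z: "z \<in> supp_box s x" for z
    proof -
      have "\<bar>(z - x) $ i\<bar> \<le> s * (R + \<rho>)" for i
      proof -
        have "(1 - s) * x $ i + s * (c $ i - \<rho>) \<le> z $ i" "z $ i \<le> (1 - s) * x $ i + s * (c $ i + \<rho>)"
          using z by (auto simp: supp_box_def mem_box_cart)
        then have "\<bar>(z - x) $ i + s * (x $ i - c $ i)\<bar> \<le> s * \<rho>" by (simp add: algebra_simps abs_le_iff)
        moreover have "\<bar>s * (x $ i - c $ i)\<bar> \<le> s * R"
          unfolding abs_mult using s R(2)[OF x, of i] by (simp add: mult_left_mono)
        ultimately show ?thesis unfolding distrib_left by linarith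
      qed
      then have "(\<Sum>i\<in>UNIV. \<bar>(z - x) $ i\<bar>) \<le> (\<Sum>i\<in>(UNIV::'d set). s * (R + \<rho>))" by (intro sum_mono)
      then have "norm (z - x) \<le> K * s" using norm_le_l1_cart[of "z - x"] by (simp add: K_def mult_ac)
      with sK have "dist z x < \<delta>" by (simp add: dist_norm)
      moreover have "z \<in> \<Omega>" using z supp_box_subset'[OF x s] by blast
      ultimately show ?thesis using \<delta>(2)[of z] by (simp add: dist_real_def)
    qed
    have i1: "integrable (lebesgue_on \<Omega>) (\<lambda>z. moll 0 0 s x z * v z)" by (rule moll_times_integrable[OF x s(1) v])
    have i2: "integrable (lebesgue_on \<Omega>) (\<lambda>z. moll 0 0 s x z * 1)" by (rule moll_times_integrable[OF x s(1) integrable_one])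
    have i3: "integrable (lebesgue_on \<Omega>) (\<lambda>z. moll 0 0 s x z * v z - v x * (moll 0 0 s x z * 1))"
      using i1 i2 by (intro Bochner_Integration.integrable_diff integrable_mult_right)
    have "avg 0 0 s x v - mass * v x = avg 0 0 s x v - v x * avg 0 0 s x (\<lambda>_. 1)"
      by (simp add: avg_one[OF x s])
    also have "\<dots> = (LINT z|lebesgue_on \<Omega>. moll 0 0 s x z * v z - v x * (moll 0 0 s x z * 1))"
      unfolding avg_def using i1 i2 by (subst Bochner_Integration.integral_diff) auto
    finally have "norm (avg 0 0 s x v - mass * v x) =
        norm (LINT z|lebesgue_on \<Omega>. moll 0 0 s x z * v z - v x * (moll 0 0 s x z * 1))" by simp
    also have "\<dots> \<le> (LINT z|lebesgue_on \<Omega>. norm (moll 0 0 s x z * v z - v x * (moll 0 0 s x z * 1)))"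
      by (rule integral_norm_bound)
    also have "\<dots> \<le> (LINT z|lebesgue_on \<Omega>. e * (moll 0 0 s x z * 1))"
    proof (rule integral_mono[OF integrable_norm[OF i3] integrable_mult_right[OF i2]])
      fix z
      show "norm (moll 0 0 s x z * v z - v x * (moll 0 0 s x z * 1)) \<le> e * (moll 0 0 s x z * 1)"
      proof (cases "z \<in> supp_box s x")
        case True
        have "norm (moll 0 0 s x z * v z - v x * (moll 0 0 s x z * 1)) = moll 0 0 s x z * \<bar>v z - v x\<bar>"
        proof -
          have "moll 0 0 s x z * v z - v x * (moll 0 0 s x z * 1) = moll 0 0 s x z * (v z - v x)"
            by (simp add: algebra_simps)
          then show ?thesis using moll_nonneg[OF s(1), of x z] by (simp only: real_norm_def abs_mult abs_of_nonneg)
        qed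
        also have "\<dots> \<le> moll 0 0 s x z * e" by (intro mult_left_mono close True moll_nonneg s(1))
        finally show ?thesis by (simp add: mult.commute)
      qed (simp add: moll_support[OF s(1)])
    qed
    also have "\<dots> = e * avg 0 0 s x (\<lambda>_. 1)" by (simp add: avg_def)
    also have "\<dots> = r / 2" using mass_pos by (simp add: avg_one[OF x s] e_def)
    also have "\<dots> < r" using r by simp
    finally show ?thesis by (simp only: s_def)
  qed
  then show "\<exists>n0. \<forall>n\<ge>n0. norm (avg 0 0 (inverse (real (Suc n))) x v - mass * v x) < r" by blast
qed

end

section \<open>Sobolev embedding with scaling\<close>

lemma sobolev_space_weak_deriv:
  assumes "v \<in> sobolev_space m \<Omega>" "mi_order \<beta> \<le> nat \<lfloor>m\<rfloor>"
  shows "is_weak_deriv \<Omega> \<beta> v (weak_deriv \<Omega> \<beta> v)"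
proof -
  have "\<exists>g. is_weak_deriv \<Omega> \<beta> v g" using assms unfolding sobolev_space_def by blast
  then show ?thesis unfolding weak_deriv_def by (rule someI_ex)
qed

lemma sobolev_norm_nonneg: "0 \<le> sobolev_norm m \<Omega> v"
  unfolding sobolev_norm_def by (auto intro!: add_nonneg_nonneg sum_nonneg)

lemma norm_weak_deriv_le_sobolev_norm:
  assumes "mi_order \<beta> \<le> nat \<lfloor>m\<rfloor>"
  shows "norm_L2 \<Omega> (weak_deriv \<Omega> \<beta> v) \<le> sobolev_norm m \<Omega> v"
proof -
  have "(norm_L2 \<Omega> (weak_deriv \<Omega> \<beta> v))\<^sup>2 \<le> (\<Sum>\<beta> | mi_order \<beta> \<le> nat \<lfloor>m\<rfloor>. (norm_L2 \<Omega> (weak_deriv \<Omega> \<beta> v))\<^sup>2)"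
    using assms finite_mi_order_le
    by (intro member_le_sum[of \<beta> _ "\<lambda>\<beta>. (norm_L2 \<Omega> (weak_deriv \<Omega> \<beta> v))\<^sup>2"]) auto
  moreover have "0 \<le> (if frac m > 0 then (\<Sum>\<beta> | mi_order \<beta> = nat \<lfloor>m\<rfloor>.
               enn2real (slobodeckij_energy \<Omega> (frac m) (weak_deriv \<Omega> \<beta> v))) else 0)"
    by (auto intro: sum_nonneg)
  ultimately show ?thesis unfolding sobolev_norm_def by (intro real_le_rsqrt) linarith
qed

lemma slobodeckij_le_sobolev_norm:
  assumes "mi_order \<beta> = nat \<lfloor>m\<rfloor>" "frac m > 0"
  shows "sqrt (enn2real (slobodeckij_energy \<Omega> (frac m) (weak_deriv \<Omega> \<beta> v))) \<le> sobolev_norm m \<Omega> v"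
proof -
  have fin: "finite {\<beta> :: nat ^ 'a. mi_order \<beta> = nat \<lfloor>m\<rfloor>}"
    by (rule finite_subset[OF _ finite_mi_order_le[of "nat \<lfloor>m\<rfloor>"]]) auto
  have "enn2real (slobodeckij_energy \<Omega> (frac m) (weak_deriv \<Omega> \<beta> v)) \<le> (\<Sum>\<beta> | mi_order \<beta> = nat \<lfloor>m\<rfloor>.
               enn2real (slobodeckij_energy \<Omega> (frac m) (weak_deriv \<Omega> \<beta> v)))"
    using assms fin
    by (intro member_le_sum[of \<beta> _ "\<lambda>\<beta>. enn2real (slobodeckij_energy \<Omega> (frac m) (weak_deriv \<Omega> \<beta> v))"]) auto
  moreover have "0 \<le> (\<Sum>\<beta> | mi_order \<beta> \<le> nat \<lfloor>m\<rfloor>. (norm_L2 \<Omega> (weak_deriv \<Omega> \<beta> v))\<^sup>2)"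
    by (intro sum_nonneg) auto
  ultimately show ?thesis unfolding sobolev_norm_def using assms(2)
    by (intro real_sqrt_le_mono) simp
qed

lemma inverse_Suc_powr_tendsto_0:
  assumes "0 < q"
  shows "(\<lambda>n. inverse (real (Suc n)) powr q) \<longlonglongrightarrow> 0"
  by (rule tendsto_zero_powrI[OF LIMSEQ_inverse_real_of_nat tendsto_const _ assms]) simp

context smoothing_domain
begin

text \<open>
  Up to order \<open>\<lfloor>m\<rfloor>\<close> all derivatives can be moved to \<open>v\<close>.
\<close>

lemma avg_mid_bound:
  obtains C where "0 \<le> C" and "\<And>\<beta> \<gamma> s x v. mi_order \<beta> \<le> nat \<lfloor>m\<rfloor> \<Longrightarrow> mi_order \<gamma> \<le> N \<Longrightarrow>
      0 < s \<Longrightarrow> s \<le> 1 \<Longrightarrow> x \<in> \<Omega> \<Longrightarrow> v \<in> sobolev_space m \<Omega> \<Longrightarrow>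
      \<bar>avg \<beta> \<gamma> s x v\<bar> \<le> C * s powr (- (real CARD('d) / 2)) * sobolev_norm m \<Omega> v"
proof -
  obtain C where C: "0 \<le> C" "\<And>\<beta> \<gamma> s x v. mi_order \<beta> \<le> N \<Longrightarrow> mi_order \<gamma> \<le> N \<Longrightarrow> 0 < s \<Longrightarrow> s \<le> 1 \<Longrightarrow>
      x \<in> \<Omega> \<Longrightarrow> square_integrable \<Omega> v \<Longrightarrow>
      \<bar>avg \<beta> \<gamma> s x v\<bar> \<le> C * s powr (- (real CARD('d) / 2) - real (mi_order \<beta>)) * norm_L2 \<Omega> v"
    by (rule avg_bound) blast
  show ?thesis
  proof (rule that[OF C(1)])
    fix \<beta> \<gamma> :: "nat ^ 'd" and s :: real and x v
    assume a: "mi_order \<beta> \<le> nat \<lfloor>m\<rfloor>" "mi_order \<gamma> \<le> N" and s: "0 < s" "s \<le> 1"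
      and x: "x \<in> \<Omega>" and v: "v \<in> sobolev_space m \<Omega>"
    have w: "is_weak_deriv \<Omega> \<beta> v (weak_deriv \<Omega> \<beta> v)" by (rule sobolev_space_weak_deriv[OF v a(1)])
    have "avg \<beta> \<gamma> s x v = avg 0 \<gamma> s x (weak_deriv \<Omega> \<beta> v)" using avg_weak[OF w x s, of 0] by simp
    also have "\<bar>\<dots>\<bar> \<le> C * s powr (- (real CARD('d) / 2) - real (mi_order (0 :: nat ^ 'd))) * norm_L2 \<Omega> (weak_deriv \<Omega> \<beta> v)"
      using w a s x by (intro C(2)) (auto simp: is_weak_deriv_def)
    also have "\<dots> \<le> C * s powr (- (real CARD('d) / 2)) * sobolev_norm m \<Omega> v"
      using C(1) norm_weak_deriv_le_sobolev_norm[OF a(1)] by (simp add: mult_left_mono)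
    finally show "\<bar>avg \<beta> \<gamma> s x v\<bar> \<le> C * s powr (- (real CARD('d) / 2)) * sobolev_norm m \<Omega> v" .
  qed
qed

text \<open>
  If \<open>m\<close> is an integer, \<open>\<lceil>m\<rceil>\<close> derivatives can be moved to \<open>v\<close>. Otherwise one of them
  stays on the kernel and the fractional seminorm accounts for it.
\<close>

lemma avg_top_bound:
  assumes m: "0 < m"
  obtains C where "0 \<le> C" and "\<And>\<beta> \<gamma> s x v. mi_order \<beta> = nat \<lceil>m\<rceil> \<Longrightarrow> mi_order \<gamma> \<le> N \<Longrightarrow>
      0 < s \<Longrightarrow> s \<le> 1 \<Longrightarrow> x \<in> \<Omega> \<Longrightarrow> v \<in> sobolev_space m \<Omega> \<Longrightarrow>
      \<bar>avg \<beta> \<gamma> s x v\<bar> \<le> C * s powr (m - real (nat \<lceil>m\<rceil>) - real CARD('d) / 2) * sobolev_norm m \<Omega> v"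
proof (cases "frac m = 0")
  case True
  then have mi: "real (nat \<lceil>m\<rceil>) = m" "nat \<lceil>m\<rceil> = nat \<lfloor>m\<rfloor>"
    using m by (auto simp: frac_eq_0_iff elim!: Ints_cases)
  show ?thesis
  proof (rule avg_mid_bound[of m N])
    fix C assume C: "0 \<le> C" "\<And>\<beta> \<gamma> s x v. mi_order \<beta> \<le> nat \<lfloor>m\<rfloor> \<Longrightarrow> mi_order \<gamma> \<le> N \<Longrightarrow>
      0 < s \<Longrightarrow> s \<le> 1 \<Longrightarrow> x \<in> \<Omega> \<Longrightarrow> v \<in> sobolev_space m \<Omega> \<Longrightarrow>
      \<bar>avg \<beta> \<gamma> s x v\<bar> \<le> C * s powr (- (real CARD('d) / 2)) * sobolev_norm m \<Omega> v"
    show ?thesis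
      by (rule that[OF C(1)]) (use C(2) mi in auto)
  qed
next
  case False
  then have fr: "0 < frac m" by (simp add: order_less_le)
  have mi: "nat \<lceil>m\<rceil> = Suc (nat \<lfloor>m\<rfloor>)" "m - real (nat \<lceil>m\<rceil>) = frac m - 1"
  proof -
    have "\<lceil>m\<rceil> = \<lfloor>m\<rfloor> + 1" using False by (simp add: ceiling_altdef frac_def)
    moreover have "0 \<le> \<lfloor>m\<rfloor>" using m by simp
    ultimately show "nat \<lceil>m\<rceil> = Suc (nat \<lfloor>m\<rfloor>)" by linarith
    then show "m - real (nat \<lceil>m\<rceil>) = frac m - 1" using \<open>0 \<le> \<lfloor>m\<rfloor>\<close> by (simp add: frac_def)
  qed
  show ?thesis
  proof (rule avg_fractional_bound[OF fr, of N])
    fix C assume C0: "0 \<le> C" and C: "\<And>\<gamma> i s x g. mi_order \<gamma> \<le> N \<Longrightarrow> 0 < s \<Longrightarrow> s \<le> 1 \<Longrightarrow>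
      x \<in> \<Omega> \<Longrightarrow> square_integrable \<Omega> g \<Longrightarrow> slobodeckij_energy \<Omega> (frac m) g < \<infinity> \<Longrightarrow>
      \<bar>avg (unit_mi i) \<gamma> s x g\<bar> \<le> C * s powr (frac m - 1 - real CARD('d) / 2) *
        sqrt (enn2real (slobodeckij_energy \<Omega> (frac m) g))"
    show ?thesis
    proof (rule that[OF C0])
      fix \<beta> \<gamma> :: "nat ^ 'd" and s :: real and x v
      assume a: "mi_order \<beta> = nat \<lceil>m\<rceil>" "mi_order \<gamma> \<le> N" and s: "0 < s" "s \<le> 1"
        and x: "x \<in> \<Omega>" and v: "v \<in> sobolev_space m \<Omega>"
      have "\<exists>i. \<beta> $ i \<noteq> 0"
      proof (rule ccontr)
        assume "\<nexists>i. \<beta> $ i \<noteq> 0"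
        then have "mi_order \<beta> = 0" by (simp add: mi_order_def)
        then show False using a(1) mi(1) by simp
      qed
      then obtain i where i: "\<beta> $ i \<noteq> 0" by blast
      define \<beta>' where "\<beta>' = \<beta> - unit_mi i"
      have \<beta>: "\<beta> = unit_mi i + \<beta>'" using i by (auto simp: \<beta>'_def vec_eq_iff unit_mi_nth)
      have o: "mi_order \<beta>' = nat \<lfloor>m\<rfloor>" using a(1) mi(1) unfolding \<beta> by (simp add: mi_order_add)
      have w: "is_weak_deriv \<Omega> \<beta>' v (weak_deriv \<Omega> \<beta>' v)" by (rule sobolev_space_weak_deriv[OF v]) (simp add: o)
      have en: "slobodeckij_energy \<Omega> (frac m) (weak_deriv \<Omega> \<beta>' v) < \<infinity>"
        using v o fr by (simp add: sobolev_space_def)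
      have "avg \<beta> \<gamma> s x v = avg (unit_mi i) \<gamma> s x (weak_deriv \<Omega> \<beta>' v)"
        unfolding \<beta> by (rule avg_weak[OF w x s])
      also have "\<bar>\<dots>\<bar> \<le> C * s powr (frac m - 1 - real CARD('d) / 2) *
        sqrt (enn2real (slobodeckij_energy \<Omega> (frac m) (weak_deriv \<Omega> \<beta>' v)))"
        using w en a s x by (intro C) (auto simp: is_weak_deriv_def)
      also have "\<dots> \<le> C * s powr (frac m - 1 - real CARD('d) / 2) * sobolev_norm m \<Omega> v"
        using C0 slobodeckij_le_sobolev_norm[OF o fr] by (intro mult_left_mono) auto
      finally show "\<bar>avg \<beta> \<gamma> s x v\<bar> \<le> C * s powr (m - real (nat \<lceil>m\<rceil>) - real CARD('d) / 2) * sobolev_norm m \<Omega> v"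
        by (simp only: mi(2))
    qed
  qed
qed

text \<open>
  The \<open>l\<close>-th derivative of the average with respect to the scale, as a sum over all choices of
  directions.
\<close>

primrec avg_iter :: "nat \<Rightarrow> nat ^ 'd \<Rightarrow> nat ^ 'd \<Rightarrow> real \<Rightarrow> real ^ 'd \<Rightarrow> (real ^ 'd \<Rightarrow> real) \<Rightarrow> real" where
  "avg_iter 0 \<beta> \<gamma> s x v = avg \<beta> \<gamma> s x v"
| "avg_iter (Suc l) \<beta> \<gamma> s x v = (\<Sum>i\<in>UNIV. avg_iter l (\<beta> + unit_mi i) (\<gamma> + unit_mi i) s x v)"

lemma avg_iter_deriv:
  assumes x: "x \<in> \<Omega>" and v: "integrable (lebesgue_on \<Omega>) v" and s: "0 < s"
  shows "((\<lambda>s. avg_iter l \<beta> \<gamma> s x v) has_real_derivative avg_iter (Suc l) \<beta> \<gamma> s x v) (at s)"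
proof (induction l arbitrary: \<beta> \<gamma>)
  case 0
  show ?case using avg_deriv_scale[OF x v s] by simp
next
  case (Suc l)
  have "((\<lambda>s. \<Sum>i\<in>UNIV. avg_iter l (\<beta> + unit_mi i) (\<gamma> + unit_mi i) s x v) has_real_derivative
     (\<Sum>i\<in>UNIV. avg_iter (Suc l) (\<beta> + unit_mi i) (\<gamma> + unit_mi i) s x v)) (at s)"
    by (intro DERIV_sum Suc.IH)
  then show ?case by simp
qed

lemma avg_iter_bound:
  assumes "\<And>\<beta>' \<gamma>'. mi_order \<beta>' = mi_order \<beta> + l \<Longrightarrow> mi_order \<gamma>' = mi_order \<gamma> + l \<Longrightarrow> \<bar>avg \<beta>' \<gamma>' s x v\<bar> \<le> T"
  shows "\<bar>avg_iter l \<beta> \<gamma> s x v\<bar> \<le> real CARD('d) ^ l * T"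
  using assms
proof (induction l arbitrary: \<beta> \<gamma>)
  case 0
  then show ?case by simp
next
  case (Suc l)
  have "\<bar>avg_iter l (\<beta> + unit_mi i) (\<gamma> + unit_mi i) s x v\<bar> \<le> real CARD('d) ^ l * T" for i
    by (rule Suc.IH) (auto intro: Suc.prems simp: mi_order_add)
  then have "(\<Sum>i\<in>UNIV. \<bar>avg_iter l (\<beta> + unit_mi i) (\<gamma> + unit_mi i) s x v\<bar>) \<le> (\<Sum>i\<in>(UNIV::'d set). real CARD('d) ^ l * T)"
    by (intro sum_mono)
  then show ?case by (simp add: order_trans[OF sum_abs] mult.assoc)
qed

text \<open>
  The crude estimates at the single scale \<open>h\<close>, measured by \<open>E\<close>, and the Sobolev norm together
  control the averages at all smaller scales. Two choices of \<open>E\<close> will be used: the \<open>L\<^sub>2\<close> norm for arbitrary \<open>h\<close>,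
  and the Sobolev norm for \<open>h = 1\<close>.
\<close>

lemma avg_stable:
  assumes m: "real CARD('d) / 2 + real k < m"
  obtains K q where "0 \<le> K" "0 < q"
    and "\<And>\<beta> v x h E s s'. mi_order \<beta> \<le> k \<Longrightarrow> v \<in> sobolev_space m \<Omega> \<Longrightarrow> x \<in> \<Omega> \<Longrightarrow> 0 < h \<Longrightarrow> h \<le> 1 \<Longrightarrow> 0 \<le> E \<Longrightarrow>
      (\<And>\<beta>' \<gamma>'. mi_order \<beta>' < nat \<lceil>m\<rceil> \<Longrightarrow> mi_order \<gamma>' \<le> nat \<lceil>m\<rceil> \<Longrightarrow>
          \<bar>avg \<beta>' \<gamma>' h x v\<bar> \<le> E * h powr (- (real CARD('d) / 2) - real (mi_order \<beta>'))) \<Longrightarrow>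
      0 < s \<Longrightarrow> s \<le> s' \<Longrightarrow> s' \<le> h \<Longrightarrow>
      \<bar>avg \<beta> 0 s' x v - avg \<beta> 0 s x v\<bar> \<le> K * (sobolev_norm m \<Omega> v * h powr (m - real (mi_order \<beta>) - real CARD('d) / 2) +
         E * h powr (- (real CARD('d) / 2) - real (mi_order \<beta>))) * (s' / h) powr q"
proof -
  define n0 where "n0 = nat \<lceil>m\<rceil>"
  define d where "d = real CARD('d)"
  have d1: "1 \<le> d" unfolding d_def using zero_less_card_finite[where 'a = 'd] by linarith
  have m0: "0 < m" using m by (meson add_nonneg_nonneg divide_nonneg_nonneg le_less_trans of_nat_0_le_iff zero_le_numeral)
  have mn: "m \<le> real n0" unfolding n0_def by linarith
  \<comment> \<open>A single exponent below 1 that works for all orders up to \<open>k\<close>; the surplus goes into \<open>A\<close> and \<open>B\<close>.\<close>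
  define q where "q = min (1 / 2) (m - real k - d / 2)"
  have q: "0 < q" "q < 1" "q \<le> m - real k - d / 2" using m by (auto simp: q_def d_def)
  define K0 where "K0 = (1 + 1 / (1 - q)) ^ n0 / q"
  have K0: "0 \<le> K0" unfolding K0_def using q by simp
  show ?thesis
  proof (rule avg_top_bound[OF m0, of n0])
    fix C assume C0: "0 \<le> C" and C: "\<And>\<beta> \<gamma> s x v. mi_order \<beta> = nat \<lceil>m\<rceil> \<Longrightarrow> mi_order \<gamma> \<le> n0 \<Longrightarrow>
      0 < s \<Longrightarrow> s \<le> 1 \<Longrightarrow> x \<in> \<Omega> \<Longrightarrow> v \<in> sobolev_space m \<Omega> \<Longrightarrow>
      \<bar>avg \<beta> \<gamma> s x v\<bar> \<le> C * s powr (m - real (nat \<lceil>m\<rceil>) - real CARD('d) / 2) * sobolev_norm m \<Omega> v"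
    define K where "K = K0 * d ^ n0 * (C + 1)"
    show ?thesis
    proof (rule that[of K q])
      show "0 \<le> K" unfolding K_def using K0 d1 C0 by simp
      show "0 < q" by (rule q)
      fix \<beta> :: "nat ^ 'd" and v x and h E s s' :: real
      assume \<beta>: "mi_order \<beta> \<le> k" and v: "v \<in> sobolev_space m \<Omega>" and x: "x \<in> \<Omega>"
        and h: "0 < h" "h \<le> 1" and E: "0 \<le> E"
        and JE: "\<And>\<beta>' \<gamma>'. mi_order \<beta>' < nat \<lceil>m\<rceil> \<Longrightarrow> mi_order \<gamma>' \<le> nat \<lceil>m\<rceil> \<Longrightarrow>
          \<bar>avg \<beta>' \<gamma>' h x v\<bar> \<le> E * h powr (- (real CARD('d) / 2) - real (mi_order \<beta>'))"
        and s: "0 < s" "s \<le> s'" "s' \<le> h"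
      define j where "j = mi_order \<beta>"
      define N where "N = n0 - j"
      define S where "S = sobolev_norm m \<Omega> v"
      have S: "0 \<le> S" unfolding S_def by (rule sobolev_norm_nonneg)
      have jn: "j < n0" using \<beta> m mn d1 by (simp add: j_def d_def)
      then have N: "1 \<le> N" "j + N = n0" "N \<le> n0" by (auto simp: N_def)
      have qj: "q \<le> m - real j - d / 2" using q(3) \<beta> by (simp add: j_def)
      define A where "A = d ^ n0 * C * S * h powr (m - real j - d / 2 - q)"
      define B where "B = d ^ n0 * E * h powr (- (d / 2) - real j - q)"
      have AB: "0 \<le> A" "0 \<le> B" unfolding A_def B_def using d1 C0 S E by auto
      have vi: "integrable (lebesgue_on \<Omega>) v"
        using v by (intro square_integrable_imp_integrable) (simp add: sobolev_space_def)
      have dl: "d ^ l \<le> d ^ n0" if "l \<le> n0" for l using d1 that by (rule power_increasing[rotated])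
      have top: "\<bar>avg_iter N \<beta> 0 t x v\<bar> \<le> A * t powr (q - real N)" if t: "0 < t" "t \<le> h" for t
      proof -
        have "\<bar>avg_iter N \<beta> 0 t x v\<bar> \<le> d ^ N * (C * t powr (m - real n0 - d / 2) * S)"
          unfolding d_def S_def
        proof (rule avg_iter_bound)
          fix \<beta>' \<gamma>' :: "nat ^ 'd" assume "mi_order \<beta>' = mi_order \<beta> + N" "mi_order \<gamma>' = mi_order (0 :: nat ^ 'd) + N"
          then show "\<bar>avg \<beta>' \<gamma>' t x v\<bar> \<le> C * t powr (m - real n0 - real CARD('d) / 2) * sobolev_norm m \<Omega> v"
            using C[of \<beta>' \<gamma>' t x v] t h x v N by (simp add: j_def n0_def)
        qed
        also have "t powr (m - real n0 - d / 2) = t powr (q - real N) * t powr (m - real j - d / 2 - q)"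
          unfolding powr_add[symmetric] using N by (simp add: algebra_simps flip: N(2))
        also have "d ^ N * (C * (t powr (q - real N) * t powr (m - real j - d / 2 - q)) * S) \<le>
            d ^ n0 * (C * (t powr (q - real N) * h powr (m - real j - d / 2 - q)) * S)"
          using t qj C0 S d1 N by (intro mult_mono dl powr_mono2 mult_nonneg_nonneg order_refl) auto
        finally show ?thesis by (simp add: A_def mult_ac)
      qed
      have low: "\<bar>avg_iter l \<beta> 0 h x v\<bar> \<le> B * h powr (q - real l)" if l: "l < N" for l
      proof -
        have "\<bar>avg_iter l \<beta> 0 h x v\<bar> \<le> d ^ l * (E * h powr (- (d / 2) - real (j + l)))"
          unfolding d_def
        proof (rule avg_iter_bound)
          fix \<beta>' \<gamma>' :: "nat ^ 'd" assume o: "mi_order \<beta>' = mi_order \<beta> + l" "mi_order \<gamma>' = mi_order (0 :: nat ^ 'd) + l"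
          then have "mi_order \<beta>' < nat \<lceil>m\<rceil>" "mi_order \<gamma>' \<le> nat \<lceil>m\<rceil>"
            using l N by (auto simp: j_def n0_def)
          from JE[OF this] show "\<bar>avg \<beta>' \<gamma>' h x v\<bar> \<le> E * h powr (- (real CARD('d) / 2) - real (j + l))"
            by (simp add: o(1) j_def)
        qed
        also have "h powr (- (d / 2) - real (j + l)) = h powr (- (d / 2) - real j - q) * h powr (q - real l)"
        proof -
          have "- (d / 2) - real (j + l) = (- (d / 2) - real j - q) + (q - real l)" by simp
          then show ?thesis by (simp only: powr_add)
        qed
        also have "d ^ l * (E * (h powr (- (d / 2) - real j - q) * h powr (q - real l))) \<le>
           d ^ n0 * (E * (h powr (- (d / 2) - real j - q) * h powr (q - real l)))"
          using l N E by (intro mult_right_mono dl) auto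
        finally show ?thesis by (simp add: B_def mult_ac)
      qed
      have "\<bar>avg_iter 0 \<beta> 0 s' x v - avg_iter 0 \<beta> 0 s x v\<bar> \<le> (1 + 1 / (1 - q)) ^ N / q * (A + B) * s' powr q"
        by (rule decay_imp_modulus[where D = "\<lambda>l s. avg_iter l \<beta> 0 s x v" and h = h, OF q(1,2) AB N(1) _ top low s])
           (intro avg_iter_deriv x vi)
      also have "\<dots> \<le> K0 * (A + B) * s' powr q"
        unfolding K0_def using q AB N by (intro mult_right_mono divide_right_mono power_increasing) auto
      also have "\<dots> = K0 * d ^ n0 * (C * (S * h powr (m - real j - d / 2)) + E * h powr (- (d / 2) - real j)) * (s' / h) powr q"
      proof -
        have "h powr (m - real j - d / 2 - q) * s' powr q = h powr (m - real j - d / 2) * (s' / h) powr q"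
          "h powr (- (d / 2) - real j - q) * s' powr q = h powr (- (d / 2) - real j) * (s' / h) powr q"
          using h s by (simp_all add: powr_diff powr_divide)
        then have e: "A * s' powr q = d ^ n0 * C * S * (h powr (m - real j - d / 2) * (s' / h) powr q)"
          "B * s' powr q = d ^ n0 * E * (h powr (- (d / 2) - real j) * (s' / h) powr q)"
          unfolding A_def B_def mult.assoc by (simp_all only:)
        have "K0 * (A + B) * s' powr q = K0 * (A * s' powr q) + K0 * (B * s' powr q)"
          by (simp add: algebra_simps)
        then show ?thesis unfolding e by (simp add: algebra_simps)
      qed
      also have "\<dots> \<le> K0 * d ^ n0 * ((C + 1) * (S * h powr (m - real j - d / 2) + E * h powr (- (d / 2) - real j))) * (s' / h) powr q"
      proof -
        have "C * (S * h powr (m - real j - d / 2)) + E * h powr (- (d / 2) - real j) \<le>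
            (C + 1) * (S * h powr (m - real j - d / 2)) + (C + 1) * (E * h powr (- (d / 2) - real j))"
          using C0 S E by (intro add_mono) (auto intro!: mult_right_mono simp: algebra_simps)
        then show ?thesis using K0 d1 by (intro mult_right_mono mult_left_mono) (auto simp: distrib_left)
      qed
      finally show "\<bar>avg \<beta> 0 s' x v - avg \<beta> 0 s x v\<bar> \<le> K * (sobolev_norm m \<Omega> v * h powr (m - real (mi_order \<beta>) - real CARD('d) / 2) +
         E * h powr (- (real CARD('d) / 2) - real (mi_order \<beta>))) * (s' / h) powr q"
        by (simp add: K_def S_def d_def j_def mult.assoc)
    qed
  qed
qed

text \<open>
  Passing to the limit \<open>s = 1 / (n + 1)\<close>. The factor \<open>1 - s\<close> from differentiating the contraction
  in \<open>x\<close> tends to \<open>1\<close>, so the uniform limits of the averages are linked by differentiation, starting from a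
  multiple of \<open>v\<close>.
\<close>

lemma sobolev_derivatives_aux:
  assumes m: "real CARD('d) / 2 + real k < m"
  obtains C where "0 \<le> C" and "\<And>v js x. v \<in> sobolev_space m \<Omega> \<Longrightarrow> continuous_on \<Omega> v \<Longrightarrow> length js \<le> k \<Longrightarrow> x \<in> \<Omega> \<Longrightarrow>
      (length js < k \<longrightarrow> iter_partial_deriv \<Omega> js v differentiable (at x within \<Omega>)) \<and>
      \<bar>iter_partial_deriv \<Omega> js v x\<bar> \<le> C * sobolev_norm m \<Omega> v \<and>
      (\<forall>h. 0 < h \<longrightarrow> h \<le> 1 \<longrightarrow> \<bar>iter_partial_deriv \<Omega> js v x\<bar> \<le>
         C * (norm_L2 \<Omega> v * h powr (- (real CARD('d) / 2) - real (length js)) +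
              sobolev_norm m \<Omega> v * h powr (m - real (length js) - real CARD('d) / 2)))"
proof -
  define n0 where "n0 = nat \<lceil>m\<rceil>"
  define d where "d = real CARD('d)"
  have d1: "1 \<le> d" unfolding d_def using zero_less_card_finite[where 'a = 'd] by linarith
  have mn: "m \<le> real n0" unfolding n0_def by linarith
  have kn: "k < n0" using m mn d1 by (simp add: d_def)
  obtain K q where K: "0 \<le> K" and q: "0 < q"
    and stable: "\<And>\<beta> v x h E s s'. mi_order \<beta> \<le> k \<Longrightarrow> v \<in> sobolev_space m \<Omega> \<Longrightarrow> x \<in> \<Omega> \<Longrightarrow> 0 < h \<Longrightarrow> h \<le> 1 \<Longrightarrow> 0 \<le> E \<Longrightarrow>
      (\<And>\<beta>' \<gamma>'. mi_order \<beta>' < nat \<lceil>m\<rceil> \<Longrightarrow> mi_order \<gamma>' \<le> nat \<lceil>m\<rceil> \<Longrightarrow>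
          \<bar>avg \<beta>' \<gamma>' h x v\<bar> \<le> E * h powr (- (real CARD('d) / 2) - real (mi_order \<beta>'))) \<Longrightarrow>
      0 < s \<Longrightarrow> s \<le> s' \<Longrightarrow> s' \<le> h \<Longrightarrow>
      \<bar>avg \<beta> 0 s' x v - avg \<beta> 0 s x v\<bar> \<le> K * (sobolev_norm m \<Omega> v * h powr (m - real (mi_order \<beta>) - real CARD('d) / 2) +
         E * h powr (- (real CARD('d) / 2) - real (mi_order \<beta>))) * (s' / h) powr q"
    by (rule avg_stable[OF m]) blast
  obtain C2 where C2: "0 \<le> C2" "\<And>\<beta> \<gamma> s x v. mi_order \<beta> \<le> n0 \<Longrightarrow> mi_order \<gamma> \<le> n0 \<Longrightarrow> 0 < s \<Longrightarrow> s \<le> 1 \<Longrightarrow>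
      x \<in> \<Omega> \<Longrightarrow> square_integrable \<Omega> v \<Longrightarrow>
      \<bar>avg \<beta> \<gamma> s x v\<bar> \<le> C2 * s powr (- (real CARD('d) / 2) - real (mi_order \<beta>)) * norm_L2 \<Omega> v"
    by (rule avg_bound) blast
  obtain C3 where C3: "0 \<le> C3" "\<And>\<beta> \<gamma> s x v. mi_order \<beta> \<le> nat \<lfloor>m\<rfloor> \<Longrightarrow> mi_order \<gamma> \<le> n0 \<Longrightarrow>
      0 < s \<Longrightarrow> s \<le> 1 \<Longrightarrow> x \<in> \<Omega> \<Longrightarrow> v \<in> sobolev_space m \<Omega> \<Longrightarrow>
      \<bar>avg \<beta> \<gamma> s x v\<bar> \<le> C3 * s powr (- (real CARD('d) / 2)) * sobolev_norm m \<Omega> v"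
    by (rule avg_mid_bound) blast
  define C where "C = (K + 1) * (C2 + C3 + 1) / mass"
  show ?thesis
  proof (rule that[of C])
    show "0 \<le> C" unfolding C_def using K C2(1) C3(1) mass_pos by simp
    fix v and js :: "'d list" and x0 assume v: "v \<in> sobolev_space m \<Omega>" and cont: "continuous_on \<Omega> v"
      and js: "length js \<le> k" and x0: "x0 \<in> \<Omega>"
    define S where "S = sobolev_norm m \<Omega> v"
    have S: "0 \<le> S" unfolding S_def by (rule sobolev_norm_nonneg)
    define M where "M = K * (S + C3 * S)"
    have M: "0 \<le> M" unfolding M_def using K S C3(1) by simp
    have sq: "square_integrable \<Omega> v" using v by (simp add: sobolev_space_def)
    have vi: "integrable (lebesgue_on \<Omega>) v" by (rule square_integrable_imp_integrable[OF sq])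
    have J1: "\<bar>avg \<beta> \<gamma> 1 x v\<bar> \<le> C3 * S" if "mi_order \<beta> < n0" "mi_order \<gamma> \<le> n0" "x \<in> \<Omega>" for \<beta> \<gamma> x
    proof -
      have "mi_order \<beta> \<le> nat \<lfloor>m\<rfloor>" using that(1) unfolding n0_def by linarith
      from C3(2)[OF this that(2) _ _ that(3) v, of 1] show ?thesis by (simp add: S_def)
    qed
    have unif: "\<bar>avg \<beta> 0 s' x v - avg \<beta> 0 s x v\<bar> \<le> M * s' powr q"
      if "mi_order \<beta> \<le> k" "x \<in> \<Omega>" "0 < s" "s \<le> s'" "s' \<le> 1" for \<beta> x s s'
      using stable[OF that(1) v that(2), of 1 "C3 * S" s s'] that J1 C3(1) S
      by (simp add: n0_def M_def S_def)
    define \<sigma> where "\<sigma> n = inverse (real (Suc n))" for n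
    have \<sigma>: "0 < \<sigma> n" "\<sigma> n \<le> 1" for n by (auto simp: \<sigma>_def field_simps)
    have \<sigma>_mono: "\<sigma> n' \<le> \<sigma> n" if "n \<le> n'" for n n'
      unfolding \<sigma>_def using that by (intro le_imp_inverse_le) auto
    have \<sigma>0: "\<sigma> \<longlonglongrightarrow> 0" unfolding \<sigma>_def by (rule LIMSEQ_inverse_real_of_nat)
    have \<sigma>q: "(\<lambda>n. \<sigma> n powr q) \<longlonglongrightarrow> 0" unfolding \<sigma>_def by (rule inverse_Suc_powr_tendsto_0[OF q])
    define G where "G \<beta> x = lim (\<lambda>n. avg \<beta> 0 (\<sigma> n) x v)" for \<beta> x
    have G_lim: "(\<lambda>n. avg \<beta> 0 (\<sigma> n) x v) \<longlonglongrightarrow> G \<beta> x" if \<beta>: "mi_order \<beta> \<le> k" and x: "x \<in> \<Omega>" for \<beta> x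
    proof -
      have "Cauchy (\<lambda>n. avg \<beta> 0 (\<sigma> n) x v)"
      proof (rule CauchyI')
        fix e :: real assume e: "0 < e"
        have "(\<lambda>n. M * \<sigma> n powr q) \<longlonglongrightarrow> 0" using tendsto_mult_right_zero[OF \<sigma>q] .
        then have "\<forall>\<^sub>F n in sequentially. M * \<sigma> n powr q < e" using e by (rule order_tendstoD)
        then obtain n1 where n1: "\<And>n. n \<ge> n1 \<Longrightarrow> M * \<sigma> n powr q < e" by (auto simp: eventually_sequentially)
        show "\<exists>N. \<forall>n\<ge>N. \<forall>n'>n. dist (avg \<beta> 0 (\<sigma> n) x v) (avg \<beta> 0 (\<sigma> n') x v) < e"
        proof (intro exI[of _ n1] allI impI)
          fix n n' assume "n1 \<le> n" "n < n'"
          then have "\<bar>avg \<beta> 0 (\<sigma> n) x v - avg \<beta> 0 (\<sigma> n') x v\<bar> \<le> M * \<sigma> n powr q"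
            using \<sigma> \<sigma>_mono by (intro unif \<beta> x) auto
          also have "\<dots> < e" using n1 \<open>n1 \<le> n\<close> by blast
          finally show "dist (avg \<beta> 0 (\<sigma> n) x v) (avg \<beta> 0 (\<sigma> n') x v) < e" by (simp add: dist_real_def)
        qed
      qed
      then show ?thesis unfolding G_def by (simp add: Cauchy_convergent_iff convergent_LIMSEQ_iff)
    qed
    have G_close: "\<bar>avg \<beta> 0 (\<sigma> n) x v - G \<beta> x\<bar> \<le> M * \<sigma> n powr q" if \<beta>: "mi_order \<beta> \<le> k" and x: "x \<in> \<Omega>" for \<beta> x n
    proof (rule LIMSEQ_le_const2)
      show "(\<lambda>n'. \<bar>avg \<beta> 0 (\<sigma> n) x v - avg \<beta> 0 (\<sigma> n') x v\<bar>) \<longlonglongrightarrow> \<bar>avg \<beta> 0 (\<sigma> n) x v - G \<beta> x\<bar>"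
        by (intro tendsto_intros G_lim \<beta> x)
      show "\<exists>N. \<forall>n'\<ge>N. \<bar>avg \<beta> 0 (\<sigma> n) x v - avg \<beta> 0 (\<sigma> n') x v\<bar> \<le> M * \<sigma> n powr q"
        using \<sigma> \<sigma>_mono by (intro exI[of _ n] allI impI unif \<beta> x) auto
    qed
    have avg_bdd: "\<bar>avg \<beta> 0 (\<sigma> n) x v\<bar> \<le> C3 * S + M" if \<beta>: "mi_order \<beta> \<le> k" and x: "x \<in> \<Omega>" for \<beta> x n
      using unif[OF \<beta> x \<sigma>(1) \<sigma>(2) order_refl, of n] J1[of \<beta> 0 x] \<beta> x kn by simp
    have G_bound: "\<bar>G \<beta> x\<bar> \<le> (K + 1) * (S * h powr (m - real (mi_order \<beta>) - real CARD('d) / 2) +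
         E * h powr (- (real CARD('d) / 2) - real (mi_order \<beta>)))"
      if \<beta>: "mi_order \<beta> \<le> k" and x: "x \<in> \<Omega>" and h: "0 < h" "h \<le> 1" and E: "0 \<le> E"
        and JE: "\<And>\<beta>' \<gamma>'. mi_order \<beta>' < n0 \<Longrightarrow> mi_order \<gamma>' \<le> n0 \<Longrightarrow>
          \<bar>avg \<beta>' \<gamma>' h x v\<bar> \<le> E * h powr (- (real CARD('d) / 2) - real (mi_order \<beta>'))" for \<beta> x h E
    proof -
      define a where "a = S * h powr (m - real (mi_order \<beta>) - real CARD('d) / 2)"
      define b' where "b' = E * h powr (- (real CARD('d) / 2) - real (mi_order \<beta>))"
      have a: "0 \<le> a" "0 \<le> b'" unfolding a_def b'_def using S E by auto
      have small: "\<bar>avg \<beta> 0 s x v\<bar> \<le> (K + 1) * (a + b')" if s: "0 < s" "s \<le> h" for s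
      proof -
        have "\<bar>avg \<beta> 0 h x v - avg \<beta> 0 s x v\<bar> \<le> K * (a + b') * (h / h) powr q"
          using stable[OF \<beta> v x h E _ s(1) s(2) order_refl] JE by (simp add: n0_def a_def b'_def S_def)
        moreover have "\<bar>avg \<beta> 0 h x v\<bar> \<le> b'" unfolding b'_def using \<beta> kn by (intro JE) auto
        ultimately have "\<bar>avg \<beta> 0 s x v\<bar> \<le> K * (a + b') + b'" using h by simp
        also have "\<dots> \<le> (K + 1) * (a + b')" using a by (simp add: algebra_simps)
        finally show ?thesis .
      qed
      have "\<bar>G \<beta> x\<bar> \<le> (K + 1) * (a + b')"
      proof (rule LIMSEQ_le_const2)
        show "(\<lambda>n. \<bar>avg \<beta> 0 (\<sigma> n) x v\<bar>) \<longlonglongrightarrow> \<bar>G \<beta> x\<bar>" by (intro tendsto_intros G_lim \<beta> x)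
        have "\<forall>\<^sub>F n in sequentially. \<sigma> n < h" using \<sigma>0 h(1) by (rule order_tendstoD)
        then show "\<exists>N. \<forall>n\<ge>N. \<bar>avg \<beta> 0 (\<sigma> n) x v\<bar> \<le> (K + 1) * (a + b')"
          unfolding eventually_sequentially using small \<sigma>(1) by (meson less_imp_le)
      qed
      then show ?thesis by (simp only: a_def b'_def)
    qed
    have G_deriv: "(G \<beta> has_derivative (\<lambda>w. \<Sum>i\<in>UNIV. w $ i * G (\<beta> + unit_mi i) x)) (at x within \<Omega>)"
      if \<beta>: "mi_order \<beta> < k" and x: "x \<in> \<Omega>" for \<beta> x
    proof -
      have \<beta>': "mi_order \<beta> \<le> k" "mi_order (\<beta> + unit_mi i) \<le> k" for i using \<beta> by (auto simp: mi_order_add)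
      define t where "t n = d * (M * \<sigma> n powr q + \<sigma> n * (C3 * S + M))" for n
      have t0: "t \<longlonglongrightarrow> 0"
      proof -
        have "t \<longlonglongrightarrow> d * (M * 0 + 0 * (C3 * S + M))"
          unfolding t_def by (intro tendsto_intros \<sigma>q \<sigma>0)
        then show ?thesis by simp
      qed
      have "\<exists>g. \<forall>x\<in>\<Omega>. (\<lambda>n. avg \<beta> 0 (\<sigma> n) x v) \<longlonglongrightarrow> g x \<and>
          (g has_derivative (\<lambda>w. \<Sum>i\<in>UNIV. w $ i * G (\<beta> + unit_mi i) x)) (at x within \<Omega>)"
      proof (rule has_derivative_sequence[where S = \<Omega> and f = "\<lambda>n x. avg \<beta> 0 (\<sigma> n) x v"
            and f' = "\<lambda>n x w. \<Sum>i\<in>UNIV. w $ i * ((1 - \<sigma> n) * avg (\<beta> + unit_mi i) 0 (\<sigma> n) x v)"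
            and g' = "\<lambda>x w. \<Sum>i\<in>UNIV. w $ i * G (\<beta> + unit_mi i) x",
            OF convex _ _ x G_lim[OF \<beta>'(1) x]])
        show "((\<lambda>x. avg \<beta> 0 (\<sigma> n) x v) has_derivative
            (\<lambda>w. \<Sum>i\<in>UNIV. w $ i * ((1 - \<sigma> n) * avg (\<beta> + unit_mi i) 0 (\<sigma> n) x v))) (at x within \<Omega>)"
          if "x \<in> \<Omega>" for n x
          by (rule avg_deriv_base[OF that vi \<sigma>])
        fix e :: real assume e: "0 < e"
        have "\<forall>\<^sub>F n in sequentially. t n < e" using t0 e by (rule order_tendstoD)
        then show "\<forall>\<^sub>F n in sequentially. \<forall>x\<in>\<Omega>. \<forall>w. norm ((\<Sum>i\<in>UNIV. w $ i * ((1 - \<sigma> n) * avg (\<beta> + unit_mi i) 0 (\<sigma> n) x v)) -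
            (\<Sum>i\<in>UNIV. w $ i * G (\<beta> + unit_mi i) x)) \<le> e * norm w"
        proof (rule eventually_mono)
          fix n assume n: "t n < e"
          show "\<forall>x\<in>\<Omega>. \<forall>w. norm ((\<Sum>i\<in>UNIV. w $ i * ((1 - \<sigma> n) * avg (\<beta> + unit_mi i) 0 (\<sigma> n) x v)) -
            (\<Sum>i\<in>UNIV. w $ i * G (\<beta> + unit_mi i) x)) \<le> e * norm w"
          proof (intro ballI allI)
            fix x w assume x: "x \<in> \<Omega>"
            have "\<bar>w $ i * ((1 - \<sigma> n) * avg (\<beta> + unit_mi i) 0 (\<sigma> n) x v - G (\<beta> + unit_mi i) x)\<bar> \<le> norm w * (t n / d)" for i
            proof -
              have "(1 - \<sigma> n) * avg (\<beta> + unit_mi i) 0 (\<sigma> n) x v - G (\<beta> + unit_mi i) x =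
                 (avg (\<beta> + unit_mi i) 0 (\<sigma> n) x v - G (\<beta> + unit_mi i) x) - \<sigma> n * avg (\<beta> + unit_mi i) 0 (\<sigma> n) x v"
                by (simp add: algebra_simps)
              moreover have "\<bar>\<sigma> n * avg (\<beta> + unit_mi i) 0 (\<sigma> n) x v\<bar> \<le> \<sigma> n * (C3 * S + M)"
                unfolding abs_mult using \<sigma>(1)[of n] avg_bdd[OF \<beta>'(2)[of i] x] by (simp add: mult_left_mono)
              ultimately have "\<bar>(1 - \<sigma> n) * avg (\<beta> + unit_mi i) 0 (\<sigma> n) x v - G (\<beta> + unit_mi i) x\<bar> \<le> t n / d"
                using G_close[OF \<beta>'(2)[of i] x, of n] d1 by (simp add: t_def)
              then show ?thesis unfolding abs_mult using component_le_norm_cart[of w i]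
                by (intro mult_mono) auto
            qed
            then have "(\<Sum>i\<in>UNIV. \<bar>w $ i * ((1 - \<sigma> n) * avg (\<beta> + unit_mi i) 0 (\<sigma> n) x v - G (\<beta> + unit_mi i) x)\<bar>) \<le>
                (\<Sum>i\<in>(UNIV::'d set). norm w * (t n / d))" by (intro sum_mono)
            also have "\<dots> = norm w * t n" using d1 by (simp add: d_def)
            also have "\<dots> \<le> e * norm w" using n by (subst mult.commute) (intro mult_right_mono, auto)
            finally have "\<bar>\<Sum>i\<in>UNIV. w $ i * ((1 - \<sigma> n) * avg (\<beta> + unit_mi i) 0 (\<sigma> n) x v - G (\<beta> + unit_mi i) x)\<bar> \<le> e * norm w"
              by (rule order_trans[OF sum_abs])
            then show "norm ((\<Sum>i\<in>UNIV. w $ i * ((1 - \<sigma> n) * avg (\<beta> + unit_mi i) 0 (\<sigma> n) x v)) -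
                (\<Sum>i\<in>UNIV. w $ i * G (\<beta> + unit_mi i) x)) \<le> e * norm w"
              by (simp only: real_norm_def right_diff_distrib sum_subtractf)
          qed
        qed
      qed
      then obtain g where g: "\<And>x. x \<in> \<Omega> \<Longrightarrow> (\<lambda>n. avg \<beta> 0 (\<sigma> n) x v) \<longlonglongrightarrow> g x"
        "\<And>x. x \<in> \<Omega> \<Longrightarrow> (g has_derivative (\<lambda>w. \<Sum>i\<in>UNIV. w $ i * G (\<beta> + unit_mi i) x)) (at x within \<Omega>)" by blast
      have "G \<beta> y = g y" if "y \<in> \<Omega>" for y
        by (rule LIMSEQ_unique[OF G_lim[OF \<beta>'(1) that] g(1)[OF that]])
      then show ?thesis by (rule has_derivative_transform[OF x _ g(2)[OF x]])
    qed
    have G0: "G 0 x = mass * v x" if "x \<in> \<Omega>" for x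
      using LIMSEQ_unique[OF G_lim[of 0 x] avg_limit[OF that vi cont, folded \<sigma>_def]] that by simp
    have it_deriv: "(iter_partial_deriv \<Omega> js v has_derivative (\<lambda>w. (\<Sum>i\<in>UNIV. w $ i * G (list_mi js + unit_mi i) x) / mass)) (at x within \<Omega>)"
      if "length js < k" "x \<in> \<Omega>" "\<And>y. y \<in> \<Omega> \<Longrightarrow> iter_partial_deriv \<Omega> js v y = G (list_mi js) y / mass" for js x
    proof -
      have D: "((\<lambda>y. G (list_mi js) y / mass) has_derivative (\<lambda>w. (\<Sum>i\<in>UNIV. w $ i * G (list_mi js + unit_mi i) x) / mass)) (at x within \<Omega>)"
        using that(1,2) by (intro bounded_linear.has_derivative[OF bounded_linear_divide] G_deriv) auto
      show ?thesis by (rule has_derivative_transform[OF that(2) _ D]) (rule that(3))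
    qed
    have it: "\<forall>x\<in>\<Omega>. iter_partial_deriv \<Omega> js v x = G (list_mi js) x / mass" if "length js \<le> k" for js
      using that
    proof (induction js)
      case Nil
      then show ?case using G0 mass_pos by simp
    next
      case (Cons i js)
      then have l: "length js < k" and IH: "\<And>y. y \<in> \<Omega> \<Longrightarrow> iter_partial_deriv \<Omega> js v y = G (list_mi js) y / mass" by auto
      show ?case
      proof
        fix x assume x: "x \<in> \<Omega>"
        have "iter_partial_deriv \<Omega> (i # js) v x = (\<Sum>j\<in>UNIV. axis i 1 $ j * G (list_mi js + unit_mi j) x) / mass"
          using has_derivative_frechet_within_convex[OF convex interior_nonempty x it_deriv[OF l x IH]]
          by (simp add: partial_deriv_def)
        also have "(\<Sum>j\<in>UNIV. axis i 1 $ j * G (list_mi js + unit_mi j) x) = (\<Sum>j\<in>UNIV. if j = i then G (list_mi js + unit_mi j) x else 0)"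
          by (rule sum.cong) (auto simp: axis_def)
        finally show "iter_partial_deriv \<Omega> (i # js) v x = G (list_mi (i # js)) x / mass" by simp
      qed
    qed
    have val: "\<bar>iter_partial_deriv \<Omega> js v x0\<bar> = \<bar>G (list_mi js) x0\<bar> / mass"
      using it[OF js] x0 mass_pos by simp
    have o: "mi_order (list_mi js) = length js" "mi_order (list_mi js) \<le> k" using js by auto
    have b1: "\<bar>G (list_mi js) x0\<bar> \<le> (K + 1) * (S + C3 * S)"
      using G_bound[OF o(2) x0, of 1 "C3 * S"] J1[OF _ _ x0] C3(1) S by simp
    also have "\<dots> \<le> (K + 1) * (C2 + C3 + 1) * S"
      unfolding mult.assoc using K C2(1) S by (intro mult_left_mono) (auto simp: algebra_simps)
    finally have c1: "\<bar>iter_partial_deriv \<Omega> js v x0\<bar> \<le> C * S"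
      unfolding val C_def using mass_pos by (simp add: divide_right_mono)
    have c2: "\<bar>iter_partial_deriv \<Omega> js v x0\<bar> \<le>
         C * (norm_L2 \<Omega> v * h powr (- (real CARD('d) / 2) - real (length js)) +
              S * h powr (m - real (length js) - real CARD('d) / 2))" if h: "0 < h" "h \<le> 1" for h
    proof -
      have n2: "0 \<le> norm_L2 \<Omega> v" by (simp add: norm_L2_def)
      define a where "a = S * h powr (m - real (length js) - real CARD('d) / 2)"
      define b' where "b' = norm_L2 \<Omega> v * h powr (- (real CARD('d) / 2) - real (length js))"
      have a: "0 \<le> a" "0 \<le> b'" unfolding a_def b'_def using S n2 by auto
      have "\<bar>G (list_mi js) x0\<bar> \<le> (K + 1) * (a + C2 * b')"
        using G_bound[OF o(2) x0 h, of "C2 * norm_L2 \<Omega> v"] C2(2)[of _ _ h x0 v] h x0 sq C2(1) n2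
        by (simp add: o(1) a_def b'_def mult_ac)
      also have "\<dots> \<le> (K + 1) * (C2 + C3 + 1) * (b' + a)"
        unfolding mult.assoc using K C2(1) C3(1) a by (intro mult_left_mono) (auto simp: algebra_simps)
      finally show ?thesis
        unfolding val C_def a_def[symmetric] b'_def[symmetric] using mass_pos by (simp add: divide_right_mono)
    qed
    show "(length js < k \<longrightarrow> iter_partial_deriv \<Omega> js v differentiable (at x0 within \<Omega>)) \<and>
      \<bar>iter_partial_deriv \<Omega> js v x0\<bar> \<le> C * sobolev_norm m \<Omega> v \<and>
      (\<forall>h. 0 < h \<longrightarrow> h \<le> 1 \<longrightarrow> \<bar>iter_partial_deriv \<Omega> js v x0\<bar> \<le>
         C * (norm_L2 \<Omega> v * h powr (- (real CARD('d) / 2) - real (length js)) +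
              sobolev_norm m \<Omega> v * h powr (m - real (length js) - real CARD('d) / 2)))"
      using it_deriv[OF _ x0, of js] it[OF js] c1 c2 unfolding S_def differentiable_def by blast
  qed
qed

end

text \<open>
  Sobolev embedding up to the boundary of a convex body, together with its scaled form. The
  bound by the Sobolev norm alone is stated separately, because \<open>v\<close> enters that norm only through a
  representative of its weak derivative of order zero.
\<close>

lemma sobolev_derivatives:
  fixes \<Omega> :: "(real ^ 'd) set"
  assumes \<Omega>: "convex \<Omega>" "compact \<Omega>" "interior \<Omega> \<noteq> {}" and m: "real CARD('d) / 2 + real k < m"
  obtains C where "0 \<le> C" and "\<And>v js x. v \<in> sobolev_space m \<Omega> \<Longrightarrow> continuous_on \<Omega> v \<Longrightarrow> length js \<le> k \<Longrightarrow> x \<in> \<Omega> \<Longrightarrow>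
      (length js < k \<longrightarrow> iter_partial_deriv \<Omega> js v differentiable (at x within \<Omega>)) \<and>
      \<bar>iter_partial_deriv \<Omega> js v x\<bar> \<le> C * sobolev_norm m \<Omega> v \<and>
      (\<forall>h. 0 < h \<longrightarrow> h \<le> 1 \<longrightarrow> \<bar>iter_partial_deriv \<Omega> js v x\<bar> \<le>
         C * (norm_L2 \<Omega> v * h powr (- (real CARD('d) / 2) - real (length js)) +
              sobolev_norm m \<Omega> v * h powr (m - real (length js) - real CARD('d) / 2)))"
proof -
  obtain c where "c \<in> interior \<Omega>" using \<Omega>(3) by blast
  then obtain r where r: "0 < r" "ball c r \<subseteq> interior \<Omega>"
    using open_interior open_contains_ball by blast
  define \<rho> where "\<rho> = r / (2 * real CARD('d))"
  have \<rho>: "0 < \<rho>" using r by (simp add: \<rho>_def)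
  have box: "cbox (\<chi> i. c $ i - \<rho>) (\<chi> i. c $ i + \<rho>) \<subseteq> interior \<Omega>"
  proof (rule order_trans[OF _ r(2)], rule subsetI)
    fix y assume "y \<in> cbox (\<chi> i. c $ i - \<rho>) (\<chi> i. c $ i + \<rho>)"
    then have y: "c $ i - \<rho> \<le> y $ i" "y $ i \<le> c $ i + \<rho>" for i by (auto simp: mem_box_cart)
    have "\<bar>(c - y) $ i\<bar> \<le> \<rho>" for i using y[of i] by (simp add: abs_le_iff)
    then have "(\<Sum>i\<in>UNIV. \<bar>(c - y) $ i\<bar>) \<le> (\<Sum>i\<in>(UNIV::'d set). \<rho>)" by (intro sum_mono)
    also have "\<dots> = r / 2" by (simp add: \<rho>_def)
    finally have "norm (c - y) \<le> r / 2" using norm_le_l1_cart[of "c - y"] by linarith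
    then show "y \<in> ball c r" using r(1) by (simp add: dist_norm)
  qed
  show ?thesis
  proof (rule smooth_bump_exists[OF \<rho>])
    fix b :: "nat \<Rightarrow> real \<Rightarrow> real"
    assume b: "\<And>n t. (b n has_real_derivative b (Suc n) t) (at t)" "\<And>n t. \<rho> \<le> \<bar>t\<bar> \<Longrightarrow> b n t = 0"
      "\<And>t. 0 \<le> b 0 t" "0 < b 0 0"
    interpret smoothing_domain b \<rho> c \<Omega>
      by unfold_locales (use b \<rho> \<Omega> box in auto)
    show ?thesis by (rule sobolev_derivatives_aux[OF m]) (rule that, assumption, blast)
  qed
qed

section \<open>Kernel ridge regression in a reproducing kernel Hilbert space\<close>

context rkhs
begin

lemma sum_mem:
  assumes "\<And>i. i \<in> A \<Longrightarrow> u i \<in> H"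
  shows "(\<lambda>x. \<Sum>i\<in>A. a i * u i x) \<in> H"
proof (cases "finite A")
  case True
  then show ?thesis using assms
  proof (induction A rule: finite_induct)
    case (insert i A)
    then show ?case using add_mem[OF scale_mem[of "u i" "a i"], of "\<lambda>x. \<Sum>i\<in>A. a i * u i x"] by simp
  qed (simp add: zero_mem)
qed (simp add: zero_mem)

lemma ip_zero_left: "w \<in> H \<Longrightarrow> ip (\<lambda>_. 0) w = 0"
  using ip_scale_left[OF zero_mem, of w 0] by simp

lemma ip_sum_left:
  assumes "finite A" "\<And>i. i \<in> A \<Longrightarrow> u i \<in> H" "w \<in> H"
  shows "ip (\<lambda>x. \<Sum>i\<in>A. a i * u i x) w = (\<Sum>i\<in>A. a i * ip (u i) w)"
  using assms(1,2)
proof (induction A rule: finite_induct)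
  case empty
  then show ?case using ip_zero_left[OF assms(3)] by simp
next
  case (insert i A)
  have "ip (\<lambda>x. a i * u i x + (\<Sum>i\<in>A. a i * u i x)) w = ip (\<lambda>x. a i * u i x) w + ip (\<lambda>x. \<Sum>i\<in>A. a i * u i x) w"
    using insert.prems by (intro ip_add_left scale_mem sum_mem assms(3)) auto
  then show ?case using insert ip_scale_left[of "u i" w "a i"] assms(3) by simp
qed

lemma ip_square_add:
  assumes "u \<in> H" "w \<in> H"
  shows "ip (\<lambda>x. u x + w x) (\<lambda>x. u x + w x) = ip u u + 2 * ip u w + ip w w"
proof -
  have s: "(\<lambda>x. u x + w x) \<in> H" by (rule add_mem[OF assms])
  have "ip (\<lambda>x. u x + w x) (\<lambda>x. u x + w x) = ip u (\<lambda>x. u x + w x) + ip w (\<lambda>x. u x + w x)"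
    by (rule ip_add_left[OF assms s])
  also have "ip u (\<lambda>x. u x + w x) = ip (\<lambda>x. u x + w x) u" by (rule ip_commute[OF assms(1) s])
  also have "\<dots> = ip u u + ip w u" by (rule ip_add_left[OF assms assms(1)])
  also have "ip w (\<lambda>x. u x + w x) = ip (\<lambda>x. u x + w x) w" by (rule ip_commute[OF assms(2) s])
  also have "\<dots> = ip u w + ip w w" by (rule ip_add_left[OF assms assms(2)])
  also have "ip w u = ip u w" by (rule ip_commute[OF assms(2,1)])
  finally show ?thesis by simp
qed

lemma ip_norm_power2: "v \<in> H \<Longrightarrow> (ip_norm ip v)\<^sup>2 = ip v v"
  by (simp add: ip_norm_def ip_nonneg)

lemma ip_norm_nonneg: "v \<in> H \<Longrightarrow> 0 \<le> ip_norm ip v"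
  by (simp add: ip_norm_def ip_nonneg)

text \<open>
  Induction on the number of design points: adding a point is a rank-one perturbation of the
  quadratic form, and the new representer is given by the Sherman-Morrison formula. The denominator is
  positive because the form is.
\<close>

lemma ridge_representer:
  fixes n :: nat and x :: "nat \<Rightarrow> 'a"
  assumes \<mu>: "0 < \<mu>" and x: "\<And>i. i \<in> {1..n} \<Longrightarrow> x i \<in> \<Omega>" and z: "z \<in> \<Omega>"
  shows "\<exists>r\<in>H. \<forall>w\<in>H. \<mu> * ip r w + (\<Sum>i=1..n. r (x i) * w (x i)) = w z"
  using x z
proof (induction n arbitrary: z)
  case 0
  have "\<mu> * ip (\<lambda>t. 1 / \<mu> * K z t) w = w z" if w: "w \<in> H" for w
    using \<mu> ip_scale_left[OF kernel_mem[OF 0(2)] w, of "1 / \<mu>"] ip_commute[OF kernel_mem[OF 0(2)] w]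
      reproducing[OF w 0(2)] by simp
  then show ?case using scale_mem[OF kernel_mem[OF 0(2)], of "1 / \<mu>"] by (intro bexI[of _ "\<lambda>t. 1 / \<mu> * K z t"]) simp_all
next
  case (Suc n)
  define x' where "x' = x (Suc n)"
  have x': "x' \<in> \<Omega>" unfolding x'_def by (rule Suc.prems) simp
  have xs: "\<And>i. i \<in> {1..n} \<Longrightarrow> x i \<in> \<Omega>" by (rule Suc.prems) simp
  obtain r where r: "r \<in> H" "\<And>w. w \<in> H \<Longrightarrow> \<mu> * ip r w + (\<Sum>i=1..n. r (x i) * w (x i)) = w z"
    using Suc.IH[OF xs Suc.prems(2)] by blast
  obtain p where p: "p \<in> H" "\<And>w. w \<in> H \<Longrightarrow> \<mu> * ip p w + (\<Sum>i=1..n. p (x i) * w (x i)) = w x'"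
    using Suc.IH[OF xs x'] by blast
  have "0 \<le> \<mu> * ip p p + (\<Sum>i=1..n. p (x i) * p (x i))"
    using \<mu> p(1) ip_nonneg by (intro add_nonneg_nonneg sum_nonneg) auto
  then have p0: "0 \<le> p x'" using p(2)[OF p(1)] by simp
  \<comment> \<open>Chosen such that \<open>r - c p\<close> takes the value \<open>c\<close> at the new point.\<close>
  define c where "c = r x' / (1 + p x')"
  define r' where "r' t = r t + (- c) * p t" for t
  have r': "r' \<in> H" unfolding r'_def by (intro add_mem r(1) scale_mem p(1))
  have "\<mu> * ip r' w + (\<Sum>i=1..Suc n. r' (x i) * w (x i)) = w z" if w: "w \<in> H" for w
  proof -
    have ip_r': "ip r' w = ip r w + (- c) * ip p w"
      unfolding r'_def using ip_add_left[OF r(1) scale_mem[OF p(1), of "- c"] w] ip_scale_left[OF p(1) w, of "- c"] by simp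
    have "\<mu> * ip r' w + (\<Sum>i=1..n. r' (x i) * w (x i)) =
        (\<mu> * ip r w + (\<Sum>i=1..n. r (x i) * w (x i))) + (- c) * (\<mu> * ip p w + (\<Sum>i=1..n. p (x i) * w (x i)))"
    proof -
      have s: "(\<Sum>i=1..n. r' (x i) * w (x i)) = (\<Sum>i=1..n. r (x i) * w (x i)) - c * (\<Sum>i=1..n. p (x i) * w (x i))"
        by (simp add: r'_def left_diff_distrib sum_subtractf sum_distrib_left mult.assoc)
      show ?thesis unfolding ip_r' s by (simp only: algebra_simps)
    qed
    also have "\<dots> = w z - c * w x'" unfolding r(2)[OF w] p(2)[OF w] by simp
    finally have *: "\<mu> * ip r' w + (\<Sum>i=1..n. r' (x i) * w (x i)) = w z - c * w x'" .
    have "r x' = c * (1 + p x')" using p0 by (simp add: c_def)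
    then have "r' x' = c" by (simp add: r'_def algebra_simps)
    then show ?thesis using * by (simp add: x'_def)
  qed
  then show ?case using r' by blast
qed

text \<open>
  Around a critical point the quadratic objective has no linear term.
\<close>

lemma krr_objective_add:
  assumes n: "n \<ge> 1" and u: "u \<in> H" and w: "w \<in> H"
    and crit: "real n * l * ip u w + (\<Sum>i=1..n. u (x i) * w (x i)) = (\<Sum>i=1..n. y i * w (x i))"
  shows "krr_objective ip n l x y (\<lambda>t. u t + w t) =
    krr_objective ip n l x y u + (1 / real n * (\<Sum>i=1..n. (w (x i))\<^sup>2) + l * ip w w)"
proof -
  have "(\<Sum>i=1..n. (y i - (u (x i) + w (x i)))\<^sup>2) =
    (\<Sum>i=1..n. (y i - u (x i))\<^sup>2) - 2 * ((\<Sum>i=1..n. y i * w (x i)) - (\<Sum>i=1..n. u (x i) * w (x i))) + (\<Sum>i=1..n. (w (x i))\<^sup>2)"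
    by (simp add: power2_eq_square algebra_simps sum.distrib sum_subtractf sum_distrib_left)
  also have "(\<Sum>i=1..n. y i * w (x i)) - (\<Sum>i=1..n. u (x i) * w (x i)) = real n * l * ip u w"
    using crit by simp
  finally have s: "(\<Sum>i=1..n. (y i - (u (x i) + w (x i)))\<^sup>2) =
    (\<Sum>i=1..n. (y i - u (x i))\<^sup>2) - 2 * (real n * l * ip u w) + (\<Sum>i=1..n. (w (x i))\<^sup>2)" .
  show ?thesis
    unfolding krr_objective_def s ip_norm_power2[OF u] ip_norm_power2[OF add_mem[OF u w]] ip_square_add[OF u w]
    using n by (simp add: field_simps)
qed

text \<open>
  The representers of the design points are the weights of the estimator; strict convexity makes the
  critical point the only minimiser, so the choice operator in the estimator is determined.
\<close>

lemma krr_linear: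
  assumes n: "n \<ge> 1" and l: "0 < l" and x: "\<And>i. i \<in> {1..n} \<Longrightarrow> x i \<in> \<Omega>"
  shows "\<exists>W. (\<forall>i\<in>{1..n}. W i \<in> H) \<and> (\<forall>y. krr H ip n l x y = (\<lambda>t. \<Sum>i=1..n. y i * W i t)) \<and>
    (\<forall>y. \<forall>v\<in>H. krr_objective ip n l x y (krr H ip n l x y) \<le> krr_objective ip n l x y v)"
proof -
  have \<mu>: "0 < real n * l" using n l by simp
  have "\<exists>r\<in>H. \<forall>w\<in>H. real n * l * ip r w + (\<Sum>j=1..n. r (x j) * w (x j)) = w (x i)" if "i \<in> {1..n}" for i
    by (rule ridge_representer) (use \<mu> x that in auto)
  then obtain W where W: "\<And>i. i \<in> {1..n} \<Longrightarrow> W i \<in> H"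
    "\<And>i w. i \<in> {1..n} \<Longrightarrow> w \<in> H \<Longrightarrow> real n * l * ip (W i) w + (\<Sum>j=1..n. W i (x j) * w (x j)) = w (x i)"
    by metis
  define u where "u y t = (\<Sum>i=1..n. y i * W i t)" for y t
  have u: "u y \<in> H" for y unfolding u_def by (rule sum_mem[OF W(1)])
  have crit: "real n * l * ip (u y) w + (\<Sum>i=1..n. u y (x i) * w (x i)) = (\<Sum>i=1..n. y i * w (x i))"
    if w: "w \<in> H" for y w
  proof -
    have "ip (u y) w = (\<Sum>i=1..n. y i * ip (W i) w)"
      unfolding u_def by (rule ip_sum_left[OF _ W(1) w]) auto
    moreover have "(\<Sum>j=1..n. u y (x j) * w (x j)) = (\<Sum>i=1..n. y i * (\<Sum>j=1..n. W i (x j) * w (x j)))"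
      unfolding u_def sum_distrib_left sum_distrib_right by (subst sum.swap) (simp add: mult.assoc)
    ultimately have "real n * l * ip (u y) w + (\<Sum>i=1..n. u y (x i) * w (x i)) =
        (\<Sum>i=1..n. y i * (real n * l * ip (W i) w + (\<Sum>j=1..n. W i (x j) * w (x j))))"
      by (simp add: distrib_left sum.distrib sum_distrib_left mult_ac)
    also have "\<dots> = (\<Sum>i=1..n. y i * w (x i))" by (intro sum.cong refl) (simp only: W(2)[OF _ w])
    finally show ?thesis .
  qed
  have obj: "krr_objective ip n l x y v = krr_objective ip n l x y (u y) +
      (1 / real n * (\<Sum>i=1..n. (v (x i) - u y (x i))\<^sup>2) + l * ip (\<lambda>t. v t + (- 1) * u y t) (\<lambda>t. v t + (- 1) * u y t))"
    if v: "v \<in> H" for y v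
  proof -
    have w: "(\<lambda>t. v t + (- 1) * u y t) \<in> H" by (intro add_mem v scale_mem u)
    show ?thesis using krr_objective_add[OF n u w crit[OF w], of y] by simp
  qed
  have nn: "0 \<le> 1 / real n * (\<Sum>i=1..n. (v (x i) - u y (x i))\<^sup>2)" for v y
    by (intro mult_nonneg_nonneg sum_nonneg) auto
  have ipn: "0 \<le> ip (\<lambda>t. v t + (- 1) * u y t) (\<lambda>t. v t + (- 1) * u y t)" if "v \<in> H" for v y
    by (intro ip_nonneg add_mem that scale_mem u)
  have min: "krr_objective ip n l x y (u y) \<le> krr_objective ip n l x y v" if "v \<in> H" for y v
    using obj[OF that, of y] nn[of v y] mult_nonneg_nonneg[OF less_imp_le[OF l] ipn[OF that, of y]] by linarith
  have eq: "krr H ip n l x y = u y" for y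
    unfolding krr_def arg_min_def
  proof (rule some_equality)
    show "is_arg_min (krr_objective ip n l x y) (\<lambda>v. v \<in> H) (u y)"
      using min[of _ y] u by (auto simp: is_arg_min_def not_less)
    fix v assume "is_arg_min (krr_objective ip n l x y) (\<lambda>v. v \<in> H) v"
    then have v: "v \<in> H" and "krr_objective ip n l x y v \<le> krr_objective ip n l x y (u y)"
      using u by (auto simp: is_arg_min_def not_less)
    then have "l * ip (\<lambda>t. v t + (- 1) * u y t) (\<lambda>t. v t + (- 1) * u y t) \<le> 0"
      using obj[OF v, of y] nn[of v y] by linarith
    then have "ip (\<lambda>t. v t + (- 1) * u y t) (\<lambda>t. v t + (- 1) * u y t) = 0"
      using l ipn[OF v, of y] by (simp add: mult_le_0_iff)
    then have "(\<lambda>t. v t + (- 1) * u y t) = (\<lambda>_. 0)"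
      by (intro ip_eq_0 add_mem v scale_mem u)
    then show "v = u y" by (auto simp: fun_eq_iff dest: spec)
  qed
  show ?thesis
    using W(1) min unfolding eq by (intro exI[of _ W]) (simp add: u_def[abs_def])
qed

lemma krr_noise_free_error:
  assumes f: "f \<in> H" and g: "g \<in> H" and l: "0 < l"
    and min: "krr_objective ip n l x (\<lambda>i. f (x i)) g \<le> krr_objective ip n l x (\<lambda>i. f (x i)) f"
  shows "empirical_norm n x (\<lambda>t. g t - f t) \<le> sqrt l * ip_norm ip f"
    and "ip_norm ip (\<lambda>t. g t - f t) \<le> 2 * ip_norm ip f"
proof -
  define a where "a = 1 / real n * (\<Sum>i=1..n. (g (x i) - f (x i))\<^sup>2)"
  have a: "0 \<le> a" unfolding a_def by (intro mult_nonneg_nonneg sum_nonneg) auto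
  have *: "a + l * ip g g \<le> l * ip f f"
    using min unfolding krr_objective_def ip_norm_power2[OF f] ip_norm_power2[OF g]
    by (simp add: a_def power2_commute)
  then have "a \<le> l * ip f f" using mult_nonneg_nonneg[OF less_imp_le[OF l] ip_nonneg[OF g]] by linarith
  then have "sqrt a \<le> sqrt (l * ip f f)" by simp
  then show "empirical_norm n x (\<lambda>t. g t - f t) \<le> sqrt l * ip_norm ip f"
    by (simp add: empirical_norm_def a_def ip_norm_def real_sqrt_mult)
  have gf: "ip g g \<le> ip f f" using * a l by (smt (verit) mult_less_cancel_left_pos)
  have mf: "(\<lambda>t. (- 1) * f t) \<in> H" by (rule scale_mem[OF f])
  have i1: "ip g (\<lambda>t. (- 1) * f t) = - ip g f"
    using ip_commute[OF g mf] ip_scale_left[OF f g, of "- 1"] ip_commute[OF f g] by simp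
  have i2: "ip (\<lambda>t. (- 1) * f t) (\<lambda>t. (- 1) * f t) = ip f f"
    using ip_scale_left[OF f mf, of "- 1"] ip_commute[OF f mf] ip_scale_left[OF f f, of "- 1"] by simp
  have "0 \<le> ip (\<lambda>t. g t + f t) (\<lambda>t. g t + f t)" by (rule ip_nonneg[OF add_mem[OF g f]])
  then have "- 2 * ip g f \<le> ip g g + ip f f" by (simp add: ip_square_add[OF g f])
  then have "ip (\<lambda>t. g t + (- 1) * f t) (\<lambda>t. g t + (- 1) * f t) \<le> 4 * ip f f"
    using ip_square_add[OF g mf] i1 i2 gf by simp
  then have "sqrt (ip (\<lambda>t. g t - f t) (\<lambda>t. g t - f t)) \<le> sqrt (4 * ip f f)" by simp
  then show "ip_norm ip (\<lambda>t. g t - f t) \<le> 2 * ip_norm ip f"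
    by (simp add: ip_norm_def real_sqrt_mult)
qed

end

section \<open>The bias of derivatives\<close>

text \<open>
  For \<open>l \<le> 1\<close> the scale \<open>h = l powr (1 / (2 * m))\<close> balances the two terms. For \<open>l > 1\<close> that scale is not
  available, but then \<open>l\<close> to a positive power is at least \<open>1\<close> and the plain bound is enough.
\<close>

lemma smoothing_scale_bound:
  fixes l d k m F D L a b :: real
  assumes l: "0 < l" and m: "d / 2 + k < m" "0 < m" and F: "0 \<le> F" and L: "0 \<le> L" and C: "0 \<le> C"
    and a: "a \<le> L * sqrt l * F" and b: "b \<le> 2 * F"
    and D1: "D \<le> C * b"
    and D2: "\<And>h. 0 < h \<Longrightarrow> h \<le> 1 \<Longrightarrow> D \<le> C * (a * h powr (- (d / 2) - k) + b * h powr (m - k - d / 2))"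
  shows "D \<le> C * (L + 2) * (l powr (1 / 2 - (d + 2 * k) / (4 * m)) * F)"
proof -
  define \<theta> where "\<theta> = 1 / 2 - (d + 2 * k) / (4 * m)"
  have \<theta>: "0 < \<theta>" unfolding \<theta>_def using m by (simp add: field_simps)
  show ?thesis
  proof (cases "l \<le> 1")
    case True
    define h where "h = l powr (1 / (2 * m))"
    have h: "0 < h" "h \<le> 1" using l True m unfolding h_def by (auto intro: powr_le1)
    have e1: "sqrt l * h powr (- (d / 2) - k) = l powr \<theta>"
      unfolding h_def powr_powr powr_half_sqrt[OF less_imp_le[OF l], symmetric] powr_add[symmetric] \<theta>_def
      using m by (intro arg_cong[where f = "\<lambda>t. l powr t"]) (simp add: field_simps)
    have e2: "h powr (m - k - d / 2) = l powr \<theta>"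
      unfolding h_def powr_powr \<theta>_def
      using m by (intro arg_cong[where f = "\<lambda>t. l powr t"]) (simp add: field_simps)
    have "D \<le> C * (a * h powr (- (d / 2) - k) + b * h powr (m - k - d / 2))" by (rule D2[OF h])
    also have "\<dots> \<le> C * ((L * sqrt l * F) * h powr (- (d / 2) - k) + (2 * F) * h powr (m - k - d / 2))"
      by (intro mult_left_mono add_mono mult_right_mono a b C) auto
    also have "\<dots> = C * (L * F * (sqrt l * h powr (- (d / 2) - k)) + 2 * F * h powr (m - k - d / 2))"
      by (simp only: mult_ac)
    also have "\<dots> = C * (L + 2) * (l powr \<theta> * F)" unfolding e1 e2 by (simp add: algebra_simps)
    finally show ?thesis by (simp only: \<theta>_def)
  next
    case False
    then have "1 \<le> l powr \<theta>" using \<theta> by (intro ge_one_powr_ge_zero) auto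
    have "D \<le> C * b" by (rule D1)
    also have "\<dots> \<le> C * (2 * F)" by (rule mult_left_mono[OF b C])
    also have "\<dots> \<le> C * ((L + 2) * (l powr \<theta> * F))"
    proof (rule mult_left_mono[OF mult_mono C])
      show "F \<le> l powr \<theta> * F" using \<open>1 \<le> l powr \<theta>\<close> F by (simp add: mult_right_mono[of 1 "l powr \<theta>" F, simplified])
    qed (use L F in auto)
    finally show ?thesis by (simp only: \<theta>_def mult.assoc)
  qed
qed

theorem corollary4:
  fixes \<Omega> :: "(real ^ 'd) set"
    and K :: "real ^ 'd \<Rightarrow> real ^ 'd \<Rightarrow> real"
    and H :: "(real ^ 'd \<Rightarrow> real) set"
    and ip :: "(real ^ 'd \<Rightarrow> real) \<Rightarrow> (real ^ 'd \<Rightarrow> real) \<Rightarrow> real"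
    and m \<sigma> :: real
    and \<alpha> :: "nat ^ 'd"
    and M :: "'w measure"
    and X :: "nat \<Rightarrow> nat \<Rightarrow> 'w \<Rightarrow> real ^ 'd"
    and e :: "nat \<Rightarrow> 'w \<Rightarrow> real"
    and f :: "nat \<Rightarrow> real ^ 'd \<Rightarrow> real"
    and lam :: "nat \<Rightarrow> real"
  assumes "convex \<Omega>" and "compact \<Omega>" and "interior \<Omega> \<noteq> {}"
    and "rkhs \<Omega> K H ip"
    and "is_sobolev_space m \<Omega> H ip"
    and "m > real CARD('d) / 2 + real (mi_order \<alpha>)"
    and "prob_space M"
    and "iid_errors M \<sigma> e"
    and "is_design M \<Omega> X"
    and "design_indep_errors M X e"
    and "norm_comparison M \<Omega> H ip m X"
    and "\<And>n. f n \<in> H"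
    and "\<And>n. lam n > 0"
    and "(\<lambda>n. real n powr (- 2 * m / real CARD('d))) \<in> O(lam)"
  shows "bigo_in_prob M
           (\<lambda>n \<omega>. SUP x\<in>\<Omega>. ereal \<bar>errors_mean_krr_deriv M \<Omega> H ip \<alpha> n (lam n) (f n) (X n) e \<omega> x
                                  - multi_deriv \<Omega> \<alpha> (f n) x\<bar>)
           (\<lambda>n. lam n powr (1 / 2 - (real CARD('d) + 2 * real (mi_order \<alpha>)) / (4 * m))
                  * ip_norm ip (f n))"
proof -
  interpret rkhs \<Omega> K H ip by (rule assms(4))
  interpret prob_space M by (rule assms(7))
  define d where "d = real CARD('d)"
  define k where "k = mi_order \<alpha>"
  have m: "d / 2 + real k < m" using assms(6) by (simp add: d_def k_def)
  have d0: "0 < d" by (simp add: d_def)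
  have m0: "0 < m" using m d0 by (meson add_nonneg_nonneg divide_nonneg_nonneg le_less_trans less_imp_le of_nat_0_le_iff zero_le_numeral)
  obtain js where js: "list_mi js = \<alpha>"
    "\<And>S f. multi_deriv S \<alpha> f = iter_partial_deriv S js (f :: real ^ 'd \<Rightarrow> real)"
    using multi_deriv_eq_iter[of \<alpha>] by blast
  have len: "length js = k" using mi_order_list_mi[of js] by (simp add: js(1) k_def)
  obtain C0 where C0: "0 \<le> C0" and D0: "\<And>v js x. v \<in> sobolev_space m \<Omega> \<Longrightarrow> continuous_on \<Omega> v \<Longrightarrow> length js \<le> k \<Longrightarrow> x \<in> \<Omega> \<Longrightarrow>
      (length js < k \<longrightarrow> iter_partial_deriv \<Omega> js v differentiable (at x within \<Omega>)) \<and>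
      \<bar>iter_partial_deriv \<Omega> js v x\<bar> \<le> C0 * sobolev_norm m \<Omega> v \<and>
      (\<forall>h. 0 < h \<longrightarrow> h \<le> 1 \<longrightarrow> \<bar>iter_partial_deriv \<Omega> js v x\<bar> \<le>
         C0 * (norm_L2 \<Omega> v * h powr (- (real CARD('d) / 2) - real (length js)) +
              sobolev_norm m \<Omega> v * h powr (m - real (length js) - real CARD('d) / 2)))"
    by (rule sobolev_derivatives[OF assms(1-3) m[unfolded d_def]]) blast
  obtain c1 where c1: "0 < c1" "\<And>v. v \<in> H \<Longrightarrow> c1 * sobolev_norm m \<Omega> v \<le> ip_norm ip v"
    using assms(5) unfolding is_sobolev_space_def by blast
  have H: "v \<in> sobolev_space m \<Omega>" "continuous_on \<Omega> v" if "v \<in> H" for v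
    using assms(5) that unfolding is_sobolev_space_def by auto
  have diff: "iter_partial_deriv \<Omega> js' v differentiable (at x within \<Omega>)"
    if "v \<in> H" "length js' < length js" "x \<in> \<Omega>" for v js' x
    using D0[OF H[OF that(1)], of js' x] that by (simp add: len)
  define C where "C = C0 * (1 + 1 / c1)"
  have C: "0 \<le> C" using C0 c1(1) by (simp add: C_def)
  have sn: "sobolev_norm m \<Omega> v \<le> (1 + 1 / c1) * ip_norm ip v" if "v \<in> H" for v
  proof -
    have "sobolev_norm m \<Omega> v \<le> ip_norm ip v / c1"
      using c1(2)[OF that] c1(1) by (simp add: pos_le_divide_eq mult.commute)
    also have "\<dots> \<le> (1 + 1 / c1) * ip_norm ip v"
      using ip_norm_nonneg[OF that] by (simp add: distrib_right)
    finally show ?thesis .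
  qed
  have Db: "\<bar>iter_partial_deriv \<Omega> js v x\<bar> \<le> C * ip_norm ip v" if v: "v \<in> H" and x: "x \<in> \<Omega>" for v x
  proof -
    have "\<bar>iter_partial_deriv \<Omega> js v x\<bar> \<le> C0 * sobolev_norm m \<Omega> v" using D0[OF H[OF v], of js x] x by (simp add: len)
    also have "\<dots> \<le> C0 * ((1 + 1 / c1) * ip_norm ip v)" by (rule mult_left_mono[OF sn[OF v] C0])
    finally show ?thesis by (simp add: C_def mult.assoc)
  qed
  have Dh: "\<bar>iter_partial_deriv \<Omega> js v x\<bar> \<le> C * (norm_L2 \<Omega> v * h powr (- (d / 2) - real k) + ip_norm ip v * h powr (m - real k - d / 2))"
    if v: "v \<in> H" and x: "x \<in> \<Omega>" and h: "0 < h" "h \<le> 1" for v x h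
  proof -
    have n2: "0 \<le> norm_L2 \<Omega> v" by (simp add: norm_L2_def)
    have "\<bar>iter_partial_deriv \<Omega> js v x\<bar> \<le> C0 * (norm_L2 \<Omega> v * h powr (- (d / 2) - real k) + sobolev_norm m \<Omega> v * h powr (m - real k - d / 2))"
      using D0[OF H[OF v], of js x] x h by (simp add: len d_def)
    also have "\<dots> \<le> C0 * ((1 + 1 / c1) * norm_L2 \<Omega> v * h powr (- (d / 2) - real k) + (1 + 1 / c1) * ip_norm ip v * h powr (m - real k - d / 2))"
      using c1(1) n2 sn[OF v] C0 by (intro mult_left_mono add_mono mult_right_mono) (auto simp: algebra_simps)
    finally show ?thesis by (simp add: C_def algebra_simps)
  qed
  have e_int: "integrable M (e i)" "(LINT \<omega>|M. e i \<omega>) = 0" if "i \<ge> 1" for i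
  proof -
    have "random_variable borel (e i)"
      using assms(8) that unfolding iid_errors_def indep_vars_def by auto
    moreover have "integrable M (\<lambda>\<omega>. (e i \<omega>)\<^sup>2)" using assms(8) that unfolding iid_errors_def by blast
    ultimately have "integrable M (\<lambda>\<omega>. 1 * e i \<omega>)" by (intro integral_Cauchy_Schwarz(1)) auto
    then show "integrable M (e i)" by simp
    show "(LINT \<omega>|M. e i \<omega>) = 0" using assms(8) that unfolding iid_errors_def by blast
  qed
  have bias: "\<exists>g\<in>H. empirical_norm n (\<lambda>i. X n i \<omega>) g \<le> sqrt (lam n) * ip_norm ip (f n) \<and>
      ip_norm ip g \<le> 2 * ip_norm ip (f n) \<and>
      (\<forall>x\<in>\<Omega>. errors_mean_krr_deriv M \<Omega> H ip \<alpha> n (lam n) (f n) (X n) e \<omega> x - multi_deriv \<Omega> \<alpha> (f n) x =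
         iter_partial_deriv \<Omega> js g x)"
    if n: "n \<ge> 1" and \<omega>: "\<omega> \<in> space M" for n \<omega>
  proof -
    define x where "x i = X n i \<omega>" for i
    have x: "x i \<in> \<Omega>" if "i \<in> {1..n}" for i
      using assms(9) that \<omega> by (auto simp: is_design_def x_def)
    obtain W where W: "\<And>i. i \<in> {1..n} \<Longrightarrow> W i \<in> H"
      and krr: "\<And>y. krr H ip n (lam n) x y = (\<lambda>t. \<Sum>i=1..n. y i * W i t)"
      and min: "\<And>y v. v \<in> H \<Longrightarrow> krr_objective ip n (lam n) x y (krr H ip n (lam n) x y) \<le> krr_objective ip n (lam n) x y v"
      using krr_linear[where x = x and n = n and l = "lam n", OF n assms(13) x] by blast
    define u where "u = krr H ip n (lam n) x (\<lambda>i. f n (x i))"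
    have uH: "u \<in> H" unfolding u_def krr by (rule sum_mem[OF W])
    have fH: "f n \<in> H" by (rule assms(12))
    have Dsum: "iter_partial_deriv \<Omega> js (\<lambda>t. \<Sum>i=1..n. y i * W i t) z = (\<Sum>i=1..n. y i * iter_partial_deriv \<Omega> js (W i) z)"
      if "z \<in> \<Omega>" for y z
      using W that by (intro iter_partial_deriv_sum assms(1,3) diff) auto
    have mean: "errors_mean_krr_deriv M \<Omega> H ip \<alpha> n (lam n) (f n) (X n) e \<omega> z = iter_partial_deriv \<Omega> js u z"
      if z: "z \<in> \<Omega>" for z
    proof -
      have "errors_mean_krr_deriv M \<Omega> H ip \<alpha> n (lam n) (f n) (X n) e \<omega> z =
          (LINT \<omega>'|M. (\<Sum>i=1..n. (f n (x i) + e i \<omega>') * iter_partial_deriv \<Omega> js (W i) z))"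
        unfolding errors_mean_krr_deriv_def js(2) x_def[symmetric] krr Dsum[OF z] ..
      also have "\<dots> = (\<Sum>i=1..n. LINT \<omega>'|M. (f n (x i) + e i \<omega>') * iter_partial_deriv \<Omega> js (W i) z)"
        using e_int(1) by (intro Bochner_Integration.integral_sum integrable_mult_left Bochner_Integration.integrable_add) auto
      also have "\<dots> = (\<Sum>i=1..n. f n (x i) * iter_partial_deriv \<Omega> js (W i) z)"
      proof (rule sum.cong[OF refl])
        fix i assume "i \<in> {1..n}"
        then have "i \<ge> 1" by simp
        then show "(LINT \<omega>'|M. (f n (x i) + e i \<omega>') * iter_partial_deriv \<Omega> js (W i) z) = f n (x i) * iter_partial_deriv \<Omega> js (W i) z"
          using e_int[of i] by (simp add: prob_space)
      qed
      also have "\<dots> = iter_partial_deriv \<Omega> js u z" unfolding u_def krr Dsum[OF z] ..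
      finally show ?thesis .
    qed
    define g where "g t = u t - f n t" for t
    \<comment> \<open>Written as a sum over two indices, so that linearity for finite sums applies.\<close>
    have g_eq: "g = (\<lambda>t. \<Sum>b\<in>{True, False}. (if b then 1 else - 1) * (if b then u else f n) t)"
      by (simp add: g_def fun_eq_iff)
    have gH: "g \<in> H" unfolding g_eq using uH fH by (intro sum_mem) auto
    have "iter_partial_deriv \<Omega> js g z = iter_partial_deriv \<Omega> js u z - iter_partial_deriv \<Omega> js (f n) z"
      if "z \<in> \<Omega>" for z
    proof -
      have "iter_partial_deriv \<Omega> js g z = (\<Sum>b\<in>{True, False}. (if b then 1 else - 1) * iter_partial_deriv \<Omega> js (if b then u else f n) z)"
        unfolding g_eq using uH fH that by (intro iter_partial_deriv_sum assms(1,3) diff) auto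
      then show ?thesis by simp
    qed
    moreover have "empirical_norm n x g \<le> sqrt (lam n) * ip_norm ip (f n)" "ip_norm ip g \<le> 2 * ip_norm ip (f n)"
      unfolding g_def using krr_noise_free_error[OF fH uH assms(13), of n n x] min[OF fH, of "\<lambda>i. f n (x i)"] by (simp_all add: u_def)
    ultimately show ?thesis using gH mean by (intro bexI[of _ g]) (auto simp: x_def[abs_def] js(2))
  qed
  define Ev where "Ev C1 C2 n = {\<omega> \<in> space M. \<forall>v\<in>H.
            norm_L2 \<Omega> v \<le> max (C1 * empirical_norm n (\<lambda>i. X n i \<omega>) v)
                                (C2 * real n powr (- m / real CARD('d)) * ip_norm ip v) \<and>
            empirical_norm n (\<lambda>i. X n i \<omega>) v \<le>
                            max (C1 * norm_L2 \<Omega> v)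
                                (C2 * real n powr (- m / real CARD('d)) * ip_norm ip v)}" for C1 C2 n
  let ?Z = "\<lambda>n \<omega>. SUP x\<in>\<Omega>. ereal \<bar>errors_mean_krr_deriv M \<Omega> H ip \<alpha> n (lam n) (f n) (X n) e \<omega> x
                                  - multi_deriv \<Omega> \<alpha> (f n) x\<bar>"
  let ?r = "\<lambda>n. lam n powr (1 / 2 - (real CARD('d) + 2 * real (mi_order \<alpha>)) / (4 * m)) * ip_norm ip (f n)"
  show ?thesis
    unfolding bigo_in_prob_def
  proof (intro allI impI)
    fix \<epsilon> :: real assume \<epsilon>: "0 < \<epsilon>"
    obtain C1 C2 where C1: "0 < C1" and C2: "0 < C2"
      and ev: "\<And>n. n \<ge> 1 \<Longrightarrow> measure M (Ev C1 C2 n) \<ge> 1 - \<epsilon>"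
      using assms(11) \<epsilon> unfolding norm_comparison_def Ev_def by meson
    obtain B where B: "0 < B" and lamB: "\<forall>\<^sub>F n in sequentially. norm (real n powr (- 2 * m / real CARD('d))) \<le> B * norm (lam n)"
      using assms(14) by (rule landau_o.bigE)
    define L where "L = C1 + C2 * sqrt B * 2"
    have L: "0 \<le> L" using C1 C2 B by (simp add: L_def)
    show "\<exists>C. \<forall>\<^sub>F n in sequentially. \<exists>A\<in>sets M. 1 - \<epsilon> \<le> measure M A \<and>
        (\<forall>\<omega>\<in>A. \<bar>?Z n \<omega>\<bar> \<le> ereal (C * ?r n))"
    proof (intro exI[of _ "C * (L + 2)"], rule eventually_mono[OF eventually_conj[OF lamB eventually_ge_at_top[of 1]]])
      fix n assume "norm (real n powr (- 2 * m / real CARD('d))) \<le> B * norm (lam n) \<and> 1 \<le> n"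
      then have nB: "real n powr (- 2 * m / d) \<le> B * lam n" and n: "n \<ge> 1"
        using assms(13)[of n] by (auto simp: d_def)
      define F where "F = ip_norm ip (f n)"
      have F: "0 \<le> F" unfolding F_def by (rule ip_norm_nonneg[OF assms(12)])
      have "real n powr (- m / d) = sqrt (real n powr (- 2 * m / d))"
        by (simp add: powr_half_sqrt[symmetric] powr_powr)
      also have "\<dots> \<le> sqrt (B * lam n)" using nB by simp
      finally have rate: "real n powr (- m / d) \<le> sqrt B * sqrt (lam n)" by (simp add: real_sqrt_mult)
      \<comment> \<open>A non-measurable event has measure \<open>0\<close> by convention; then \<open>\<epsilon> \<ge> 1\<close> and the empty event will do.\<close>
      define A where "A = (if Ev C1 C2 n \<in> sets M then Ev C1 C2 n else {})"
      have A: "A \<in> sets M" "1 - \<epsilon> \<le> measure M A"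
        using ev[OF n] measure_notin_sets[of "Ev C1 C2 n" M] by (auto simp: A_def)
      have bound: "\<bar>errors_mean_krr_deriv M \<Omega> H ip \<alpha> n (lam n) (f n) (X n) e \<omega> x - multi_deriv \<Omega> \<alpha> (f n) x\<bar> \<le>
          C * (L + 2) * (lam n powr (1 / 2 - (d + 2 * real k) / (4 * m)) * F)"
        if "\<omega> \<in> A" and x: "x \<in> \<Omega>" for \<omega> x
      proof -
        have \<omega>: "\<omega> \<in> Ev C1 C2 n" using that(1) by (auto simp: A_def split: if_splits)
        then have "\<omega> \<in> space M" by (simp add: Ev_def)
        from bias[OF n this] obtain g where g: "g \<in> H" "empirical_norm n (\<lambda>i. X n i \<omega>) g \<le> sqrt (lam n) * F"
          "ip_norm ip g \<le> 2 * F"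
          and eq: "errors_mean_krr_deriv M \<Omega> H ip \<alpha> n (lam n) (f n) (X n) e \<omega> x - multi_deriv \<Omega> \<alpha> (f n) x =
            iter_partial_deriv \<Omega> js g x" using x by (auto simp: F_def)
        have "norm_L2 \<Omega> g \<le> max (C1 * empirical_norm n (\<lambda>i. X n i \<omega>) g) (C2 * real n powr (- m / d) * ip_norm ip g)"
          using \<omega> g(1) by (simp add: Ev_def d_def)
        also have "\<dots> \<le> C1 * (sqrt (lam n) * F) + C2 * (sqrt B * sqrt (lam n)) * (2 * F)"
        proof (rule max.boundedI)
          have 1: "C1 * empirical_norm n (\<lambda>i. X n i \<omega>) g \<le> C1 * (sqrt (lam n) * F)"
            using C1 g(2) by (intro mult_left_mono) auto
          have 2: "C2 * real n powr (- m / d) * ip_norm ip g \<le> C2 * (sqrt B * sqrt (lam n)) * (2 * F)"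
            using C2 B rate g(3) ip_norm_nonneg[OF g(1)] assms(13)[of n] by (intro mult_mono) auto
          have 3: "0 \<le> C1 * (sqrt (lam n) * F)" "0 \<le> C2 * (sqrt B * sqrt (lam n)) * (2 * F)"
            using C1 C2 B F assms(13)[of n] by auto
          show "C1 * empirical_norm n (\<lambda>i. X n i \<omega>) g \<le> C1 * (sqrt (lam n) * F) + C2 * (sqrt B * sqrt (lam n)) * (2 * F)"
            using 1 3(2) by linarith
          show "C2 * real n powr (- m / d) * ip_norm ip g \<le> C1 * (sqrt (lam n) * F) + C2 * (sqrt B * sqrt (lam n)) * (2 * F)"
            using 2 3(1) by linarith
        qed
        also have "\<dots> = L * sqrt (lam n) * F" by (simp add: L_def algebra_simps)
        finally have L2: "norm_L2 \<Omega> g \<le> L * sqrt (lam n) * F" .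
        show ?thesis
          unfolding eq
          by (rule smoothing_scale_bound[OF assms(13) m m0 F L C L2 g(3) Db[OF g(1) x] Dh[OF g(1) x]])
      qed
      show "\<exists>A\<in>sets M. 1 - \<epsilon> \<le> measure M A \<and>
        (\<forall>\<omega>\<in>A. \<bar>?Z n \<omega>\<bar> \<le> ereal (C * (L + 2) * ?r n))"
      proof (intro bexI[OF _ A(1)] conjI ballI A(2))
        fix \<omega> assume \<omega>: "\<omega> \<in> A"
        obtain x0 where x0: "x0 \<in> \<Omega>" using assms(3) interior_subset by blast
        have "0 \<le> ?Z n \<omega>" by (rule SUP_upper2[OF x0]) simp
        moreover have "?Z n \<omega> \<le> ereal (C * (L + 2) * (lam n powr (1 / 2 - (d + 2 * real k) / (4 * m)) * F))"
          by (rule SUP_least) (simp only: ereal_less_eq bound[OF \<omega>])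
        ultimately show "\<bar>?Z n \<omega>\<bar> \<le> ereal (C * (L + 2) * ?r n)"
          by (simp only: abs_ereal_ge0 d_def k_def F_def)
      qed
    qed
  qed
qed

end
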